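(* Let $H,K$ be finite-dimensional Hilbert spaces and $A\subseteq\mathcal{L}(H)$, $B\subseteq\mathcal{L}(K)$ nondegenerate $C^{*}$-subalgebras; let $N$ be a finite-dimensional $C^{*}$-algebra with a faithful state $\mu$ and injective unital $*$-homomorphisms $\rho\colon N^{op}\to A$, $\sigma\colon N\to B$; let $(\mathfrak{H},\mathfrak{B},\mathfrak{B}^{\dagger})$ be a finite-dimensional standard $C^{*}$-base with bicyclic vector $\zeta\in\mathfrak{H}$; let $\alpha$ be a $C^{*}$-factorization of $H$ with respect to $(\mathfrak{H},\mathfrak{B},\mathfrak{B}^{\dagger})$ with $\rho_{\alpha}(\mathfrak{B}^{\dagger})\subseteq A$, and $\beta$ a $C^{*}$-factorization of $K$ with respect to $(\mathfrak{H},\mathfrak{B}^{\dagger},\mathfrak{B})$ with $\rho_{\beta}(\mathfrak{B})\subseteq B$. Let $U\colon\mathfrak{H}\to H_{\mu}$ be a unitary such that $$U\mathfrak{B}U^{*}=\pi_{\mu}(N),\quad U\mathfrak{B}^{\dagger}U^{*}=\pi_{\mu}^{op}(N^{op}),\quad U\zeta=\zeta_{\mu},\quad \rho=\rho_{\alpha}\circ\mathrm{Ad}_{U^{*}}\circ\pi_{\mu}^{op},\quad \sigma=\rho_{\beta}\circ\mathrm{Ad}_{U^{*}}\circ\pi_{\mu}.$$ Then conjugation by the unitary $\Phi^{U,\zeta}_{\alpha,\beta}\colon H\,{}_{\rho}\underset{\mu}{\otimes}{}_{\sigma}\,K\to H\,{}_{\alpha}\underset{\mathfrak{H}}{\otimes}{}_{\beta}\,K$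 induces an isomorphism $$\phi^{U,\zeta}_{\alpha,\beta}\colon A\,{}_{\rho}\underset{\mu}{\ast}{}_{\sigma}\,B\xrightarrow{\ \cong\ }A\,{}_{\alpha}\underset{\mathfrak{H}}{\ast}{}_{\beta}\,B .$$
   Context: Inner products are conjugate-linear in the first variable. $[Y]$ denotes the closed linear span; $XY$ the set of products; $X'$ the commutant of a set $X$ of operators; $\mathrm{Ad}_{U}(x)=UxU^{*}$. A $C^{*}$-base is a triple $(\mathfrak{H},\mathfrak{B},\mathfrak{B}^{\dagger})$ of a Hilbert space $\mathfrak{H}$ and two commuting nondegenerate $C^{*}$-algebras $\mathfrak{B},\mathfrak{B}^{\dagger}\subseteq\mathcal{L}(\mathfrak{H})$; it is finite-dimensional if $\dim\mathfrak{H}<\infty$, and standard if there is a bicyclic vector, i.e. a vector cyclic for both $\mathfrak{B}$ and $\mathfrak{B}^{\dagger}$. A $C^{*}$-factorization of $H$ with respect to $(\mathfrak{H},\mathfrak{B},\mathfrak{B}^{\dagger})$ is a closed subspace $\alpha\subseteq\mathcal{L}(\mathfrak{H},H)$ with $[\alpha^{*}\alpha]=\mathfrak{B}$, $[\alpha\mathfrak{B}]=\alpha$, $[\alpha\mathfrak{H}]=H$; it determines a unique nondegenerate faithful representation $\rho_{\alpha}\colon\mathfrak{B}^{\dagger}\to\mathcal{L}(H)$ with $\rho_{\alpha}(b^{\dagger})\xi\omega=\xi b^{\dagger}\omega$ for $b^{\dagger}\in\mathfrak{B}^{\dagger}$, $\xi\in\alpha$, $\omega\in\mathfrak{H}$.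 Similarly, $\beta$ (with respect to $(\mathfrak{H},\mathfrak{B}^{\dagger},\mathfrak{B})$) determines $\rho_{\beta}\colon\mathfrak{B}\to\mathcal{L}(K)$. $(H_{\mu},\pi_{\mu},\zeta_{\mu})$ is a GNS-representation for $\mu$, $J_{\mu}$ the modular conjugation (antiunitary part of the polar decomposition of $\pi_{\mu}(b)\zeta_{\mu}\mapsto\pi_{\mu}(b^{*})\zeta_{\mu}$), and $\pi_{\mu}^{op}(b^{op})=J_{\mu}\pi_{\mu}(b)^{*}J_{\mu}$. Relative tensor products: for $\xi\in H$, $\eta\in K$ let $R^{\rho}_{\mu^{op}}(\xi)\colon H_{\mu}\to H$, $\pi_{\mu}^{op}(b^{op})\zeta_{\mu}\mapsto\rho(b^{op})\xi$, and $R^{\sigma}_{\mu}(\eta)\colon H_{\mu}\to K$, $\pi_{\mu}(b)\zeta_{\mu}\mapsto\sigma(b)\eta$. $H\,{}_{\rho}\underset{\mu}{\otimes}{}_{\sigma}\,K$ is the quotient of $H\otimes K$ by the null space of the form $\langle\xi\otimes\eta|\xi'\otimes\eta'\rangle_{\mu}=\langle R^{\rho}_{\mu^{op}}(\xi')^{*}R^{\rho}_{\mu^{op}}(\xi)\zeta_{\mu}|R^{\sigma}_{\mu}(\eta)^{*}R^{\sigma}_{\mu}(\eta')\zeta_{\mu}\rangle$, with $\xi\,{}_{\rho}\underset{\mu}{\otimes}{}_{\sigma}\,\eta$ the class of $\xi\otimes\eta$. $H\,{}_{\alpha}\underset{\mathfrak{H}}{\otimes}{}_{\beta}\,K$ is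 the separated completion of the algebraic tensor product of $\alpha,\mathfrak{H},\beta$ with respect to $\langle\xi\otimes\omega\otimes\eta|\xi'\otimes\omega'\otimes\eta'\rangle=\langle\omega|(\xi^{*}\xi')(\eta^{*}\eta')\omega'\rangle$. $\Phi^{U,\zeta}_{\alpha,\beta}$ is the (well-defined) unitary $\xi\,{}_{\rho}\underset{\mu}{\otimes}{}_{\sigma}\,\eta\mapsto R^{\rho}_{\mu^{op}}(\xi)U\otimes\zeta\otimes R^{\sigma}_{\mu}(\eta)U$. Classical fiber product: for $S\in A'$, $T\in B'$ let $S\,{}_{\rho}\underset{\mu}{\otimes}{}_{\sigma}\,T$ be the operator $\xi\,{}_{\rho}\underset{\mu}{\otimes}{}_{\sigma}\,\eta\mapsto S\xi\,{}_{\rho}\underset{\mu}{\otimes}{}_{\sigma}\,T\eta$. Then $A\,{}_{\rho}\underset{\mu}{\ast}{}_{\sigma}\,B=\{S\,{}_{\rho}\underset{\mu}{\otimes}{}_{\sigma}\,T\mid S\in A',T\in B'\}'\subseteq\mathcal{L}(H\,{}_{\rho}\underset{\mu}{\otimes}{}_{\sigma}\,K)$. Spatial $C^{*}$-fiber product: for $\xi\in\alpha$ let $|\xi\rangle_{[1]}\colon K\to H\,{}_{\alpha}\underset{\mathfrak{H}}{\otimes}{}_{\beta}\,K$ be the operator with $\eta\omega\mapsto\xi\otimes\omega\otimes\eta$ $(\eta\in\beta,\omega\in\mathfrak{H})$, and for $\eta\in\beta$ let $|\eta\rangle_{[2]}\colon H\to H\,{}_{\alpha}\underset{\mathfrak{H}}{\otimes}{}_{\beta}\,K$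 be the operator with $\xi\omega\mapsto\xi\otimes\omega\otimes\eta$ $(\xi\in\alpha,\omega\in\mathfrak{H})$. Put $|\alpha\rangle_{[1]}=\{|\xi\rangle_{[1]}\mid\xi\in\alpha\}$, $|\beta\rangle_{[2]}=\{|\eta\rangle_{[2]}\mid\eta\in\beta\}$. Then $A\,{}_{\alpha}\underset{\mathfrak{H}}{\ast}{}_{\beta}\,B$ is the set of all $T\in\mathcal{L}(H\,{}_{\alpha}\underset{\mathfrak{H}}{\otimes}{}_{\beta}\,K)$ such that $T|\alpha\rangle_{[1]}$ and $T^{*}|\alpha\rangle_{[1]}$ are contained in $[|\alpha\rangle_{[1]}B]$, and $T|\beta\rangle_{[2]}$ and $T^{*}|\beta\rangle_{[2]}$ are contained in $[|\beta\rangle_{[2]}A]$. *)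

theory Defs
  imports
    "HOL-Algebra.Module"
    "HOL-Algebra.AbelCoset"
    "HOL-Analysis.Abstract_Metric_Spaces"
    "HOL-Library.Poly_Mapping"
    "HOL-Library.Nonpos_Ints"
begin

text \<open>
  All spaces are carrier-based structures extending the \<open>module\<close> record of HOL-Algebra, so that
  the quotient spaces that occur as relative tensor products are structures of the same kind as
  the given Hilbert spaces. The fields \<open>mult\<close> and \<open>one\<close> inherited from \<open>ring\<close> are meaningful only
  for algebras.
\<close>

definition CC :: "complex ring" where
  "CC = \<lparr>carrier = UNIV, mult = (*), one = 1, zero = 0, add = (+)\<rparr>"

record 'a normed = "(complex, 'a) module" +
  nrm :: "'a \<Rightarrow> real"

record 'a hilb = "'a normed" +
  ip :: "'a \<Rightarrow> 'a \<Rightarrow> complex"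

record 'a cstar = "'a normed" +
  star :: "'a \<Rightarrow> 'a"

definition complete_space :: "('a, 'm) normed_scheme \<Rightarrow> bool" where
  "complete_space V \<longleftrightarrow> Metric_space.mcomplete (carrier V) (\<lambda>x y. nrm V (x \<ominus>\<^bsub>V\<^esub> y))"

definition lspan :: "(complex, 'a, 'm) module_scheme \<Rightarrow> 'a set \<Rightarrow> 'a set" where
  "lspan V Y = \<Inter>{W. submodule W CC V \<and> Y \<subseteq> W}"

definition fin_dim :: "(complex, 'a, 'm) module_scheme \<Rightarrow> bool" where
  "fin_dim V \<longleftrightarrow> (\<exists>B. finite B \<and> B \<subseteq> carrier V \<and> lspan V B = carrier V)"

definition cspan :: "('a, 'm) normed_scheme \<Rightarrow> 'a set \<Rightarrow> 'a set" where
  "cspan V Y = {x \<in> carrier V. \<forall>e>0. \<exists>y\<in>lspan V Y. nrm V (x \<ominus>\<^bsub>V\<^esub> y) < e}"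

definition closed_subspace :: "('a, 'm) normed_scheme \<Rightarrow> 'a set \<Rightarrow> bool" where
  "closed_subspace V W \<longleftrightarrow> submodule W CC V \<and> cspan V W = W"

locale hilbert_space = Module.module CC V for V :: "('a, 'm) hilb_scheme" (structure) +
  assumes ip_add: "\<lbrakk>x \<in> carrier V; y \<in> carrier V; z \<in> carrier V\<rbrakk>
      \<Longrightarrow> ip V x (y \<oplus>\<^bsub>V\<^esub> z) = ip V x y + ip V x z"
    and ip_smult: "\<lbrakk>x \<in> carrier V; y \<in> carrier V\<rbrakk> \<Longrightarrow> ip V x (c \<odot>\<^bsub>V\<^esub> y) = c * ip V x y"
    and ip_commute: "\<lbrakk>x \<in> carrier V; y \<in> carrier V\<rbrakk> \<Longrightarrow> ip V y x = cnj (ip V x y)"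
    and ip_pos: "\<lbrakk>x \<in> carrier V; x \<noteq> \<zero>\<^bsub>V\<^esub>\<rbrakk> \<Longrightarrow> Re (ip V x x) > 0"
    and nrm_eq: "x \<in> carrier V \<Longrightarrow> nrm V x = sqrt (Re (ip V x x))"
    and complete: "complete_space V"

text \<open>Unital C*-algebras; every finite-dimensional C*-algebra is unital.\<close>

locale cstar_algebra = Module.module CC N + ring N for N :: "('a, 'm) cstar_scheme" (structure) +
  assumes smult_mult_left: "\<lbrakk>x \<in> carrier N; y \<in> carrier N\<rbrakk>
      \<Longrightarrow> (c \<odot>\<^bsub>N\<^esub> x) \<otimes>\<^bsub>N\<^esub> y = c \<odot>\<^bsub>N\<^esub> (x \<otimes>\<^bsub>N\<^esub> y)"
    and smult_mult_right: "\<lbrakk>x \<in> carrier N; y \<in> carrier N\<rbrakk>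
      \<Longrightarrow> x \<otimes>\<^bsub>N\<^esub> (c \<odot>\<^bsub>N\<^esub> y) = c \<odot>\<^bsub>N\<^esub> (x \<otimes>\<^bsub>N\<^esub> y)"
    and star_closed: "x \<in> carrier N \<Longrightarrow> star N x \<in> carrier N"
    and star_add: "\<lbrakk>x \<in> carrier N; y \<in> carrier N\<rbrakk> \<Longrightarrow> star N (x \<oplus>\<^bsub>N\<^esub> y) = star N x \<oplus>\<^bsub>N\<^esub> star N y"
    and star_smult: "x \<in> carrier N \<Longrightarrow> star N (c \<odot>\<^bsub>N\<^esub> x) = cnj c \<odot>\<^bsub>N\<^esub> star N x"
    and star_mult: "\<lbrakk>x \<in> carrier N; y \<in> carrier N\<rbrakk> \<Longrightarrow> star N (x \<otimes>\<^bsub>N\<^esub> y) = star N y \<otimes>\<^bsub>N\<^esub> star N x"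
    and star_star: "x \<in> carrier N \<Longrightarrow> star N (star N x) = x"
    and nrm_nonneg: "x \<in> carrier N \<Longrightarrow> nrm N x \<ge> 0"
    and nrm_eq_0: "x \<in> carrier N \<Longrightarrow> nrm N x = 0 \<longleftrightarrow> x = \<zero>\<^bsub>N\<^esub>"
    and nrm_triangle: "\<lbrakk>x \<in> carrier N; y \<in> carrier N\<rbrakk> \<Longrightarrow> nrm N (x \<oplus>\<^bsub>N\<^esub> y) \<le> nrm N x + nrm N y"
    and nrm_smult: "x \<in> carrier N \<Longrightarrow> nrm N (c \<odot>\<^bsub>N\<^esub> x) = cmod c * nrm N x"
    and nrm_mult: "\<lbrakk>x \<in> carrier N; y \<in> carrier N\<rbrakk> \<Longrightarrow> nrm N (x \<otimes>\<^bsub>N\<^esub> y) \<le> nrm N x * nrm N y"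
    and nrm_star_mult: "x \<in> carrier N \<Longrightarrow> nrm N (star N x \<otimes>\<^bsub>N\<^esub> x) = (nrm N x)\<^sup>2"
    and complete: "complete_space N"

text \<open>The opposite algebra has the same elements, that is, \<open>b\<^sup>o\<^sup>p\<close> is represented by \<open>b\<close> itself.\<close>

definition opposite :: "('a, 'm) cstar_scheme \<Rightarrow> ('a, 'm) cstar_scheme" where
  "opposite N = N\<lparr>mult := (\<lambda>x y. y \<otimes>\<^bsub>N\<^esub> x)\<rparr>"

definition star_hom :: "('a, 'm) cstar_scheme \<Rightarrow> ('b, 'n) cstar_scheme \<Rightarrow> ('a \<Rightarrow> 'b) set" where
  "star_hom M N = {f \<in> carrier M \<rightarrow> carrier N.
     (\<forall>x\<in>carrier M. \<forall>y\<in>carrier M. f (x \<oplus>\<^bsub>M\<^esub> y) = f x \<oplus>\<^bsub>N\<^esub> f y) \<and>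
     (\<forall>c. \<forall>x\<in>carrier M. f (c \<odot>\<^bsub>M\<^esub> x) = c \<odot>\<^bsub>N\<^esub> f x) \<and>
     (\<forall>x\<in>carrier M. \<forall>y\<in>carrier M. f (x \<otimes>\<^bsub>M\<^esub> y) = f x \<otimes>\<^bsub>N\<^esub> f y) \<and>
     (\<forall>x\<in>carrier M. f (star M x) = star N (f x))}"

definition star_iso :: "('a, 'm) cstar_scheme \<Rightarrow> ('b, 'n) cstar_scheme \<Rightarrow> ('a \<Rightarrow> 'b) set" where
  "star_iso M N = {f \<in> star_hom M N. bij_betw f (carrier M) (carrier N)}"

definition faithful_state :: "('a, 'm) cstar_scheme \<Rightarrow> ('a \<Rightarrow> complex) \<Rightarrow> bool" where
  "faithful_state N \<mu> \<longleftrightarrow>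
     (\<forall>x\<in>carrier N. \<forall>y\<in>carrier N. \<mu> (x \<oplus>\<^bsub>N\<^esub> y) = \<mu> x + \<mu> y) \<and>
     (\<forall>c. \<forall>x\<in>carrier N. \<mu> (c \<odot>\<^bsub>N\<^esub> x) = c * \<mu> x) \<and>
     (\<forall>x\<in>carrier N. \<mu> (star N x \<otimes>\<^bsub>N\<^esub> x) \<in> \<real>\<^sub>\<ge>\<^sub>0) \<and>
     \<mu> \<one>\<^bsub>N\<^esub> = 1 \<and>
     (\<forall>x\<in>carrier N. \<mu> (star N x \<otimes>\<^bsub>N\<^esub> x) = 0 \<longrightarrow> x = \<zero>\<^bsub>N\<^esub>)"


section \<open>Operators between Hilbert spaces\<close>

text \<open>
  Operators are extensional functions on the carrier, so that equality of operators is equality of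
  functions, and \<open>S\<close> after \<open>T\<close> with \<open>T\<close> defined on \<open>V\<close> is \<open>compose (carrier V) S T\<close>.
  Operators given by a prescription on a total subset are introduced by \<open>THE\<close>; this presupposes that
  the prescription is well-defined and bounded, which holds in the situations considered.
\<close>

definition Ops :: "('a, 'm) hilb_scheme \<Rightarrow> ('b, 'n) hilb_scheme \<Rightarrow> ('a \<Rightarrow> 'b) normed" where
  "Ops V W = \<lparr>
     carrier = {T \<in> carrier V \<rightarrow>\<^sub>E carrier W.
       (\<forall>x\<in>carrier V. \<forall>y\<in>carrier V. T (x \<oplus>\<^bsub>V\<^esub> y) = T x \<oplus>\<^bsub>W\<^esub> T y) \<and>
       (\<forall>c. \<forall>x\<in>carrier V. T (c \<odot>\<^bsub>V\<^esub> x) = c \<odot>\<^bsub>W\<^esub> T x) \<and>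
       (\<exists>C. \<forall>x\<in>carrier V. nrm W (T x) \<le> C * nrm V x)},
     mult = undefined,
     one = undefined,
     zero = (\<lambda>x\<in>carrier V. \<zero>\<^bsub>W\<^esub>),
     add = (\<lambda>S T. \<lambda>x\<in>carrier V. S x \<oplus>\<^bsub>W\<^esub> T x),
     smult = (\<lambda>c T. \<lambda>x\<in>carrier V. c \<odot>\<^bsub>W\<^esub> T x),
     nrm = (\<lambda>T. SUP x\<in>{x \<in> carrier V. nrm V x \<le> 1}. nrm W (T x))\<rparr>"

definition adj :: "('a, 'm) hilb_scheme \<Rightarrow> ('b, 'n) hilb_scheme \<Rightarrow> ('a \<Rightarrow> 'b) \<Rightarrow> 'b \<Rightarrow> 'a" where
  "adj V W T = (THE S. S \<in> carrier (Ops W V) \<and>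
     (\<forall>x\<in>carrier V. \<forall>y\<in>carrier W. ip W (T x) y = ip V x (S y)))"

definition Lalg :: "('a, 'm) hilb_scheme \<Rightarrow> ('a \<Rightarrow> 'a) cstar" where
  "Lalg V = \<lparr>
     carrier = carrier (Ops V V),
     mult = compose (carrier V),
     one = (\<lambda>x\<in>carrier V. x),
     zero = zero (Ops V V),
     add = add (Ops V V),
     smult = smult (Ops V V),
     nrm = nrm (Ops V V),
     star = adj V V\<rparr>"

definition unitary :: "('a, 'm) hilb_scheme \<Rightarrow> ('b, 'n) hilb_scheme \<Rightarrow> ('a \<Rightarrow> 'b) \<Rightarrow> bool" where
  "unitary V W U \<longleftrightarrow> U \<in> carrier (Ops V W) \<and> bij_betw U (carrier V) (carrier W) \<and>
     (\<forall>x\<in>carrier V. \<forall>y\<in>carrier V. ip W (U x) (U y) = ip V x y)"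

definition antiunitary :: "('a, 'm) hilb_scheme \<Rightarrow> ('b, 'n) hilb_scheme \<Rightarrow> ('a \<Rightarrow> 'b) \<Rightarrow> bool" where
  "antiunitary V W J \<longleftrightarrow> J \<in> carrier V \<rightarrow>\<^sub>E carrier W \<and> bij_betw J (carrier V) (carrier W) \<and>
     (\<forall>x\<in>carrier V. \<forall>y\<in>carrier V. J (x \<oplus>\<^bsub>V\<^esub> y) = J x \<oplus>\<^bsub>W\<^esub> J y) \<and>
     (\<forall>c. \<forall>x\<in>carrier V. J (c \<odot>\<^bsub>V\<^esub> x) = cnj c \<odot>\<^bsub>W\<^esub> J x) \<and>
     (\<forall>x\<in>carrier V. \<forall>y\<in>carrier V. ip W (J x) (J y) = ip V y x)"

definition positive_op :: "('a, 'm) hilb_scheme \<Rightarrow> ('a \<Rightarrow> 'a) \<Rightarrow> bool" where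
  "positive_op V D \<longleftrightarrow> D \<in> carrier (Lalg V) \<and> (\<forall>x\<in>carrier V. ip V x (D x) \<in> \<real>\<^sub>\<ge>\<^sub>0)"

text \<open>\<open>Ad V W U T\<close> is \<open>U T U*\<close> for \<open>U\<close> from \<open>V\<close> to \<open>W\<close> and \<open>T\<close> on \<open>V\<close>.\<close>

definition Ad :: "('a, 'm) hilb_scheme \<Rightarrow> ('b, 'n) hilb_scheme \<Rightarrow> ('a \<Rightarrow> 'b) \<Rightarrow> ('a \<Rightarrow> 'a) \<Rightarrow> 'b \<Rightarrow> 'b" where
  "Ad V W U T = compose (carrier W) U (compose (carrier W) T (adj V W U))"

definition commutant :: "('a, 'm) hilb_scheme \<Rightarrow> ('a \<Rightarrow> 'a) set \<Rightarrow> ('a \<Rightarrow> 'a) set" where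
  "commutant V X = {T \<in> carrier (Lalg V). \<forall>S\<in>X. T \<otimes>\<^bsub>Lalg V\<^esub> S = S \<otimes>\<^bsub>Lalg V\<^esub> T}"

definition cstar_subalgebra :: "('a \<Rightarrow> 'a) set \<Rightarrow> ('a, 'm) hilb_scheme \<Rightarrow> bool" where
  "cstar_subalgebra A V \<longleftrightarrow> closed_subspace (Lalg V) A \<and>
     (\<forall>S\<in>A. \<forall>T\<in>A. S \<otimes>\<^bsub>Lalg V\<^esub> T \<in> A) \<and> (\<forall>T\<in>A. adj V V T \<in> A)"

definition nondegenerate :: "('a \<Rightarrow> 'a) set \<Rightarrow> ('a, 'm) hilb_scheme \<Rightarrow> bool" where
  "nondegenerate A V \<longleftrightarrow> cspan V {T x |T x. T \<in> A \<and> x \<in> carrier V} = carrier V"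

definition cyclic :: "('a \<Rightarrow> 'a) set \<Rightarrow> ('a, 'm) hilb_scheme \<Rightarrow> 'a \<Rightarrow> bool" where
  "cyclic A V z \<longleftrightarrow> z \<in> carrier V \<and> cspan V {T z |T. T \<in> A} = carrier V"


section \<open>C*-bases and C*-factorizations\<close>

definition cstar_base :: "('g, 'm) hilb_scheme \<Rightarrow> ('g \<Rightarrow> 'g) set \<Rightarrow> ('g \<Rightarrow> 'g) set \<Rightarrow> bool" where
  "cstar_base G B Bd \<longleftrightarrow> hilbert_space G \<and>
     cstar_subalgebra B G \<and> nondegenerate B G \<and>
     cstar_subalgebra Bd G \<and> nondegenerate Bd G \<and>
     (\<forall>b\<in>B. \<forall>c\<in>Bd. b \<otimes>\<^bsub>Lalg G\<^esub> c = c \<otimes>\<^bsub>Lalg G\<^esub> b)"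

definition bicyclic ::
  "('g, 'm) hilb_scheme \<Rightarrow> ('g \<Rightarrow> 'g) set \<Rightarrow> ('g \<Rightarrow> 'g) set \<Rightarrow> 'g \<Rightarrow> bool" where
  "bicyclic G B Bd z \<longleftrightarrow> cyclic B G z \<and> cyclic Bd G z"

definition cstar_factorization :: "('h, 'n) hilb_scheme \<Rightarrow> ('g, 'm) hilb_scheme \<Rightarrow>
    ('g \<Rightarrow> 'g) set \<Rightarrow> ('g \<Rightarrow> 'g) set \<Rightarrow> ('g \<Rightarrow> 'h) set \<Rightarrow> bool" where
  "cstar_factorization H G B Bd \<alpha> \<longleftrightarrow> cstar_base G B Bd \<and>
     closed_subspace (Ops G H) \<alpha> \<and>
     cspan (Lalg G) {compose (carrier G) (adj G H \<xi>) \<xi>' |\<xi> \<xi>'. \<xi> \<in> \<alpha> \<and> \<xi>' \<in> \<alpha>} = B \<and>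
     cspan (Ops G H) {compose (carrier G) \<xi> b |\<xi> b. \<xi> \<in> \<alpha> \<and> b \<in> B} = \<alpha> \<and>
     cspan H {\<xi> \<omega> |\<xi> \<omega>. \<xi> \<in> \<alpha> \<and> \<omega> \<in> carrier G} = carrier H"

definition fact_rep :: "('h, 'n) hilb_scheme \<Rightarrow> ('g, 'm) hilb_scheme \<Rightarrow>
    ('g \<Rightarrow> 'h) set \<Rightarrow> ('g \<Rightarrow> 'g) \<Rightarrow> 'h \<Rightarrow> 'h" where
  "fact_rep H G \<alpha> c = (THE T. T \<in> carrier (Lalg H) \<and>
     (\<forall>\<xi>\<in>\<alpha>. \<forall>\<omega>\<in>carrier G. T (\<xi> \<omega>) = \<xi> (c \<omega>)))"


section \<open>GNS-representations\<close>

definition GNS :: "('n, 'p) cstar_scheme \<Rightarrow> ('n \<Rightarrow> complex) \<Rightarrow>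
    ('v, 'm) hilb_scheme \<Rightarrow> ('n \<Rightarrow> 'v \<Rightarrow> 'v) \<Rightarrow> 'v \<Rightarrow> bool" where
  "GNS N \<mu> V \<pi> z \<longleftrightarrow> hilbert_space V \<and> \<pi> \<in> star_hom N (Lalg V) \<and>
     cyclic (\<pi> ` carrier N) V z \<and> (\<forall>b\<in>carrier N. \<mu> b = ip V z (\<pi> b z))"

text \<open>
  The antiunitary part \<open>J\<close> of the polar decomposition \<open>J D\<close> of the map \<open>\<pi> b z \<mapsto> \<pi> (b*) z\<close>.
  For finite-dimensional \<open>N\<close> the latter is defined on all of \<open>V\<close>, hence \<open>D\<close> is a bounded operator.
\<close>

definition modular_conj :: "('n, 'p) cstar_scheme \<Rightarrow> ('v, 'm) hilb_scheme \<Rightarrow>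
    ('n \<Rightarrow> 'v \<Rightarrow> 'v) \<Rightarrow> 'v \<Rightarrow> 'v \<Rightarrow> 'v" where
  "modular_conj N V \<pi> z = (THE J. antiunitary V V J \<and>
     (\<exists>D. positive_op V D \<and> (\<forall>b\<in>carrier N. J (D (\<pi> b z)) = \<pi> (star N b) z)))"

definition GNS_op :: "('n, 'p) cstar_scheme \<Rightarrow> ('v, 'm) hilb_scheme \<Rightarrow>
    ('n \<Rightarrow> 'v \<Rightarrow> 'v) \<Rightarrow> 'v \<Rightarrow> 'n \<Rightarrow> 'v \<Rightarrow> 'v" where
  "GNS_op N V \<pi> z b = (let J = modular_conj N V \<pi> z in
     compose (carrier V) J (compose (carrier V) (adj V V (\<pi> b)) J))"


section \<open>Relative tensor products\<close>

text \<open>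
  The separated space of a positive sesquilinear form on an algebraic tensor product.
  The elements of \<open>X\<close> are the tuples representing elementary tensors and \<open>\<phi>\<close> is the form on
  elementary tensors. Starting from the free vector space over \<open>X\<close> and dividing by the null space
  of the sesquilinear extension of \<open>\<phi>\<close> gives the quotient of the algebraic tensor product, because
  the null space contains the multilinearity relations whenever \<open>\<phi>\<close> is multilinear (conjugate-linear
  in the components of its first argument). No completion is needed in finite dimensions.
\<close>

definition free_space :: "'x set \<Rightarrow> (complex, 'x \<Rightarrow>\<^sub>0 complex) module" where
  "free_space X = \<lparr>
     carrier = {u. Poly_Mapping.keys u \<subseteq> X},
     mult = undefined,
     one = undefined,
     zero = 0,
     add = (+),
     smult = (\<lambda>c. Poly_Mapping.map ((*) c))\<rparr>"

definition sesq :: "('x \<Rightarrow> 'x \<Rightarrow> complex) \<Rightarrow> ('x \<Rightarrow>\<^sub>0 complex) \<Rightarrow> ('x \<Rightarrow>\<^sub>0 complex) \<Rightarrow> complex" where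
  "sesq \<phi> u v = (\<Sum>x\<in>Poly_Mapping.keys u. \<Sum>y\<in>Poly_Mapping.keys v.
     cnj (Poly_Mapping.lookup u x) * Poly_Mapping.lookup v y * \<phi> x y)"

definition null_space :: "'x set \<Rightarrow> ('x \<Rightarrow> 'x \<Rightarrow> complex) \<Rightarrow> ('x \<Rightarrow>\<^sub>0 complex) set" where
  "null_space X \<phi> = {u \<in> carrier (free_space X). \<forall>v\<in>carrier (free_space X). sesq \<phi> u v = 0}"

definition sep_ip :: "('x \<Rightarrow> 'x \<Rightarrow> complex) \<Rightarrow> ('x \<Rightarrow>\<^sub>0 complex) set \<Rightarrow> ('x \<Rightarrow>\<^sub>0 complex) set \<Rightarrow> complex" where
  "sep_ip \<phi> P Q = sesq \<phi> (SOME u. u \<in> P) (SOME v. v \<in> Q)"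

definition sep_space :: "'x set \<Rightarrow> ('x \<Rightarrow> 'x \<Rightarrow> complex) \<Rightarrow> ('x \<Rightarrow>\<^sub>0 complex) set hilb" where
  "sep_space X \<phi> = (let F = free_space X; Z = null_space X \<phi> in \<lparr>
     carrier = a_rcosets\<^bsub>F\<^esub> Z,
     mult = undefined,
     one = undefined,
     zero = Z,
     add = set_add F,
     smult = (\<lambda>c P. \<Union>u\<in>P. Z +>\<^bsub>F\<^esub> (c \<odot>\<^bsub>F\<^esub> u)),
     nrm = (\<lambda>P. sqrt (Re (sep_ip \<phi> P P))),
     ip = sep_ip \<phi>\<rparr>)"

definition sep_class :: "'x set \<Rightarrow> ('x \<Rightarrow> 'x \<Rightarrow> complex) \<Rightarrow> 'x \<Rightarrow> ('x \<Rightarrow>\<^sub>0 complex) set" where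
  "sep_class X \<phi> x = null_space X \<phi> +>\<^bsub>free_space X\<^esub> Poly_Mapping.single x 1"

definition R_mu :: "('n, 'p) cstar_scheme \<Rightarrow> ('v, 'm) hilb_scheme \<Rightarrow> ('n \<Rightarrow> 'v \<Rightarrow> 'v) \<Rightarrow> 'v \<Rightarrow>
    ('k, 'q) hilb_scheme \<Rightarrow> ('n \<Rightarrow> 'k \<Rightarrow> 'k) \<Rightarrow> 'k \<Rightarrow> 'v \<Rightarrow> 'k" where
  "R_mu N V \<pi> z K \<sigma> \<eta> = (THE T. T \<in> carrier (Ops V K) \<and>
     (\<forall>b\<in>carrier N. T (\<pi> b z) = \<sigma> b \<eta>))"

definition R_muop :: "('n, 'p) cstar_scheme \<Rightarrow> ('v, 'm) hilb_scheme \<Rightarrow> ('n \<Rightarrow> 'v \<Rightarrow> 'v) \<Rightarrow> 'v \<Rightarrow>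
    ('h, 'q) hilb_scheme \<Rightarrow> ('n \<Rightarrow> 'h \<Rightarrow> 'h) \<Rightarrow> 'h \<Rightarrow> 'v \<Rightarrow> 'h" where
  "R_muop N V \<pi> z H \<rho> \<xi> = (THE T. T \<in> carrier (Ops V H) \<and>
     (\<forall>b\<in>carrier N. T (GNS_op N V \<pi> z b z) = \<rho> b \<xi>))"

definition rel_form :: "('n, 'p) cstar_scheme \<Rightarrow> ('v, 'm) hilb_scheme \<Rightarrow> ('n \<Rightarrow> 'v \<Rightarrow> 'v) \<Rightarrow> 'v \<Rightarrow>
    ('h, 'q) hilb_scheme \<Rightarrow> ('n \<Rightarrow> 'h \<Rightarrow> 'h) \<Rightarrow> ('k, 'r) hilb_scheme \<Rightarrow> ('n \<Rightarrow> 'k \<Rightarrow> 'k) \<Rightarrow>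
    'h \<times> 'k \<Rightarrow> 'h \<times> 'k \<Rightarrow> complex" where
  "rel_form N V \<pi> z H \<rho> K \<sigma> = (\<lambda>(\<xi>, \<eta>) (\<xi>', \<eta>').
     ip V (adj V H (R_muop N V \<pi> z H \<rho> \<xi>') (R_muop N V \<pi> z H \<rho> \<xi> z))
          (adj V K (R_mu N V \<pi> z K \<sigma> \<eta>) (R_mu N V \<pi> z K \<sigma> \<eta>' z)))"

definition rel_tensor :: "('n, 'p) cstar_scheme \<Rightarrow> ('v, 'm) hilb_scheme \<Rightarrow> ('n \<Rightarrow> 'v \<Rightarrow> 'v) \<Rightarrow> 'v \<Rightarrow>
    ('h, 'q) hilb_scheme \<Rightarrow> ('n \<Rightarrow> 'h \<Rightarrow> 'h) \<Rightarrow> ('k, 'r) hilb_scheme \<Rightarrow> ('n \<Rightarrow> 'k \<Rightarrow> 'k) \<Rightarrow>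
    ('h \<times> 'k \<Rightarrow>\<^sub>0 complex) set hilb" where
  "rel_tensor N V \<pi> z H \<rho> K \<sigma> =
     sep_space (carrier H \<times> carrier K) (rel_form N V \<pi> z H \<rho> K \<sigma>)"

definition rel_elem :: "('n, 'p) cstar_scheme \<Rightarrow> ('v, 'm) hilb_scheme \<Rightarrow> ('n \<Rightarrow> 'v \<Rightarrow> 'v) \<Rightarrow> 'v \<Rightarrow>
    ('h, 'q) hilb_scheme \<Rightarrow> ('n \<Rightarrow> 'h \<Rightarrow> 'h) \<Rightarrow> ('k, 'r) hilb_scheme \<Rightarrow> ('n \<Rightarrow> 'k \<Rightarrow> 'k) \<Rightarrow>
    'h \<Rightarrow> 'k \<Rightarrow> ('h \<times> 'k \<Rightarrow>\<^sub>0 complex) set" where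
  "rel_elem N V \<pi> z H \<rho> K \<sigma> \<xi> \<eta> =
     sep_class (carrier H \<times> carrier K) (rel_form N V \<pi> z H \<rho> K \<sigma>) (\<xi>, \<eta>)"

definition cst_form :: "('h, 'q) hilb_scheme \<Rightarrow> ('g, 'm) hilb_scheme \<Rightarrow> ('k, 'r) hilb_scheme \<Rightarrow>
    ('g \<Rightarrow> 'h) \<times> 'g \<times> ('g \<Rightarrow> 'k) \<Rightarrow> ('g \<Rightarrow> 'h) \<times> 'g \<times> ('g \<Rightarrow> 'k) \<Rightarrow> complex" where
  "cst_form H G K = (\<lambda>(\<xi>, \<omega>, \<eta>) (\<xi>', \<omega>', \<eta>').
     ip G \<omega> (adj G H \<xi> (\<xi>' (adj G K \<eta> (\<eta>' \<omega>')))))"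

definition cst_tensor :: "('h, 'q) hilb_scheme \<Rightarrow> ('g \<Rightarrow> 'h) set \<Rightarrow> ('g, 'm) hilb_scheme \<Rightarrow>
    ('k, 'r) hilb_scheme \<Rightarrow> ('g \<Rightarrow> 'k) set \<Rightarrow>
    (('g \<Rightarrow> 'h) \<times> 'g \<times> ('g \<Rightarrow> 'k) \<Rightarrow>\<^sub>0 complex) set hilb" where
  "cst_tensor H \<alpha> G K \<beta> = sep_space (\<alpha> \<times> carrier G \<times> \<beta>) (cst_form H G K)"

definition cst_elem :: "('h, 'q) hilb_scheme \<Rightarrow> ('g \<Rightarrow> 'h) set \<Rightarrow> ('g, 'm) hilb_scheme \<Rightarrow>
    ('k, 'r) hilb_scheme \<Rightarrow> ('g \<Rightarrow> 'k) set \<Rightarrow> ('g \<Rightarrow> 'h) \<Rightarrow> 'g \<Rightarrow> ('g \<Rightarrow> 'k) \<Rightarrow>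
    (('g \<Rightarrow> 'h) \<times> 'g \<times> ('g \<Rightarrow> 'k) \<Rightarrow>\<^sub>0 complex) set" where
  "cst_elem H \<alpha> G K \<beta> \<xi> \<omega> \<eta> = sep_class (\<alpha> \<times> carrier G \<times> \<beta>) (cst_form H G K) (\<xi>, \<omega>, \<eta>)"

definition Phi :: "('n, 'p) cstar_scheme \<Rightarrow> ('v, 'm) hilb_scheme \<Rightarrow> ('n \<Rightarrow> 'v \<Rightarrow> 'v) \<Rightarrow> 'v \<Rightarrow>
    ('h, 'q) hilb_scheme \<Rightarrow> ('n \<Rightarrow> 'h \<Rightarrow> 'h) \<Rightarrow> ('k, 'r) hilb_scheme \<Rightarrow> ('n \<Rightarrow> 'k \<Rightarrow> 'k) \<Rightarrow>
    ('g, 's) hilb_scheme \<Rightarrow> ('g \<Rightarrow> 'h) set \<Rightarrow> ('g \<Rightarrow> 'k) set \<Rightarrow> ('g \<Rightarrow> 'v) \<Rightarrow> 'g \<Rightarrow>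
    ('h \<times> 'k \<Rightarrow>\<^sub>0 complex) set \<Rightarrow> (('g \<Rightarrow> 'h) \<times> 'g \<times> ('g \<Rightarrow> 'k) \<Rightarrow>\<^sub>0 complex) set" where
  "Phi N V \<pi> z H \<rho> K \<sigma> G \<alpha> \<beta> U \<zeta> =
     (THE F. F \<in> carrier (Ops (rel_tensor N V \<pi> z H \<rho> K \<sigma>) (cst_tensor H \<alpha> G K \<beta>)) \<and>
       (\<forall>\<xi>\<in>carrier H. \<forall>\<eta>\<in>carrier K. F (rel_elem N V \<pi> z H \<rho> K \<sigma> \<xi> \<eta>) =
          cst_elem H \<alpha> G K \<beta> (compose (carrier G) (R_muop N V \<pi> z H \<rho> \<xi>) U) \<zeta>
            (compose (carrier G) (R_mu N V \<pi> z K \<sigma> \<eta>) U)))"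


section \<open>Fiber products\<close>

definition tensor_op :: "('n, 'p) cstar_scheme \<Rightarrow> ('v, 'm) hilb_scheme \<Rightarrow> ('n \<Rightarrow> 'v \<Rightarrow> 'v) \<Rightarrow> 'v \<Rightarrow>
    ('h, 'q) hilb_scheme \<Rightarrow> ('n \<Rightarrow> 'h \<Rightarrow> 'h) \<Rightarrow> ('k, 'r) hilb_scheme \<Rightarrow> ('n \<Rightarrow> 'k \<Rightarrow> 'k) \<Rightarrow>
    ('h \<Rightarrow> 'h) \<Rightarrow> ('k \<Rightarrow> 'k) \<Rightarrow>
    ('h \<times> 'k \<Rightarrow>\<^sub>0 complex) set \<Rightarrow> ('h \<times> 'k \<Rightarrow>\<^sub>0 complex) set" where
  "tensor_op N V \<pi> z H \<rho> K \<sigma> S T =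
     (THE Q. Q \<in> carrier (Lalg (rel_tensor N V \<pi> z H \<rho> K \<sigma>)) \<and>
       (\<forall>\<xi>\<in>carrier H. \<forall>\<eta>\<in>carrier K. Q (rel_elem N V \<pi> z H \<rho> K \<sigma> \<xi> \<eta>) =
          rel_elem N V \<pi> z H \<rho> K \<sigma> (S \<xi>) (T \<eta>)))"

definition classical_fiber :: "('n, 'p) cstar_scheme \<Rightarrow> ('v, 'm) hilb_scheme \<Rightarrow>
    ('n \<Rightarrow> 'v \<Rightarrow> 'v) \<Rightarrow> 'v \<Rightarrow> ('h, 'q) hilb_scheme \<Rightarrow> ('n \<Rightarrow> 'h \<Rightarrow> 'h) \<Rightarrow> ('h \<Rightarrow> 'h) set \<Rightarrow>
    ('k, 'r) hilb_scheme \<Rightarrow> ('n \<Rightarrow> 'k \<Rightarrow> 'k) \<Rightarrow> ('k \<Rightarrow> 'k) set \<Rightarrow>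
    (('h \<times> 'k \<Rightarrow>\<^sub>0 complex) set \<Rightarrow> ('h \<times> 'k \<Rightarrow>\<^sub>0 complex) set) set" where
  "classical_fiber N V \<pi> z H \<rho> A K \<sigma> B =
     commutant (rel_tensor N V \<pi> z H \<rho> K \<sigma>)
       {tensor_op N V \<pi> z H \<rho> K \<sigma> S T |S T. S \<in> commutant H A \<and> T \<in> commutant K B}"

definition ket1 :: "('h, 'q) hilb_scheme \<Rightarrow> ('g \<Rightarrow> 'h) set \<Rightarrow> ('g, 'm) hilb_scheme \<Rightarrow>
    ('k, 'r) hilb_scheme \<Rightarrow> ('g \<Rightarrow> 'k) set \<Rightarrow> ('g \<Rightarrow> 'h) \<Rightarrow>
    'k \<Rightarrow> (('g \<Rightarrow> 'h) \<times> 'g \<times> ('g \<Rightarrow> 'k) \<Rightarrow>\<^sub>0 complex) set" where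
  "ket1 H \<alpha> G K \<beta> \<xi> = (THE T. T \<in> carrier (Ops K (cst_tensor H \<alpha> G K \<beta>)) \<and>
     (\<forall>\<eta>\<in>\<beta>. \<forall>\<omega>\<in>carrier G. T (\<eta> \<omega>) = cst_elem H \<alpha> G K \<beta> \<xi> \<omega> \<eta>))"

definition ket2 :: "('h, 'q) hilb_scheme \<Rightarrow> ('g \<Rightarrow> 'h) set \<Rightarrow> ('g, 'm) hilb_scheme \<Rightarrow>
    ('k, 'r) hilb_scheme \<Rightarrow> ('g \<Rightarrow> 'k) set \<Rightarrow> ('g \<Rightarrow> 'k) \<Rightarrow>
    'h \<Rightarrow> (('g \<Rightarrow> 'h) \<times> 'g \<times> ('g \<Rightarrow> 'k) \<Rightarrow>\<^sub>0 complex) set" where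
  "ket2 H \<alpha> G K \<beta> \<eta> = (THE T. T \<in> carrier (Ops H (cst_tensor H \<alpha> G K \<beta>)) \<and>
     (\<forall>\<xi>\<in>\<alpha>. \<forall>\<omega>\<in>carrier G. T (\<xi> \<omega>) = cst_elem H \<alpha> G K \<beta> \<xi> \<omega> \<eta>))"

definition spatial_fiber :: "('h, 'q) hilb_scheme \<Rightarrow> ('g \<Rightarrow> 'h) set \<Rightarrow> ('h \<Rightarrow> 'h) set \<Rightarrow>
    ('g, 'm) hilb_scheme \<Rightarrow> ('k, 'r) hilb_scheme \<Rightarrow> ('g \<Rightarrow> 'k) set \<Rightarrow> ('k \<Rightarrow> 'k) set \<Rightarrow>
    ((('g \<Rightarrow> 'h) \<times> 'g \<times> ('g \<Rightarrow> 'k) \<Rightarrow>\<^sub>0 complex) set \<Rightarrow>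
     (('g \<Rightarrow> 'h) \<times> 'g \<times> ('g \<Rightarrow> 'k) \<Rightarrow>\<^sub>0 complex) set) set" where
  "spatial_fiber H \<alpha> A G K \<beta> B =
     (let W = cst_tensor H \<alpha> G K \<beta>;
          X1 = cspan (Ops K W)
                 {compose (carrier K) (ket1 H \<alpha> G K \<beta> \<xi>) b |\<xi> b. \<xi> \<in> \<alpha> \<and> b \<in> B};
          X2 = cspan (Ops H W)
                 {compose (carrier H) (ket2 H \<alpha> G K \<beta> \<eta>) a |\<eta> a. \<eta> \<in> \<beta> \<and> a \<in> A}
      in {T \<in> carrier (Lalg W).
            (\<forall>\<xi>\<in>\<alpha>. compose (carrier K) T (ket1 H \<alpha> G K \<beta> \<xi>) \<in> X1 \<and>
                     compose (carrier K) (adj W W T) (ket1 H \<alpha> G K \<beta> \<xi>) \<in> X1) \<and>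
            (\<forall>\<eta>\<in>\<beta>. compose (carrier H) T (ket2 H \<alpha> G K \<beta> \<eta>) \<in> X2 \<and>
                     compose (carrier H) (adj W W T) (ket2 H \<alpha> G K \<beta> \<eta>) \<in> X2)})"

end

theory Submission
  imports Defs
begin

text \<open>
  The modular conjugation plays no role: by hypothesis the operators \<open>GNS_op b\<close> are exactly the
  operators \<open>U c U*\<close> with \<open>c\<close> in \<open>\<BB>d\<close>, and \<open>\<rho> b\<close> is the operator \<open>\<rho>\<^sub>\<alpha>(c)\<close> for that same
  \<open>c\<close>. So everything can be moved to the base \<open>G\<close>.

  Since \<open>\<zeta>\<close> is bicyclic, every \<open>h \<in> H\<close> is \<open>a \<zeta>\<close> for exactly one \<open>a \<in> \<alpha>\<close> (\<open>ex_elt\<close>,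
  \<open>elt_unique\<close>); write \<open>a = elt h\<close>. The map \<open>\<rho>\<^sub>\<alpha>(c)\<close> sends \<open>a \<zeta>\<close> to \<open>a c \<zeta>\<close>, and every operator
  commuting with \<open>\<rho>\<^sub>\<alpha>(\<BB>d)\<close> maps \<open>\<alpha>\<close> into itself (\<open>intertwiner\<close>). The same holds for \<open>K\<close>, \<open>\<beta>\<close>.
  It follows that the compositions of \<open>R_muop \<xi>\<close> and \<open>R_mu \<eta>\<close> with \<open>U\<close> are \<open>elt \<xi>\<close> and \<open>elt \<eta>\<close>, that
  \<open>\<langle>\<xi> \<otimes> \<eta>|\<xi>' \<otimes> \<eta>'\<rangle>\<^sub>\<mu>\<close> is the form of the C*-relative tensor product at \<open>elt \<xi> \<otimes> \<zeta> \<otimes> elt \<eta>\<close> and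
  \<open>elt \<xi>' \<otimes> \<zeta> \<otimes> elt \<eta>'\<close> (\<open>rel_form_eq\<close>), and, because \<open>a \<otimes> b \<zeta> \<otimes> e = a b \<otimes> \<zeta> \<otimes> e\<close> for \<open>b \<in> \<BB>\<close>,
  that every elementary tensor is of the form \<open>elt \<xi> \<otimes> \<zeta> \<otimes> elt \<eta>\<close>. Hence \<open>\<Phi>\<close> is unitary, once the form is known to be
  positive.

  Positivity (\<open>pos_form_cst\<close>): the form is \<open>\<langle>a \<omega>|\<rho>\<^sub>\<alpha>(e*e') a' \<omega>'\<rangle>\<close>. With \<open>w\<^sub>f = elt f\<close> for \<open>f\<close> in an
  orthonormal basis of \<open>H\<close>, the operator \<open>S = \<Sum>\<^sub>f w\<^sub>f w\<^sub>f*\<close> commutes with \<open>\<rho>\<^sub>\<alpha>(\<BB>d)\<close>, is positive and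
  invertible, and \<open>\<langle>x\<^sub>i|\<rho>\<^sub>\<alpha>(e\<^sub>i*e\<^sub>j) S x\<^sub>j\<rangle>\<close> is visibly a positive matrix. To divide by \<open>S\<close> one needs
  that a product of commuting positive operators is positive; this is proved by writing a positive
  contraction as a weakly convergent sum of squares \<open>Q = \<Sum>\<^sub>k q\<^sub>k\<^sup>2\<close> with \<open>q\<^sub>k\<^sub>+\<^sub>1 = q\<^sub>k - q\<^sub>k\<^sup>2\<close>
  (\<open>positive_squares\<close>, \<open>positive_product\<close>).

  Fiber products: \<open>\<Phi>\<close> carries \<open>s \<otimes> t\<close> to the operator \<open>a \<otimes> \<omega> \<otimes> e \<mapsto> s a \<otimes> \<omega> \<otimes> t e\<close> for \<open>s \<in> A'\<close>,
  \<open>t \<in> B'\<close>, so the classical fiber product becomes the commutant of all these. On the other side, an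
  operator \<open>X\<close> from \<open>K\<close> to the tensor product lies in \<open>[|\<alpha>\<rangle>\<^sub>[\<^sub>1\<^sub>] B]\<close> if and only if
  \<open>X t = (1 \<otimes> t) X\<close> for all \<open>t \<in> B'\<close>: the compositions \<open>\<langle>a|\<^sub>[\<^sub>1\<^sub>] X\<close> then lie in \<open>B'' = B\<close>, and an
  orthogonal projection in the Hilbert--Schmidt inner product does the rest. So the conditions that
  define the spatial fiber product say that \<open>T\<close> commutes with all \<open>1 \<otimes> t\<close> and all \<open>s \<otimes> 1\<close>
  (\<open>commutes_iff_ket\<close>, \<open>spatial_fiber_eq\<close>).
\<close>

section \<open>Finite-dimensional inner product spaces\<close>

lemma CC_simps [simp]:
  "carrier CC = UNIV" "mult CC = (*)" "one CC = 1" "zero CC = 0" "add CC = (+)"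
  by (simp_all add: CC_def)

lemma cring_CC: "cring CC"
proof (rule cringI)
  show "abelian_group CC"
  proof (rule abelian_groupI)
    fix x :: complex
    show "\<exists>y\<in>carrier CC. y \<oplus>\<^bsub>CC\<^esub> x = \<zero>\<^bsub>CC\<^esub>" by (rule bexI[of _ "- x"]) auto
  qed auto
  show "comm_monoid CC" by (rule comm_monoidI) auto
qed (auto simp: algebra_simps)

text \<open>Complex vector spaces.\<close>

locale cvec = Module.module CC V for V :: "(complex, 'a, 'm) module_scheme" (structure)
begin

lemma submoduleI':
  assumes "M \<subseteq> carrier V" "\<zero>\<^bsub>V\<^esub> \<in> M" "\<And>x y. x \<in> M \<Longrightarrow> y \<in> M \<Longrightarrow> x \<oplus>\<^bsub>V\<^esub> y \<in> M"
    "\<And>c x. x \<in> M \<Longrightarrow> c \<odot>\<^bsub>V\<^esub> x \<in> M"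
  shows "submodule M CC V"
proof (rule submoduleI)
  fix a assume a: "a \<in> M"
  have "(- 1) \<odot>\<^bsub>V\<^esub> a \<in> M" using assms(4) a .
  moreover have "\<ominus>\<^bsub>V\<^esub> a = (\<ominus>\<^bsub>CC\<^esub> 1) \<odot>\<^bsub>V\<^esub> a" using smult_l_minus[of 1 a] a assms(1) smult_one[of a] by auto
  moreover have "\<ominus>\<^bsub>CC\<^esub> 1 = - 1"
    by (rule R.minus_equality) auto
  ultimately show "\<ominus>\<^bsub>V\<^esub> a \<in> M" by simp
qed (use assms in auto)

lemma submoduleD:
  assumes "submodule M CC V"
  shows "M \<subseteq> carrier V" "\<zero>\<^bsub>V\<^esub> \<in> M" "\<And>x y. x \<in> M \<Longrightarrow> y \<in> M \<Longrightarrow> x \<oplus>\<^bsub>V\<^esub> y \<in> M"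
    "\<And>c x. x \<in> M \<Longrightarrow> c \<odot>\<^bsub>V\<^esub> x \<in> M"
proof -
  note E = submoduleE[OF assms]
  show "M \<subseteq> carrier V" by (fact E)
  show "\<And>x y. x \<in> M \<Longrightarrow> y \<in> M \<Longrightarrow> x \<oplus>\<^bsub>V\<^esub> y \<in> M" by (fact E(5))
  show "\<And>c x. x \<in> M \<Longrightarrow> c \<odot>\<^bsub>V\<^esub> x \<in> M" using E(4) by simp
  obtain x where "x \<in> M" using E by auto
  then have "(0::complex) \<odot>\<^bsub>V\<^esub> x \<in> M" "x \<in> carrier V" using E by auto
  then show "\<zero>\<^bsub>V\<^esub> \<in> M" using smult_l_null by auto
qed

lemma smult_in [simp]: "x \<in> carrier V \<Longrightarrow> c \<odot>\<^bsub>V\<^esub> x \<in> carrier V"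
  by simp

lemma smult_zero_left [simp]: "x \<in> carrier V \<Longrightarrow> (0::complex) \<odot>\<^bsub>V\<^esub> x = \<zero>\<^bsub>V\<^esub>"
  using smult_l_null by simp

lemma smult_zero_right [simp]: "c \<odot>\<^bsub>V\<^esub> \<zero>\<^bsub>V\<^esub> = \<zero>\<^bsub>V\<^esub>"
  by (rule smult_r_null) simp

lemma smult_1 [simp]: "x \<in> carrier V \<Longrightarrow> (1::complex) \<odot>\<^bsub>V\<^esub> x = x"
  using smult_one by simp

lemma lspan_submodule:
  assumes "Y \<subseteq> carrier V" shows "submodule (lspan V Y) CC V"
proof (rule submoduleI')
  show "lspan V Y \<subseteq> carrier V" unfolding lspan_def using carrier_is_submodule assms by blast
qed (auto simp: lspan_def dest: submoduleD)

lemma lspan_base: "Y \<subseteq> lspan V Y" unfolding lspan_def by auto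

lemma lspan_least: "submodule M CC V \<Longrightarrow> Y \<subseteq> M \<Longrightarrow> lspan V Y \<subseteq> M" unfolding lspan_def by auto

lemma lspan_carrier: "Y \<subseteq> carrier V \<Longrightarrow> lspan V Y \<subseteq> carrier V"
  using lspan_least carrier_is_submodule by blast

lemma submodule_finsum:
  assumes "submodule M CC V" "finite E" "\<And>e. e \<in> E \<Longrightarrow> f e \<in> M"
  shows "finsum V f E \<in> M"
  using assms(2,3)
proof (induction E rule: finite_induct)
  case empty then show ?case using submoduleD[OF assms(1)] by simp
next
  case (insert e E)
  have "f \<in> E \<rightarrow> carrier V" "f e \<in> carrier V" using insert submoduleD[OF assms(1)] by auto
  then have "finsum V f (insert e E) = f e \<oplus>\<^bsub>V\<^esub> finsum V f E"
    using insert by (simp add: finsum_insert)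
  then show ?case using insert submoduleD[OF assms(1)] by auto
qed

lemma submodule_diff:
  assumes "submodule M CC V" "x \<in> M" "y \<in> M" shows "x \<ominus>\<^bsub>V\<^esub> y \<in> M"
  using submoduleE[OF assms(1)] assms by (simp add: a_minus_def)

end

text \<open>
  Inner product spaces without completeness. In finite dimensions completeness is never needed, and
  leaving it out means that the separated spaces below need no separate completeness proof.
\<close>

locale ip_space = cvec V for V :: "('a, 'm) hilb_scheme" (structure) +
  assumes ip_add_right: "\<lbrakk>x \<in> carrier V; y \<in> carrier V; z \<in> carrier V\<rbrakk>
      \<Longrightarrow> ip V x (y \<oplus>\<^bsub>V\<^esub> z) = ip V x y + ip V x z"
    and ip_smult_right: "\<lbrakk>x \<in> carrier V; y \<in> carrier V\<rbrakk> \<Longrightarrow> ip V x (c \<odot>\<^bsub>V\<^esub> y) = c * ip V x y"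
    and ip_commute: "\<lbrakk>x \<in> carrier V; y \<in> carrier V\<rbrakk> \<Longrightarrow> ip V y x = cnj (ip V x y)"
    and ip_pos: "\<lbrakk>x \<in> carrier V; x \<noteq> \<zero>\<^bsub>V\<^esub>\<rbrakk> \<Longrightarrow> Re (ip V x x) > 0"
    and nrm_eq: "x \<in> carrier V \<Longrightarrow> nrm V x = sqrt (Re (ip V x x))"
begin

lemma ip_add_left: "\<lbrakk>x \<in> carrier V; y \<in> carrier V; z \<in> carrier V\<rbrakk>
      \<Longrightarrow> ip V (x \<oplus>\<^bsub>V\<^esub> y) z = ip V x z + ip V y z"
  using ip_commute[of z "x \<oplus>\<^bsub>V\<^esub> y"] ip_commute[of z] ip_add_right[of z x y] by simp

lemma ip_smult_left: "\<lbrakk>x \<in> carrier V; y \<in> carrier V\<rbrakk> \<Longrightarrow> ip V (c \<odot>\<^bsub>V\<^esub> x) y = cnj c * ip V x y"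
  using ip_commute[of y "c \<odot>\<^bsub>V\<^esub> x"] ip_commute[of y x] ip_smult_right[of y x c] by simp

lemma ip_zero_right [simp]: "x \<in> carrier V \<Longrightarrow> ip V x \<zero>\<^bsub>V\<^esub> = 0"
  using ip_smult_right[of x "\<zero>\<^bsub>V\<^esub>" 0] by simp

lemma ip_zero_left [simp]: "x \<in> carrier V \<Longrightarrow> ip V \<zero>\<^bsub>V\<^esub> x = 0"
  using ip_smult_left[of "\<zero>\<^bsub>V\<^esub>" x 0] by simp

lemma ip_uminus_right: "\<lbrakk>x \<in> carrier V; y \<in> carrier V\<rbrakk> \<Longrightarrow> ip V x (\<ominus>\<^bsub>V\<^esub> y) = - ip V x y"
  using ip_add_right[of x y "\<ominus>\<^bsub>V\<^esub> y"] by (simp add: M.r_neg add_eq_0_iff2 minus_unique)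

lemma ip_diff_right: "\<lbrakk>x \<in> carrier V; y \<in> carrier V; z \<in> carrier V\<rbrakk>
      \<Longrightarrow> ip V x (y \<ominus>\<^bsub>V\<^esub> z) = ip V x y - ip V x z"
  by (simp add: a_minus_def ip_add_right ip_uminus_right)

lemma ip_diff_left: "\<lbrakk>x \<in> carrier V; y \<in> carrier V; z \<in> carrier V\<rbrakk>
      \<Longrightarrow> ip V (x \<ominus>\<^bsub>V\<^esub> y) z = ip V x z - ip V y z"
  using ip_commute[of z "x \<ominus>\<^bsub>V\<^esub> y"] ip_commute[of z] ip_diff_right[of z x y] by simp

lemmas ip_simps = ip_add_right ip_add_left ip_smult_right ip_smult_left ip_diff_right ip_diff_left

lemma ip_self: "x \<in> carrier V \<Longrightarrow> ip V x x = (complex_of_real (nrm V x))\<^sup>2"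
proof -
  assume x: "x \<in> carrier V"
  have "Im (ip V x x) = 0" using ip_commute[OF x x] by (metis complex_cnj_cancel_iff Reals_cnj_iff complex_is_Real_iff)
  moreover have "Re (ip V x x) \<ge> 0" using ip_pos[OF x] x by (cases "x = \<zero>\<^bsub>V\<^esub>") auto
  ultimately show ?thesis using nrm_eq[OF x] by (simp add: complex_eq_iff flip: of_real_power)
qed

lemma nrm_nonneg [simp]: "x \<in> carrier V \<Longrightarrow> nrm V x \<ge> 0"
  using ip_pos[of x] nrm_eq[of x] by (cases "x = \<zero>\<^bsub>V\<^esub>") auto

lemma nrm_eq_0: "x \<in> carrier V \<Longrightarrow> nrm V x = 0 \<longleftrightarrow> x = \<zero>\<^bsub>V\<^esub>"
  using ip_pos[of x] nrm_eq[of x] by (cases "x = \<zero>\<^bsub>V\<^esub>") auto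

lemma ip_self_zero: "x \<in> carrier V \<Longrightarrow> ip V x x = 0 \<Longrightarrow> x = \<zero>\<^bsub>V\<^esub>"
  using ip_pos[of x] by force

lemma diff_zero_eq: "x \<in> carrier V \<Longrightarrow> y \<in> carrier V \<Longrightarrow> x \<ominus>\<^bsub>V\<^esub> y = \<zero>\<^bsub>V\<^esub> \<Longrightarrow> x = y"
  unfolding a_minus_def using M.minus_equality[of x "\<ominus>\<^bsub>V\<^esub> y"] by simp

lemma ip_eqI:
  assumes "x \<in> carrier V" "y \<in> carrier V" "\<And>z. z \<in> carrier V \<Longrightarrow> ip V z x = ip V z y"
  shows "x = y"
proof -
  have "ip V (x \<ominus>\<^bsub>V\<^esub> y) (x \<ominus>\<^bsub>V\<^esub> y) = 0" using assms by (simp add: ip_diff_right)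
  then have "x \<ominus>\<^bsub>V\<^esub> y = \<zero>\<^bsub>V\<^esub>" using assms ip_self_zero by blast
  then show ?thesis using assms diff_zero_eq by blast
qed

lemma ip_finsum_right:
  assumes "finite E" "\<And>e. e \<in> E \<Longrightarrow> f e \<in> carrier V" "x \<in> carrier V"
  shows "ip V x (finsum V f E) = (\<Sum>e\<in>E. ip V x (f e))"
  using assms(1,2)
proof (induction E rule: finite_induct)
  case (insert e E)
  have "f \<in> E \<rightarrow> carrier V" "f e \<in> carrier V" using insert by auto
  then show ?case using insert assms(3) by (simp add: finsum_insert ip_add_right)
qed (use assms(3) in simp)

lemma ip_finsum_left:
  assumes "finite E" "\<And>e. e \<in> E \<Longrightarrow> f e \<in> carrier V" "x \<in> carrier V"
  shows "ip V (finsum V f E) x = (\<Sum>e\<in>E. ip V (f e) x)"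
proof -
  have "finsum V f E \<in> carrier V" using assms by (intro finsum_closed) auto
  then have "ip V (finsum V f E) x = cnj (ip V x (finsum V f E))" using ip_commute assms by blast
  also have "... = (\<Sum>e\<in>E. ip V (f e) x)"
    using assms by (simp add: ip_finsum_right ip_commute[of x])
  finally show ?thesis .
qed

lemma cauchy_schwarz:
  assumes x: "x \<in> carrier V" and y: "y \<in> carrier V"
  shows "cmod (ip V x y) \<le> nrm V x * nrm V y"
proof (cases "x = \<zero>\<^bsub>V\<^esub>")
  case True then show ?thesis using y by (simp add: nrm_eq)
next
  case False
  define n where "n = (nrm V x)\<^sup>2"
  define p where "p = ip V x y"
  define z where "z = (complex_of_real n \<odot>\<^bsub>V\<^esub> y) \<ominus>\<^bsub>V\<^esub> (p \<odot>\<^bsub>V\<^esub> x)"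
  have z: "z \<in> carrier V" using x y z_def by simp
  have n: "n > 0" using False nrm_eq_0[OF x] nrm_nonneg[OF x] by (simp add: n_def)
  have "ip V z z = complex_of_real (n * (n * (nrm V y)\<^sup>2 - (cmod p)\<^sup>2))"
  proof -
    have xx: "ip V x x = complex_of_real n" "ip V y y = (complex_of_real (nrm V y))\<^sup>2"
      "ip V y x = cnj p" "ip V x y = p"
      using x y by (simp_all add: ip_self n_def ip_commute[of x y] p_def)
    have pp: "complex_of_real ((cmod p)\<^sup>2) = p * cnj p" by (rule complex_norm_square)
    show ?thesis using x y unfolding z_def of_real_mult of_real_diff pp
      by (simp add: ip_simps xx algebra_simps)
  qed
  moreover have "Re (ip V z z) \<ge> 0" using ip_self[OF z] by (simp flip: of_real_power)
  ultimately have "n * (n * (nrm V y)\<^sup>2 - (cmod p)\<^sup>2) \<ge> 0" by simp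
  then have "(cmod p)\<^sup>2 \<le> n * (nrm V y)\<^sup>2" using n by (simp add: zero_le_mult_iff)
  then have "(cmod p)\<^sup>2 \<le> (nrm V x * nrm V y)\<^sup>2" by (simp add: n_def power_mult_distrib)
  then show ?thesis unfolding p_def by (rule power2_le_imp_le) (use x y in auto)
qed

lemma nrm_triangle:
  assumes x: "x \<in> carrier V" and y: "y \<in> carrier V"
  shows "nrm V (x \<oplus>\<^bsub>V\<^esub> y) \<le> nrm V x + nrm V y"
proof -
  have "complex_of_real ((nrm V (x \<oplus>\<^bsub>V\<^esub> y))\<^sup>2) = complex_of_real ((nrm V x)\<^sup>2 + (nrm V y)\<^sup>2) + (ip V x y + cnj (ip V x y))"
    using x y by (simp add: ip_self[symmetric] ip_simps ip_commute[of x y])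
  also have "... = complex_of_real ((nrm V x)\<^sup>2 + (nrm V y)\<^sup>2 + 2 * Re (ip V x y))"
    by (simp add: complex_add_cnj)
  finally have "(nrm V (x \<oplus>\<^bsub>V\<^esub> y))\<^sup>2 = (nrm V x)\<^sup>2 + (nrm V y)\<^sup>2 + 2 * Re (ip V x y)"
    using of_real_eq_iff by blast
  also have "... \<le> (nrm V x + nrm V y)\<^sup>2"
    using cauchy_schwarz[OF x y] complex_Re_le_cmod[of "ip V x y"] by (simp add: power2_sum)
  finally show ?thesis by (rule power2_le_imp_le) (use x y in auto)
qed

lemma nrm_smult: "x \<in> carrier V \<Longrightarrow> nrm V (c \<odot>\<^bsub>V\<^esub> x) = cmod c * nrm V x"
proof -
  assume x: "x \<in> carrier V"
  have "ip V (c \<odot>\<^bsub>V\<^esub> x) (c \<odot>\<^bsub>V\<^esub> x) = (c * cnj c) * (complex_of_real (nrm V x))\<^sup>2"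
    using x by (simp add: ip_smult_left ip_smult_right flip: ip_self)
  also have "... = complex_of_real ((cmod c * nrm V x)\<^sup>2)"
    by (simp add: power_mult_distrib flip: complex_norm_square)
  finally have "ip V (c \<odot>\<^bsub>V\<^esub> x) (c \<odot>\<^bsub>V\<^esub> x) = complex_of_real ((cmod c * nrm V x)\<^sup>2)" .
  then have "nrm V (c \<odot>\<^bsub>V\<^esub> x) = sqrt ((cmod c * nrm V x)\<^sup>2)" using x nrm_eq by simp
  then show ?thesis using x by simp
qed

lemma nrm_finsum:
  assumes "finite E" "\<And>e. e \<in> E \<Longrightarrow> f e \<in> carrier V"
  shows "nrm V (finsum V f E) \<le> (\<Sum>e\<in>E. nrm V (f e))"
  using assms
proof (induction E rule: finite_induct)
  case (insert e E)
  have "f \<in> E \<rightarrow> carrier V" "f e \<in> carrier V" using insert by auto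
  then have "finsum V f (insert e E) = f e \<oplus>\<^bsub>V\<^esub> finsum V f E"
    using insert by (simp add: finsum_insert)
  moreover have "finsum V f E \<in> carrier V" using \<open>f \<in> E \<rightarrow> carrier V\<close> by simp
  ultimately show ?case using insert nrm_triangle[of "f e" "finsum V f E"] \<open>f e \<in> carrier V\<close> by auto
qed (simp add: nrm_eq)

text \<open>An orthonormal set is finite here.\<close>

definition orthonormal :: "'a set \<Rightarrow> bool" where
  "orthonormal E \<longleftrightarrow> finite E \<and> E \<subseteq> carrier V \<and> (\<forall>e\<in>E. \<forall>f\<in>E. ip V e f = (if e = f then 1 else 0))"

text \<open>The orthogonal projection onto the span of an orthonormal set.\<close>

definition proj :: "'a set \<Rightarrow> 'a \<Rightarrow> 'a" where
  "proj E x = finsum V (\<lambda>e. ip V e x \<odot>\<^bsub>V\<^esub> e) E"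

text \<open>An orthonormal basis: an orthonormal set in which every vector has its Fourier expansion.\<close>

definition onb :: "'a set \<Rightarrow> bool" where
  "onb E \<longleftrightarrow> orthonormal E \<and> (\<forall>x\<in>carrier V. proj E x = x)"

lemma orthonormalD:
  assumes "orthonormal E"
  shows "finite E" "E \<subseteq> carrier V" "\<And>e. e \<in> E \<Longrightarrow> e \<in> carrier V"
    "\<And>e f. e \<in> E \<Longrightarrow> f \<in> E \<Longrightarrow> ip V e f = (if e = f then 1 else 0)"
  using assms unfolding orthonormal_def by auto

lemma proj_closed: "orthonormal E \<Longrightarrow> x \<in> carrier V \<Longrightarrow> proj E x \<in> carrier V"
  unfolding proj_def by (intro finsum_closed) (auto dest: orthonormalD)

lemma ip_proj_right:
  "orthonormal E \<Longrightarrow> x \<in> carrier V \<Longrightarrow> y \<in> carrier V \<Longrightarrow> ip V y (proj E x) = (\<Sum>e\<in>E. ip V e x * ip V y e)"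
  unfolding proj_def by (subst ip_finsum_right) (auto dest: orthonormalD simp: ip_smult_right intro!: sum.cong)

lemma ip_proj_left:
  "orthonormal E \<Longrightarrow> x \<in> carrier V \<Longrightarrow> y \<in> carrier V \<Longrightarrow> ip V (proj E y) x = (\<Sum>e\<in>E. ip V e x * ip V y e)"
proof -
  assume E: "orthonormal E" and x: "x \<in> carrier V" and y: "y \<in> carrier V"
  have "ip V (proj E y) x = cnj (ip V x (proj E y))"
    using ip_commute[OF x proj_closed[OF E y]] .
  also have "... = (\<Sum>e\<in>E. cnj (ip V e y) * cnj (ip V x e))"
    using ip_proj_right[OF E y x] by simp
  also have "... = (\<Sum>e\<in>E. ip V e x * ip V y e)"
  proof (rule sum.cong[OF refl])
    fix e assume "e \<in> E"
    then have e: "e \<in> carrier V" using orthonormalD(3)[OF E] by blast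
    show "cnj (ip V e y) * cnj (ip V x e) = ip V e x * ip V y e"
      using ip_commute[OF e y] ip_commute[OF x e] by simp
  qed
  finally show ?thesis .
qed

lemma ip_proj_basis:
  assumes "orthonormal E" "x \<in> carrier V" "e \<in> E" shows "ip V e (proj E x) = ip V e x"
proof -
  have "ip V e (proj E x) = (\<Sum>f\<in>E. ip V f x * ip V e f)"
    using assms ip_proj_right orthonormalD by blast
  also have "... = (\<Sum>f\<in>E. if e = f then ip V f x else 0)"
    using assms by (intro sum.cong) (auto simp: orthonormalD(4))
  finally show ?thesis using assms orthonormalD by simp
qed

lemma bessel:
  assumes E: "orthonormal E" and x: "x \<in> carrier V"
  shows "(\<Sum>e\<in>E. (cmod (ip V e x))\<^sup>2) \<le> (nrm V x)\<^sup>2"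
proof -
  let ?z = "x \<ominus>\<^bsub>V\<^esub> proj E x"
  have p: "proj E x \<in> carrier V" using E x proj_closed by blast
  have z: "?z \<in> carrier V" using p x by simp
  have s: "(\<Sum>e\<in>E. ip V e x * ip V x e) = complex_of_real (\<Sum>e\<in>E. (cmod (ip V e x))\<^sup>2)"
    unfolding of_real_sum using E x
    by (intro sum.cong) (auto dest: orthonormalD simp: ip_commute[of _ x] complex_norm_square simp del: of_real_power)
  have "ip V (proj E x) (proj E x) = (\<Sum>e\<in>E. ip V e x * ip V x e)"
    using ip_proj_left[OF E p x] ip_proj_basis[OF E x] by (simp cong: sum.cong)
  then have "ip V ?z ?z = ip V x x - (\<Sum>e\<in>E. ip V e x * ip V x e)"
    using x p z ip_proj_left[OF E x x] ip_proj_right[OF E x x] by (simp add: ip_simps)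
  then have "Re (ip V ?z ?z) = (nrm V x)\<^sup>2 - (\<Sum>e\<in>E. (cmod (ip V e x))\<^sup>2)"
    using s ip_self[OF x] by (simp flip: of_real_power)
  moreover have "Re (ip V ?z ?z) \<ge> 0" using ip_self[OF z] by (simp flip: of_real_power)
  ultimately show ?thesis by simp
qed

text \<open>One Gram--Schmidt step.\<close>

lemma orthonormal_extend:
  assumes E: "orthonormal E" and x: "x \<in> carrier V" and n: "proj E x \<noteq> x"
  shows "\<exists>c. let f = c \<odot>\<^bsub>V\<^esub> (x \<ominus>\<^bsub>V\<^esub> proj E x) in orthonormal (insert f E) \<and> f \<notin> E \<and> proj (insert f E) x = x"
proof -
  let ?z = "x \<ominus>\<^bsub>V\<^esub> proj E x"
  have p: "proj E x \<in> carrier V" using E x proj_closed by blast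
  have z: "?z \<in> carrier V" using p x by simp
  have zn: "?z \<noteq> \<zero>\<^bsub>V\<^esub>" using n diff_zero_eq[OF x p] by metis
  define r where "r = nrm V ?z"
  have r: "r > 0" using zn nrm_eq_0[OF z] nrm_nonneg[OF z] unfolding r_def by linarith
  define f where "f = complex_of_real (inverse r) \<odot>\<^bsub>V\<^esub> ?z"
  have f: "f \<in> carrier V" using z f_def by simp
  have ez: "ip V e ?z = 0" if "e \<in> E" for e
    using that ip_proj_basis[OF E x that] x p orthonormalD(3)[OF E that] by (simp add: ip_diff_right)
  have ef: "ip V e f = 0" if "e \<in> E" for e
    using that ez[OF that] z orthonormalD(3)[OF E that] by (simp add: f_def ip_smult_right)
  have fe: "ip V f e = 0" if "e \<in> E" for e
    using ef[OF that] ip_commute[of e f] f orthonormalD(3)[OF E that] by simp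
  have ff: "ip V f f = 1" unfolding f_def using z r
    by (simp add: ip_smult_left ip_smult_right)
       (simp add: ip_self r_def[symmetric] power2_eq_square field_simps)
  have fE: "f \<notin> E" using ef[of f] ff by auto
  have on: "orthonormal (insert f E)" using E f ef fe ff fE unfolding orthonormal_def by auto
  have pz: "ip V (proj E x) ?z = 0"
    using ip_proj_left[OF E z x] ez by simp
  have "ip V ?z x = ip V ?z ?z"
  proof -
    have "ip V ?z (proj E x) = 0" using pz ip_commute[OF p z] by simp
    then show ?thesis using x p z ip_diff_right[of ?z x "proj E x"] by simp
  qed
  then have "ip V f x = complex_of_real r"
    using z x r by (simp add: f_def ip_smult_left ip_self r_def[symmetric] power2_eq_square)
  then have fx: "ip V f x \<odot>\<^bsub>V\<^esub> f = ?z"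
    using z r by (simp add: f_def smult_assoc1[symmetric, simplified])
  have "(\<lambda>e. ip V e x \<odot>\<^bsub>V\<^esub> e) \<in> E \<rightarrow> carrier V" using E by (auto dest: orthonormalD)
  then have "proj (insert f E) x = ip V f x \<odot>\<^bsub>V\<^esub> f \<oplus>\<^bsub>V\<^esub> proj E x"
    unfolding proj_def using fE f orthonormalD(1)[OF E] by (subst finsum_insert) auto
  also have "... = x" using fx x p
    by (simp add: a_minus_def M.a_assoc M.l_neg)
  finally show ?thesis using on fE unfolding f_def Let_def by blast
qed

lemma orthonormal_insert_proj:
  assumes "orthonormal E" "orthonormal (insert f E)" "f \<notin> E" "x \<in> carrier V" "proj E x = x"
  shows "proj (insert f E) x = x"
proof -
  have fin: "finite E" and f: "f \<in> carrier V" using assms orthonormalD by auto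
  have "ip V f x = ip V f (proj E x)" using assms by simp
  also have "... = 0" using ip_proj_right[OF assms(1,4) f] orthonormalD(4)[OF assms(2)] assms(3)
    by (auto intro!: sum.neutral)
  finally have "ip V f x \<odot>\<^bsub>V\<^esub> f = \<zero>\<^bsub>V\<^esub>" using f by simp
  moreover have "(\<lambda>e. ip V e x \<odot>\<^bsub>V\<^esub> e) \<in> E \<rightarrow> carrier V" using assms(1) by (auto dest: orthonormalD)
  then have "proj (insert f E) x = ip V f x \<odot>\<^bsub>V\<^esub> f \<oplus>\<^bsub>V\<^esub> proj E x"
    unfolding proj_def using assms(3) f fin by (subst finsum_insert) auto
  ultimately show ?thesis using assms by simp
qed

lemma fixed_submodule: "orthonormal E \<Longrightarrow> submodule {x \<in> carrier V. proj E x = x} CC V"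
proof (rule submoduleI')
  assume E: "orthonormal E"
  show "\<zero>\<^bsub>V\<^esub> \<in> {x \<in> carrier V. proj E x = x}"
    by (auto intro!: ip_eqI simp: proj_closed E ip_proj_right orthonormalD(3)[OF E])
next
  fix x y assume E: "orthonormal E" and "x \<in> {x \<in> carrier V. proj E x = x}" "y \<in> {x \<in> carrier V. proj E x = x}"
  then have xy: "x \<in> carrier V" "y \<in> carrier V" "proj E x = x" "proj E y = y" by auto
  have "proj E (x \<oplus>\<^bsub>V\<^esub> y) = x \<oplus>\<^bsub>V\<^esub> y"
  proof (rule ip_eqI)
    fix z assume z: "z \<in> carrier V"
    have "ip V z x = (\<Sum>e\<in>E. ip V e x * ip V z e)" "ip V z y = (\<Sum>e\<in>E. ip V e y * ip V z e)"
      using ip_proj_right[OF E _ z] xy by metis+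
    then show "ip V z (proj E (x \<oplus>\<^bsub>V\<^esub> y)) = ip V z (x \<oplus>\<^bsub>V\<^esub> y)"
      using E xy z by (auto simp: ip_proj_right ip_add_right orthonormalD(3)[OF E] sum.distrib[symmetric] distrib_right
          intro!: sum.cong)
  qed (use xy E proj_closed in auto)
  then show "x \<oplus>\<^bsub>V\<^esub> y \<in> {x \<in> carrier V. proj E x = x}" using xy by simp
next
  fix c x assume E: "orthonormal E" and "x \<in> {x \<in> carrier V. proj E x = x}"
  then have xy: "x \<in> carrier V" "proj E x = x" by auto
  have "proj E (c \<odot>\<^bsub>V\<^esub> x) = c \<odot>\<^bsub>V\<^esub> x"
  proof (rule ip_eqI)
    fix z assume z: "z \<in> carrier V"
    have "ip V z x = (\<Sum>e\<in>E. ip V e x * ip V z e)" 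
      using ip_proj_right[OF E _ z] xy by metis
    then show "ip V z (proj E (c \<odot>\<^bsub>V\<^esub> x)) = ip V z (c \<odot>\<^bsub>V\<^esub> x)"
      using E xy z by (auto simp: ip_proj_right ip_smult_right orthonormalD(3)[OF E] sum_distrib_left
          intro!: sum.cong)
  qed (use xy E proj_closed in auto)
  then show "c \<odot>\<^bsub>V\<^esub> x \<in> {x \<in> carrier V. proj E x = x}" using xy by simp
qed auto

end

text \<open>Finite-dimensional Hilbert spaces.\<close>

locale fd_space = ip_space V for V :: "('a, 'm) hilb_scheme" (structure) +
  assumes fin_dim: "fin_dim V"
begin

lemma ex_onb: "\<exists>E. onb E"
proof -
  obtain S where S: "finite S" "S \<subseteq> carrier V" "lspan V S = carrier V"
    using fin_dim unfolding fin_dim_def by auto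
  have "\<exists>E. orthonormal E \<and> (\<forall>x\<in>S. proj E x = x)" using S(1,2)
  proof (induction S rule: finite_induct)
    case empty
    have "orthonormal {}" by (simp add: orthonormal_def)
    then show ?case by auto
  next
    case (insert b S)
    then obtain E where E: "orthonormal E" "\<forall>x\<in>S. proj E x = x" by auto
    show ?case
    proof (cases "proj E b = b")
      case True then show ?thesis using E by auto
    next
      case False
      then obtain f where f: "orthonormal (insert f E)" "f \<notin> E" "proj (insert f E) b = b"
        using orthonormal_extend[OF E(1), of b] insert unfolding Let_def by auto
      have "proj (insert f E) x = x" if "x \<in> S" for x
        using orthonormal_insert_proj[OF E(1) f(1,2), of x] E(2) that insert by auto
      then show ?thesis using f by auto
    qed
  qed
  then obtain E where E: "orthonormal E" "\<forall>x\<in>S. proj E x = x" by auto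
  have "lspan V S \<subseteq> {x \<in> carrier V. proj E x = x}"
    using fixed_submodule[OF E(1)] E(2) S(2) by (intro lspan_least) auto
  then have "onb E" unfolding onb_def using S(3) E(1) by auto
  then show ?thesis by auto
qed

text \<open>A fixed but arbitrary orthonormal basis.\<close>

definition basis :: "'a set" where "basis = (SOME E. onb E)"

lemma onb_basis: "onb basis" unfolding basis_def using ex_onb by (rule someI_ex)

lemma basis_orthonormal: "orthonormal basis" using onb_basis onb_def by simp

lemma finite_basis [simp]: "finite basis" using basis_orthonormal orthonormalD by blast

lemma basis_carrier [simp]: "e \<in> basis \<Longrightarrow> e \<in> carrier V" using basis_orthonormal orthonormalD by blast

lemma ip_basis: "e \<in> basis \<Longrightarrow> f \<in> basis \<Longrightarrow> ip V e f = (if e = f then 1 else 0)"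
  using basis_orthonormal orthonormalD by blast

lemma basis_expand: "x \<in> carrier V \<Longrightarrow> finsum V (\<lambda>e. ip V e x \<odot>\<^bsub>V\<^esub> e) basis = x"
  using onb_basis unfolding onb_def proj_def by simp

lemma parseval: "x \<in> carrier V \<Longrightarrow> y \<in> carrier V \<Longrightarrow> (\<Sum>e\<in>basis. ip V e x * ip V y e) = ip V y x"
  using ip_proj_right[OF basis_orthonormal, of x y] onb_basis unfolding onb_def by simp

lemma orthonormal_card: assumes "orthonormal E" shows "card E \<le> card basis"
proof -
  have "real (card E) = (\<Sum>e\<in>E. Re (ip V e e))" using assms by (simp add: orthonormalD(4))
  also have "... = (\<Sum>e\<in>E. \<Sum>f\<in>basis. (cmod (ip V e f))\<^sup>2)"
  proof (rule sum.cong[OF refl])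
    fix e assume "e \<in> E"
    then have e: "e \<in> carrier V" using assms orthonormalD by blast
    have "ip V e e = (\<Sum>f\<in>basis. ip V f e * ip V e f)" using parseval[OF e e] by simp
    also have "... = complex_of_real (\<Sum>f\<in>basis. (cmod (ip V e f))\<^sup>2)"
      unfolding of_real_sum using e by (intro sum.cong) (auto simp: ip_commute[of e] complex_norm_square mult.commute simp del: of_real_power)
    finally show "Re (ip V e e) = (\<Sum>f\<in>basis. (cmod (ip V e f))\<^sup>2)" by simp
  qed
  also have "... = (\<Sum>f\<in>basis. \<Sum>e\<in>E. (cmod (ip V e f))\<^sup>2)" by (rule sum.swap)
  also have "... \<le> (\<Sum>f\<in>basis. 1)"
  proof (rule sum_mono)
    fix f assume f: "f \<in> basis"
    have "nrm V f = 1" using f nrm_eq ip_basis[OF f f] by simp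
    then show "(\<Sum>e\<in>E. (cmod (ip V e f))\<^sup>2) \<le> 1" using bessel[OF assms, of f] f by simp
  qed
  finally show ?thesis by simp
qed

text \<open>
  Every subspace has an orthonormal basis: by Bessel's inequality the orthonormal subsets have
  bounded cardinality, so there is one of maximal cardinality.
\<close>

lemma submodule_onb:
  assumes M: "submodule M CC V"
  shows "\<exists>E. orthonormal E \<and> E \<subseteq> M \<and> (\<forall>x\<in>M. proj E x = x)"
proof -
  let ?P = "\<lambda>E. orthonormal E \<and> E \<subseteq> M"
  have "\<exists>E. ?P E \<and> (\<forall>F. ?P F \<longrightarrow> card F \<le> card E)"
    by (rule ex_has_greatest_nat[where k = "{}" and f = card and b = "Suc (card basis)"])
       (auto simp: orthonormal_def less_Suc_eq_le intro: orthonormal_card[unfolded orthonormal_def])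
  then obtain E where E: "orthonormal E" "E \<subseteq> M" and mx: "\<And>F. orthonormal F \<Longrightarrow> F \<subseteq> M \<Longrightarrow> card F \<le> card E"
    by auto
  have "proj E x = x" if x: "x \<in> M" for x
  proof (rule ccontr)
    assume n: "proj E x \<noteq> x"
    have xc: "x \<in> carrier V" using x submoduleD[OF M] by auto
    from orthonormal_extend[OF E(1) xc n] obtain c where c: "orthonormal (insert (c \<odot>\<^bsub>V\<^esub> (x \<ominus>\<^bsub>V\<^esub> proj E x)) E)"
      "c \<odot>\<^bsub>V\<^esub> (x \<ominus>\<^bsub>V\<^esub> proj E x) \<notin> E" unfolding Let_def by auto
    have "proj E x \<in> M" unfolding proj_def
      using E M by (intro submodule_finsum) (auto dest: orthonormalD submoduleD)
    then have "c \<odot>\<^bsub>V\<^esub> (x \<ominus>\<^bsub>V\<^esub> proj E x) \<in> M" using M x submodule_diff submoduleD by meson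
    then have "card (insert (c \<odot>\<^bsub>V\<^esub> (x \<ominus>\<^bsub>V\<^esub> proj E x)) E) \<le> card E" using mx c(1) E(2) by blast
    then show False using c(2) orthonormalD(1)[OF E(1)] by simp
  qed
  then show ?thesis using E by auto
qed

lemma submodule_total:
  assumes M: "submodule M CC V" and t: "\<And>x. x \<in> carrier V \<Longrightarrow> (\<And>m. m \<in> M \<Longrightarrow> ip V m x = 0) \<Longrightarrow> x = \<zero>\<^bsub>V\<^esub>"
  shows "M = carrier V"
proof
  show "M \<subseteq> carrier V" using submoduleD[OF M] by auto
  obtain E where E: "orthonormal E" "E \<subseteq> M" "\<forall>x\<in>M. proj E x = x" using submodule_onb[OF M] by auto
  show "carrier V \<subseteq> M"
  proof
    fix x assume x: "x \<in> carrier V"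
    have p: "proj E x \<in> carrier V" using E x proj_closed by blast
    have pM: "proj E x \<in> M" unfolding proj_def
      using E M by (intro submodule_finsum) (auto dest: orthonormalD submoduleD)
    have "x \<ominus>\<^bsub>V\<^esub> proj E x = \<zero>\<^bsub>V\<^esub>"
    proof (rule t)
      fix m assume m: "m \<in> M"
      then have mc: "m \<in> carrier V" using submoduleD[OF M] by auto
      have "ip V m x = ip V (proj E m) x" using E m by simp
      also have "... = ip V m (proj E x)" using ip_proj_left[OF E(1) x mc] ip_proj_right[OF E(1) x mc] by simp
      finally show "ip V m (x \<ominus>\<^bsub>V\<^esub> proj E x) = 0" using mc x p by (simp add: ip_diff_right)
    qed (use x p in simp)
    then show "x \<in> M" using pM diff_zero_eq[OF x p] by simp
  qed
qed

end

section \<open>Operators and adjoints\<close>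

context cvec begin

lemma smult_add_left: "x \<in> carrier V \<Longrightarrow> (a + b) \<odot>\<^bsub>V\<^esub> x = a \<odot>\<^bsub>V\<^esub> x \<oplus>\<^bsub>V\<^esub> b \<odot>\<^bsub>V\<^esub> x"
  using smult_l_distr[of a b x] by simp

end

context ip_space begin

lemma proj_selfadj:
  "orthonormal E \<Longrightarrow> x \<in> carrier V \<Longrightarrow> y \<in> carrier V \<Longrightarrow> ip V y (proj E x) = ip V (proj E y) x"
  using ip_proj_left ip_proj_right by simp

lemma proj_in_submodule:
  "orthonormal E \<Longrightarrow> submodule M CC V \<Longrightarrow> E \<subseteq> M \<Longrightarrow> x \<in> carrier V \<Longrightarrow> proj E x \<in> M"
  unfolding proj_def by (intro submodule_finsum) (auto dest: orthonormalD submoduleD)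

lemma proj_add:
  assumes "orthonormal E" "x \<in> carrier V" "y \<in> carrier V"
  shows "proj E (x \<oplus>\<^bsub>V\<^esub> y) = proj E x \<oplus>\<^bsub>V\<^esub> proj E y"
  by (rule ip_eqI) (use assms in \<open>simp_all add: proj_closed proj_selfadj ip_add_right\<close>)

lemma proj_smult:
  assumes "orthonormal E" "x \<in> carrier V"
  shows "proj E (c \<odot>\<^bsub>V\<^esub> x) = c \<odot>\<^bsub>V\<^esub> proj E x"
  by (rule ip_eqI) (use assms in \<open>simp_all add: proj_closed proj_selfadj ip_smult_right\<close>)

lemma proj_orth:
  assumes "orthonormal E" "\<forall>m\<in>M. proj E m = m" "M \<subseteq> carrier V" "x \<in> carrier V" "m \<in> M"
  shows "ip V m (x \<ominus>\<^bsub>V\<^esub> proj E x) = 0"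
proof -
  have "m \<in> carrier V" "proj E m = m" using assms by auto
  then show ?thesis using assms(1,4) by (simp add: ip_diff_right proj_closed proj_selfadj)
qed

lemma proj_eqI:
  assumes E: "orthonormal E" "E \<subseteq> M" "\<forall>m\<in>M. proj E m = m" and M: "submodule M CC V"
    and x: "x \<in> carrier V" and y: "y \<in> M" and o: "\<And>m. m \<in> M \<Longrightarrow> ip V m (x \<ominus>\<^bsub>V\<^esub> y) = 0"
  shows "proj E x = y"
proof -
  have yc: "y \<in> carrier V" and Mc: "M \<subseteq> carrier V" using submoduleD[OF M] y by auto
  have p: "proj E x \<in> M" using proj_in_submodule[OF E(1) M E(2) x] .
  have pc: "proj E x \<in> carrier V" using p Mc by auto
  let ?d = "proj E x \<ominus>\<^bsub>V\<^esub> y"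
  have d: "?d \<in> M" using submodule_diff[OF M p y] .
  have dc: "?d \<in> carrier V" using d Mc by auto
  have "ip V ?d ?d = ip V ?d (x \<ominus>\<^bsub>V\<^esub> y) - ip V ?d (x \<ominus>\<^bsub>V\<^esub> proj E x)"
    using dc pc yc x by (simp add: ip_diff_right[OF dc])
  also have "... = 0" using o[OF d] proj_orth[OF E(1,3) Mc x d] by simp
  finally show ?thesis using ip_self_zero[OF dc] diff_zero_eq[OF pc yc] by blast
qed

end

context fd_space begin

lemma basis_span:
  assumes "submodule M CC V" "basis \<subseteq> M" "x \<in> carrier V" shows "x \<in> M"
proof -
  have "finsum V (\<lambda>e. ip V e x \<odot>\<^bsub>V\<^esub> e) basis \<in> M"
    using assms submoduleD[OF assms(1)] by (intro submodule_finsum) auto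
  then show ?thesis using basis_expand assms by simp
qed

text \<open>Subspaces are closed: no vector of the subspace is nearer to \<open>x\<close> than its projection.\<close>

lemma submodule_approx:
  assumes M: "submodule M CC V" and x: "x \<in> carrier V"
    and ap: "\<And>e. e > 0 \<Longrightarrow> \<exists>y\<in>M. nrm V (x \<ominus>\<^bsub>V\<^esub> y) < e"
  shows "x \<in> M"
proof -
  obtain E where E: "orthonormal E" "E \<subseteq> M" "\<forall>x\<in>M. proj E x = x" using submodule_onb[OF M] by auto
  have Mc: "M \<subseteq> carrier V" using submoduleD[OF M] by auto
  let ?z = "x \<ominus>\<^bsub>V\<^esub> proj E x"
  have p: "proj E x \<in> M" using proj_in_submodule[OF E(1) M E(2) x] .
  have pc: "proj E x \<in> carrier V" using p Mc by auto
  have z: "?z \<in> carrier V" using x pc by simp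
  have zo: "ip V ?z m = 0" if m: "m \<in> M" for m
    using proj_orth[OF E(1,3) Mc x m] ip_commute[of m ?z] m Mc z by auto
  have "nrm V ?z = 0"
  proof (rule ccontr)
    assume n: "nrm V ?z \<noteq> 0"
    then have pos: "nrm V ?z > 0" using nrm_nonneg[OF z] by linarith
    obtain y where y: "y \<in> M" "nrm V (x \<ominus>\<^bsub>V\<^esub> y) < nrm V ?z" using ap[OF pos] by auto
    have yc: "y \<in> carrier V" using y Mc by auto
    have "ip V ?z ?z = ip V ?z x - ip V ?z (proj E x)" using z x pc by (simp add: ip_diff_right[OF z])
    also have "... = ip V ?z x - ip V ?z y" using zo[OF p] zo[OF y(1)] by simp
    also have "... = ip V ?z (x \<ominus>\<^bsub>V\<^esub> y)" using z x yc by (simp add: ip_diff_right[OF z])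
    finally have "(nrm V ?z)\<^sup>2 = cmod (ip V ?z (x \<ominus>\<^bsub>V\<^esub> y))" using ip_self[OF z] by (metis norm_of_real abs_of_nonneg of_real_power zero_le_power2)
    also have "... \<le> nrm V ?z * nrm V (x \<ominus>\<^bsub>V\<^esub> y)" using cauchy_schwarz[OF z] x yc by simp
    also have "... < nrm V ?z * nrm V ?z" using pos y(2) by simp
    finally show False by (simp add: power2_eq_square)
  qed
  then have "?z = \<zero>\<^bsub>V\<^esub>" using nrm_eq_0[OF z] by blast
  then show ?thesis using diff_zero_eq[OF x pc] p by simp
qed

lemma nrm_zero [simp]: "nrm V \<zero>\<^bsub>V\<^esub> = 0" by (simp add: nrm_eq)

lemma cspan_eq_lspan:
  assumes "Y \<subseteq> carrier V" shows "cspan V Y = lspan V Y"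
proof
  show "cspan V Y \<subseteq> lspan V Y"
    unfolding cspan_def using submodule_approx[OF lspan_submodule[OF assms]] by blast
  show "lspan V Y \<subseteq> cspan V Y"
  proof
    fix x assume x: "x \<in> lspan V Y"
    then have xc: "x \<in> carrier V" using lspan_carrier[OF assms] by auto
    then have "nrm V (x \<ominus>\<^bsub>V\<^esub> x) = 0" by (simp add: a_minus_def M.r_neg)
    then show "x \<in> cspan V Y" using x xc unfolding cspan_def by force
  qed
qed

end

lemma OpsD:
  assumes "T \<in> carrier (Ops V W)"
  shows "T \<in> carrier V \<rightarrow>\<^sub>E carrier W" "x \<in> carrier V \<Longrightarrow> T x \<in> carrier W"
    "x \<in> carrier V \<Longrightarrow> y \<in> carrier V \<Longrightarrow> T (x \<oplus>\<^bsub>V\<^esub> y) = T x \<oplus>\<^bsub>W\<^esub> T y"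
    "x \<in> carrier V \<Longrightarrow> T (c \<odot>\<^bsub>V\<^esub> x) = c \<odot>\<^bsub>W\<^esub> T x"
    "T \<in> extensional (carrier V)"
  using assms by (auto simp: Ops_def PiE_def)

lemma Ops_eqI:
  assumes "S \<in> carrier (Ops V W)" "T \<in> carrier (Ops V W)" "\<And>x. x \<in> carrier V \<Longrightarrow> S x = T x"
  shows "S = T"
  using assms OpsD(5) by (intro extensionalityI[of S "carrier V" T]) auto

lemma Lalg_simps [simp]:
  "carrier (Lalg V) = carrier (Ops V V)" "mult (Lalg V) = compose (carrier V)"
  "one (Lalg V) = (\<lambda>x\<in>carrier V. x)" "zero (Lalg V) = zero (Ops V V)"
  "add (Lalg V) = add (Ops V V)" "smult (Lalg V) = smult (Ops V V)"
  "nrm (Lalg V) = nrm (Ops V V)" "star (Lalg V) = adj V V"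
  by (simp_all add: Lalg_def)

lemma Ops_simps:
  "zero (Ops V W) = (\<lambda>x\<in>carrier V. \<zero>\<^bsub>W\<^esub>)"
  "add (Ops V W) S T = (\<lambda>x\<in>carrier V. S x \<oplus>\<^bsub>W\<^esub> T x)"
  "smult (Ops V W) c T = (\<lambda>x\<in>carrier V. c \<odot>\<^bsub>W\<^esub> T x)"
  "nrm (Ops V W) T = (SUP x\<in>{x \<in> carrier V. nrm V x \<le> 1}. nrm W (T x))"
  by (simp_all add: Ops_def)

lemma Ops_zero_apply [simp]: "x \<in> carrier V \<Longrightarrow> zero (Ops V W) x = \<zero>\<^bsub>W\<^esub>" by (simp add: Ops_simps)
lemma Ops_add_apply [simp]: "x \<in> carrier V \<Longrightarrow> add (Ops V W) S T x = S x \<oplus>\<^bsub>W\<^esub> T x" by (simp add: Ops_simps)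
lemma Ops_smult_apply [simp]: "x \<in> carrier V \<Longrightarrow> smult (Ops V W) c T x = c \<odot>\<^bsub>W\<^esub> T x" by (simp add: Ops_simps)

text \<open>Two finite-dimensional Hilbert spaces, the setting for operators from one to the other.\<close>

locale fd_pair = V: fd_space V + W: fd_space W
  for V :: "('a, 'm) hilb_scheme" and W :: "('b, 'n) hilb_scheme"
begin

lemma linear_finsum:
  assumes "finite E" "\<And>e. e \<in> E \<Longrightarrow> f e \<in> carrier V"
    and T: "T \<in> carrier V \<rightarrow> carrier W" "\<And>x y. x \<in> carrier V \<Longrightarrow> y \<in> carrier V \<Longrightarrow> T (x \<oplus>\<^bsub>V\<^esub> y) = T x \<oplus>\<^bsub>W\<^esub> T y"
     "\<And>c x. x \<in> carrier V \<Longrightarrow> T (c \<odot>\<^bsub>V\<^esub> x) = c \<odot>\<^bsub>W\<^esub> T x"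
  shows "T (finsum V f E) = finsum W (\<lambda>e. T (f e)) E"
  using assms(1,2)
proof (induction E rule: finite_induct)
  case empty
  have "T (0 \<odot>\<^bsub>V\<^esub> \<zero>\<^bsub>V\<^esub>) = 0 \<odot>\<^bsub>W\<^esub> T \<zero>\<^bsub>V\<^esub>" using T(3) by blast
  moreover have "T \<zero>\<^bsub>V\<^esub> \<in> carrier W" using T(1) by auto
  ultimately show ?case by simp
next
  case (insert e E)
  have f: "f \<in> E \<rightarrow> carrier V" "f e \<in> carrier V" using insert by auto
  have Tf: "(\<lambda>e. T (f e)) \<in> E \<rightarrow> carrier W" "T (f e) \<in> carrier W" using f T(1) by auto
  have "T (finsum V f (insert e E)) = T (f e \<oplus>\<^bsub>V\<^esub> finsum V f E)"
    using f insert by (simp add: V.finsum_insert)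
  also have "... = T (f e) \<oplus>\<^bsub>W\<^esub> finsum W (\<lambda>e. T (f e)) E"
    using T(2)[OF f(2) V.finsum_closed[OF f(1)]] insert by simp
  also have "... = finsum W (\<lambda>e. T (f e)) (insert e E)"
    using Tf insert by (simp add: W.finsum_insert)
  finally show ?case .
qed

text \<open>Boundedness is automatic in finite dimensions.\<close>

lemma OpsI:
  assumes T: "T \<in> carrier V \<rightarrow>\<^sub>E carrier W" "\<And>x y. x \<in> carrier V \<Longrightarrow> y \<in> carrier V \<Longrightarrow> T (x \<oplus>\<^bsub>V\<^esub> y) = T x \<oplus>\<^bsub>W\<^esub> T y"
     "\<And>c x. x \<in> carrier V \<Longrightarrow> T (c \<odot>\<^bsub>V\<^esub> x) = c \<odot>\<^bsub>W\<^esub> T x"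
  shows "T \<in> carrier (Ops V W)"
proof -
  let ?C = "\<Sum>e\<in>V.basis. nrm W (T e)"
  have Tc: "T \<in> carrier V \<rightarrow> carrier W" using T(1) by auto
  have "nrm W (T x) \<le> ?C * nrm V x" if x: "x \<in> carrier V" for x
  proof -
    have "T x = T (finsum V (\<lambda>e. ip V e x \<odot>\<^bsub>V\<^esub> e) V.basis)" using V.basis_expand[OF x] by simp
    also have "... = finsum W (\<lambda>e. T (ip V e x \<odot>\<^bsub>V\<^esub> e)) V.basis"
      by (rule linear_finsum) (use Tc T(2,3) in auto)
    finally have "nrm W (T x) \<le> (\<Sum>e\<in>V.basis. nrm W (T (ip V e x \<odot>\<^bsub>V\<^esub> e)))"
      using W.nrm_finsum[of V.basis "\<lambda>e. T (ip V e x \<odot>\<^bsub>V\<^esub> e)"] Tc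
      by (metis V.finite_basis V.basis_carrier V.smult_in funcset_mem)
    also have "... \<le> (\<Sum>e\<in>V.basis. nrm W (T e) * nrm V x)"
    proof (rule sum_mono)
      fix e assume e: "e \<in> V.basis"
      have Te: "T e \<in> carrier W" using Tc e by auto
      have "cmod (ip V e x) \<le> nrm V x"
        using V.cauchy_schwarz[of e x] e x V.nrm_eq[of e] V.ip_basis[OF e e] by simp
      then show "nrm W (T (ip V e x \<odot>\<^bsub>V\<^esub> e)) \<le> nrm W (T e) * nrm V x"
        using T(3)[of e] e W.nrm_smult[OF Te] W.nrm_nonneg[OF Te]
        by (simp add: mult.commute[of "nrm W (T e)"] mult_right_mono)
    qed
    finally show ?thesis by (simp add: sum_distrib_right)
  qed
  then show ?thesis using T by (auto simp: Ops_def)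
qed

lemma restrict_OpsI:
  assumes "\<And>x. x \<in> carrier V \<Longrightarrow> t x \<in> carrier W"
     "\<And>x y. x \<in> carrier V \<Longrightarrow> y \<in> carrier V \<Longrightarrow> t (x \<oplus>\<^bsub>V\<^esub> y) = t x \<oplus>\<^bsub>W\<^esub> t y"
     "\<And>c x. x \<in> carrier V \<Longrightarrow> t (c \<odot>\<^bsub>V\<^esub> x) = c \<odot>\<^bsub>W\<^esub> t x"
  shows "(\<lambda>x\<in>carrier V. t x) \<in> carrier (Ops V W)"
  by (rule OpsI) (use assms in auto)

lemma Ops_finsum:
  assumes "T \<in> carrier (Ops V W)" "finite E" "\<And>e. e \<in> E \<Longrightarrow> f e \<in> carrier V"
  shows "T (finsum V f E) = finsum W (\<lambda>e. T (f e)) E"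
  by (rule linear_finsum) (use assms OpsD[OF assms(1)] in auto)

lemma Ops_zero: "T \<in> carrier (Ops V W) \<Longrightarrow> T \<zero>\<^bsub>V\<^esub> = \<zero>\<^bsub>W\<^esub>"
  using Ops_finsum[of T "{}" "\<lambda>_. \<zero>\<^bsub>V\<^esub>"] by simp

lemma Ops_add_closed: "S \<in> carrier (Ops V W) \<Longrightarrow> T \<in> carrier (Ops V W) \<Longrightarrow> add (Ops V W) S T \<in> carrier (Ops V W)"
  unfolding Ops_simps by (rule restrict_OpsI) (auto dest: OpsD simp: OpsD(3,4) W.M.add.m_ac W.smult_r_distr OpsD(2))

lemma Ops_smult_closed: "T \<in> carrier (Ops V W) \<Longrightarrow> smult (Ops V W) c T \<in> carrier (Ops V W)"
  unfolding Ops_simps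
  by (rule restrict_OpsI) (auto simp: OpsD(2,3,4) W.smult_r_distr mult.commute simp flip: W.smult_assoc1[simplified])

lemma Ops_zero_closed: "zero (Ops V W) \<in> carrier (Ops V W)"
  unfolding Ops_simps by (rule restrict_OpsI) auto

lemma cvec_Ops: "cvec (Ops V W)"
proof (unfold cvec_def, rule moduleI)
  show "cring CC" by (rule cring_CC)
  show "abelian_group (Ops V W)"
  proof (rule abelian_groupI)
    fix S assume S: "S \<in> carrier (Ops V W)"
    show "\<exists>T\<in>carrier (Ops V W). T \<oplus>\<^bsub>Ops V W\<^esub> S = \<zero>\<^bsub>Ops V W\<^esub>"
    proof (rule bexI)
      show "smult (Ops V W) (-1) S \<in> carrier (Ops V W)" using S Ops_smult_closed by blast
      show "smult (Ops V W) (-1) S \<oplus>\<^bsub>Ops V W\<^esub> S = \<zero>\<^bsub>Ops V W\<^esub>"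
      proof (rule Ops_eqI)
        fix x assume x: "x \<in> carrier V"
        have "(-1) \<odot>\<^bsub>W\<^esub> S x \<oplus>\<^bsub>W\<^esub> S x = \<zero>\<^bsub>W\<^esub>"
          using W.smult_add_left[OF OpsD(2)[OF S x], of "-1" 1] OpsD(2)[OF S x] by simp
        then show "(smult (Ops V W) (-1) S \<oplus>\<^bsub>Ops V W\<^esub> S) x = \<zero>\<^bsub>Ops V W\<^esub> x" using S x OpsD(2)[OF S x] by simp
      qed (use S Ops_smult_closed Ops_add_closed Ops_zero_closed in blast)+
    qed
  qed (auto intro!: Ops_eqI[of _ V W] Ops_add_closed Ops_zero_closed simp: OpsD(2) W.M.add.m_ac)
qed (auto intro!: Ops_eqI[of _ V W] Ops_add_closed Ops_zero_closed Ops_smult_closed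
       simp: OpsD(2) W.M.add.m_ac W.smult_l_distr[simplified] W.smult_r_distr W.smult_assoc1[simplified])

sublocale O: cvec "Ops V W" by (rule cvec_Ops)

lemma Ops_diff_apply:
  assumes "S \<in> carrier (Ops V W)" "T \<in> carrier (Ops V W)" "x \<in> carrier V"
  shows "(S \<ominus>\<^bsub>Ops V W\<^esub> T) x = S x \<ominus>\<^bsub>W\<^esub> T x"
proof -
  let ?D = "S \<ominus>\<^bsub>Ops V W\<^esub> T"
  have D: "?D \<in> carrier (Ops V W)" using assms by simp
  have "S = ?D \<oplus>\<^bsub>Ops V W\<^esub> T" using assms by (simp add: a_minus_def O.M.add.m_assoc O.M.l_neg)
  then have "S x = ?D x \<oplus>\<^bsub>W\<^esub> T x" using assms(3) by (metis Ops_add_apply)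
  then show ?thesis using OpsD(2)[OF assms(1,3)] OpsD(2)[OF assms(2,3)] OpsD(2)[OF D assms(3)]
    by (simp add: a_minus_def W.M.add.m_assoc W.M.r_neg)
qed

lemma ex_adj:
  assumes T: "T \<in> carrier (Ops V W)"
  shows "\<exists>S. S \<in> carrier (Ops W V) \<and> (\<forall>x\<in>carrier V. \<forall>y\<in>carrier W. ip W (T x) y = ip V x (S y))"
proof -
  interpret WV: fd_pair W V ..
  have Tc: "\<And>x. x \<in> carrier V \<Longrightarrow> T x \<in> carrier W" using OpsD(2)[OF T] .
  let ?s = "\<lambda>y. finsum V (\<lambda>e. ip W (T e) y \<odot>\<^bsub>V\<^esub> e) V.basis"
  have sc: "?s y \<in> carrier V" for y by (intro V.finsum_closed) auto
  have eq: "ip V x (?s y) = ip W (T x) y" if x: "x \<in> carrier V" and y: "y \<in> carrier W" for x y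
  proof -
    have "ip W (T x) y = ip W (T (finsum V (\<lambda>e. ip V e x \<odot>\<^bsub>V\<^esub> e) V.basis)) y" using V.basis_expand[OF x] by simp
    also have "... = (\<Sum>e\<in>V.basis. ip W (T (ip V e x \<odot>\<^bsub>V\<^esub> e)) y)"
      using Tc y by (simp add: Ops_finsum[OF T] W.ip_finsum_left)
    also have "... = (\<Sum>e\<in>V.basis. ip W (T e) y * ip V x e)"
      using Tc y x by (intro sum.cong) (simp_all add: OpsD(4)[OF T] W.ip_smult_left V.ip_commute[of x] mult.commute)
    also have "... = ip V x (?s y)"
      using x by (simp add: V.ip_finsum_right V.ip_smult_right)
    finally show ?thesis ..
  qed
  have "(\<lambda>y\<in>carrier W. ?s y) \<in> carrier (Ops W V)"
  proof (rule WV.restrict_OpsI)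
    fix y z assume "y \<in> carrier W" "z \<in> carrier W"
    then show "?s (y \<oplus>\<^bsub>W\<^esub> z) = ?s y \<oplus>\<^bsub>V\<^esub> ?s z"
      by (intro V.ip_eqI) (simp_all only: V.ip_add_right sc eq V.M.a_closed W.M.a_closed, simp add: W.ip_add_right Tc)
  next
    fix c y assume "y \<in> carrier W"
    then show "?s (c \<odot>\<^bsub>W\<^esub> y) = c \<odot>\<^bsub>V\<^esub> ?s y"
      by (intro V.ip_eqI) (simp_all only: V.ip_smult_right sc eq V.smult_in W.smult_in, simp add: W.ip_smult_right Tc)
  qed (rule sc)
  then show ?thesis using eq by (intro exI[of _ "\<lambda>y\<in>carrier W. ?s y"]) auto
qed

lemma adj_eqI:
  assumes "S \<in> carrier (Ops W V)"
    "\<And>x y. x \<in> carrier V \<Longrightarrow> y \<in> carrier W \<Longrightarrow> ip W (T x) y = ip V x (S y)"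
  shows "adj V W T = S"
  unfolding adj_def
proof (rule the_equality)
  fix R assume R: "R \<in> carrier (Ops W V) \<and> (\<forall>x\<in>carrier V. \<forall>y\<in>carrier W. ip W (T x) y = ip V x (R y))"
  show "R = S"
  proof (rule Ops_eqI)
    fix y assume y: "y \<in> carrier W"
    show "R y = S y"
      by (rule V.ip_eqI) (use R assms y OpsD(2) in fastforce)+
  qed (use R assms in auto)
qed (use assms in auto)

lemma adj_props:
  assumes T: "T \<in> carrier (Ops V W)"
  shows adj_closed: "adj V W T \<in> carrier (Ops W V)"
    and adj_ip: "\<lbrakk>x \<in> carrier V; y \<in> carrier W\<rbrakk> \<Longrightarrow> ip W (T x) y = ip V x (adj V W T y)"
    and adj_ip2: "\<lbrakk>x \<in> carrier V; y \<in> carrier W\<rbrakk> \<Longrightarrow> ip W y (T x) = ip V (adj V W T y) x"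
proof -
  obtain S where S: "S \<in> carrier (Ops W V)" "\<And>x y. x \<in> carrier V \<Longrightarrow> y \<in> carrier W \<Longrightarrow> ip W (T x) y = ip V x (S y)"
    using ex_adj[OF T] by blast
  have eq: "adj V W T = S" by (rule adj_eqI) (use S in auto)
  show c: "adj V W T \<in> carrier (Ops W V)" using eq S by simp
  show i: "ip W (T x) y = ip V x (adj V W T y)" if "x \<in> carrier V" "y \<in> carrier W" for x y
    using eq S that by simp
  show "ip W y (T x) = ip V (adj V W T y) x" if x: "x \<in> carrier V" and y: "y \<in> carrier W" for x y
    using i[OF x y] W.ip_commute[OF OpsD(2)[OF T x] y] V.ip_commute[OF x OpsD(2)[OF c y]] by simp
qed

lemma adj_adj:
  assumes T: "T \<in> carrier (Ops V W)" shows "adj W V (adj V W T) = T"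
proof -
  interpret WV: fd_pair W V ..
  show ?thesis by (rule WV.adj_eqI) (use T adj_ip2[OF T] in auto)
qed

end

lemma compose_Ops:
  assumes "fd_space V" "fd_space W" "fd_space Z" "T \<in> carrier (Ops V W)" "S \<in> carrier (Ops W Z)"
  shows "compose (carrier V) S T \<in> carrier (Ops V Z)"
proof -
  interpret V: fd_space V by fact
  interpret Z: fd_space Z by fact
  interpret fd_pair V Z ..
  show ?thesis unfolding compose_def
    by (rule restrict_OpsI) (use assms in \<open>auto simp: OpsD(2,3,4)\<close>)
qed

lemma adj_compose:
  assumes "fd_space V" "fd_space W" "fd_space Z" "T \<in> carrier (Ops V W)" "S \<in> carrier (Ops W Z)"
  shows "adj V Z (compose (carrier V) S T) = compose (carrier Z) (adj V W T) (adj W Z S)"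
proof -
  interpret V: fd_space V by fact
  interpret W: fd_space W by fact
  interpret Z: fd_space Z by fact
  interpret VW: fd_pair V W ..
  interpret WZ: fd_pair W Z ..
  interpret VZ: fd_pair V Z ..
  show ?thesis
  proof (rule VZ.adj_eqI)
    show "compose (carrier Z) (adj V W T) (adj W Z S) \<in> carrier (Ops Z V)"
      using assms VW.adj_closed WZ.adj_closed compose_Ops by blast
    fix x y assume "x \<in> carrier V" "y \<in> carrier Z"
    then show "ip Z (compose (carrier V) S T x) y = ip V x (compose (carrier Z) (adj V W T) (adj W Z S) y)"
      using assms by (simp add: compose_eq WZ.adj_ip VW.adj_ip OpsD(2) OpsD(2)[OF WZ.adj_closed])
  qed
qed

section \<open>Hilbert--Schmidt inner product and bicommutant theorem\<close>

lemma submodule_Lalg: "submodule M CC (Lalg V) \<longleftrightarrow> submodule M CC (Ops V V)"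
  by (simp add: submodule_def submodule_axioms_def subgroup_def m_inv_def)

lemma lspan_Lalg: "lspan (Lalg V) Y = lspan (Ops V V) Y"
  by (simp add: lspan_def submodule_Lalg)

lemma cspan_Lalg: "cspan (Lalg V) Y = cspan (Ops V V) Y"
  by (simp add: cspan_def lspan_Lalg a_minus_def a_inv_def m_inv_def)

text \<open>
  The space of operators from \<open>V\<close> to \<open>W\<close> with the Hilbert--Schmidt inner product, computed in the
  fixed basis of \<open>V\<close>. Its vector space structure is that of \<open>Ops V W\<close>, its norm is a different one.
\<close>

definition HS :: "('a, 'm) hilb_scheme \<Rightarrow> ('b, 'n) hilb_scheme \<Rightarrow> ('a \<Rightarrow> 'b) hilb" where
  "HS V W = \<lparr>carrier = carrier (Ops V W), mult = undefined, one = undefined,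
     zero = zero (Ops V W), add = add (Ops V W), smult = smult (Ops V W),
     nrm = (\<lambda>T. sqrt (Re (\<Sum>e\<in>fd_space.basis V. ip W (T e) (T e)))),
     ip = (\<lambda>S T. \<Sum>e\<in>fd_space.basis V. ip W (S e) (T e))\<rparr>"

lemma HS_simps [simp]:
  "carrier (HS V W) = carrier (Ops V W)" "zero (HS V W) = zero (Ops V W)" "add (HS V W) = add (Ops V W)"
  "smult (HS V W) = smult (Ops V W)" "ip (HS V W) S T = (\<Sum>e\<in>fd_space.basis V. ip W (S e) (T e))"
  "nrm (HS V W) T = sqrt (Re (\<Sum>e\<in>fd_space.basis V. ip W (T e) (T e)))"
  by (simp_all add: HS_def)

lemma submodule_HS: "submodule M CC (HS V W) \<longleftrightarrow> submodule M CC (Ops V W)"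
  by (simp add: submodule_def submodule_axioms_def subgroup_def m_inv_def)

lemma a_minus_HS: "a_minus (HS V W) = a_minus (Ops V W)"
  by (simp add: a_minus_def a_inv_def m_inv_def fun_eq_iff)

context fd_pair begin

lemma cvec_HS: "cvec (HS V W)"
proof -
  have g: "abelian_group (HS V W)"
    by (rule abelian_groupI)
       (use O.M.add.m_ac O.M.add.l_inv_ex in \<open>auto intro!: Ops_add_closed Ops_zero_closed\<close>)
  show ?thesis unfolding cvec_def
    by (rule moduleI[OF cring_CC g])
       (use O.smult_l_distr O.smult_r_distr O.smult_assoc1 in \<open>simp_all\<close>)
qed

lemma ip_space_HS: "ip_space (HS V W)"
proof -
  interpret cvec "HS V W" by (rule cvec_HS)
  note Tc = OpsD(2)[where V=V and W=W]
  show ?thesis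
  proof (unfold_locales, goal_cases)
    case (1 x y z) then show ?case by (simp add: W.ip_add_right Tc sum.distrib)
  next
    case (2 x y c) then show ?case by (simp add: W.ip_smult_right Tc sum_distrib_left)
  next
    case (3 x y) then show ?case by (simp add: Tc W.ip_commute[of "x _" "y _"])
  next
    case (4 T)
    then have T: "T \<in> carrier (Ops V W)" by simp
    have "\<exists>e\<in>V.basis. T e \<noteq> \<zero>\<^bsub>W\<^esub>"
    proof (rule ccontr)
      assume a: "\<not> ?thesis"
      have "submodule {x \<in> carrier V. T x = \<zero>\<^bsub>W\<^esub>} CC V"
        by (rule V.submoduleI') (use T Ops_zero[OF T] in \<open>auto simp: OpsD(3,4)\<close>)
      then have "x \<in> {x \<in> carrier V. T x = \<zero>\<^bsub>W\<^esub>}" if "x \<in> carrier V" for x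
        by (rule V.basis_span) (use a that in auto)
      then have "\<And>x. x \<in> carrier V \<Longrightarrow> T x = \<zero>\<^bsub>W\<^esub>" by blast
      then have "T = zero (Ops V W)" using T Ops_zero_closed by (intro Ops_eqI) auto
      then show False using 4 by simp
    qed
    then obtain e where e: "e \<in> V.basis" "T e \<noteq> \<zero>\<^bsub>W\<^esub>" by auto
    have "Re (\<Sum>e\<in>V.basis. ip W (T e) (T e)) = (\<Sum>e\<in>V.basis. Re (ip W (T e) (T e)))" by simp
    also have "... > 0"
    proof (rule sum_pos2[OF _ e(1)])
      show "0 < Re (ip W (T e) (T e))" using W.ip_pos[OF Tc[OF T] e(2)] e by simp
      fix i assume "i \<in> V.basis"
      then show "0 \<le> Re (ip W (T i) (T i))" using W.ip_self[OF Tc[OF T]] by (simp flip: of_real_power)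
    qed simp
    finally show ?case by simp
  next
    case (5 x) then show ?case by simp
  qed
qed

text \<open>The operator \<open>|f\<rangle>\<langle>e|\<close>.\<close>

definition rank1 :: "'b \<Rightarrow> 'a \<Rightarrow> 'a \<Rightarrow> 'b" where
  "rank1 f e = (\<lambda>x\<in>carrier V. ip V e x \<odot>\<^bsub>W\<^esub> f)"

lemma rank1_apply [simp]: "x \<in> carrier V \<Longrightarrow> rank1 f e x = ip V e x \<odot>\<^bsub>W\<^esub> f"
  by (simp add: rank1_def)

lemma rank1_closed: "f \<in> carrier W \<Longrightarrow> e \<in> carrier V \<Longrightarrow> rank1 f e \<in> carrier (Ops V W)"
  unfolding rank1_def
  by (rule restrict_OpsI) (simp_all add: V.ip_add_right V.ip_smult_right W.smult_l_distr[simplified] W.smult_assoc1[simplified])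

lemma ip_HS_rank1:
  assumes "X \<in> carrier (Ops V W)" "f \<in> carrier W" "e \<in> V.basis"
  shows "ip (HS V W) X (rank1 f e) = ip W (X e) f"
proof -
  have "ip (HS V W) X (rank1 f e) = (\<Sum>e'\<in>V.basis. if e = e' then ip W (X e') f else 0)"
    unfolding HS_simps
    by (rule sum.cong) (use assms OpsD(2)[OF assms(1)] in \<open>auto simp: W.ip_smult_right V.ip_basis\<close>)
  then show ?thesis using assms by simp
qed

lemma rank1_span:
  assumes M: "submodule M CC (Ops V W)" and r: "\<And>f e. f \<in> W.basis \<Longrightarrow> e \<in> V.basis \<Longrightarrow> rank1 f e \<in> M"
    and T: "T \<in> carrier (Ops V W)"
  shows "T \<in> M"
proof -
  interpret H: ip_space "HS V W" by (rule ip_space_HS)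
  let ?B = "W.basis \<times> V.basis"
  let ?f = "\<lambda>(f, e). ip W f (T e) \<odot>\<^bsub>HS V W\<^esub> rank1 f e"
  have fin: "finite ?B" by simp
  have M': "submodule M CC (HS V W)" using M submodule_HS by blast
  have fc: "p \<in> ?B \<Longrightarrow> ?f p \<in> carrier (HS V W)" for p
    by (auto intro!: Ops_smult_closed rank1_closed)
  have sM: "finsum (HS V W) ?f ?B \<in> M"
    by (rule H.submodule_finsum[OF M' fin]) (use r H.submoduleD(4)[OF M'] in auto)
  have "finsum (HS V W) ?f ?B = T"
  proof (rule H.ip_eqI)
    show "finsum (HS V W) ?f ?B \<in> carrier (HS V W)" using fc by (intro H.finsum_closed) auto
    show "T \<in> carrier (HS V W)" using T by simp
    fix X assume X: "X \<in> carrier (HS V W)"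
    then have X': "X \<in> carrier (Ops V W)" by simp
    have "ip (HS V W) X (finsum (HS V W) ?f ?B) = (\<Sum>p\<in>?B. ip (HS V W) X (?f p))"
      by (rule H.ip_finsum_right[OF fin fc X])
    also have "... = (\<Sum>p\<in>?B. ip W (fst p) (T (snd p)) * ip W (X (snd p)) (fst p))"
    proof (rule sum.cong[OF refl])
      fix p assume p: "p \<in> ?B"
      then have rc: "rank1 (fst p) (snd p) \<in> carrier (HS V W)" by (auto intro!: rank1_closed)
      have "ip (HS V W) X (?f p) = ip W (fst p) (T (snd p)) * ip (HS V W) X (rank1 (fst p) (snd p))"
        using H.ip_smult_right[OF X rc] by (simp only: case_prod_beta)
      also have "ip (HS V W) X (rank1 (fst p) (snd p)) = ip W (X (snd p)) (fst p)"
        using p by (intro ip_HS_rank1[OF X']) auto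
      finally show "ip (HS V W) X (?f p) = ip W (fst p) (T (snd p)) * ip W (X (snd p)) (fst p)" .
    qed
    also have "... = (\<Sum>f\<in>W.basis. \<Sum>e\<in>V.basis. ip W f (T e) * ip W (X e) f)"
      unfolding sum.cartesian_product by (simp add: case_prod_beta)
    also have "... = (\<Sum>e\<in>V.basis. \<Sum>f\<in>W.basis. ip W f (T e) * ip W (X e) f)" by (rule sum.swap)
    also have "... = (\<Sum>e\<in>V.basis. ip W (X e) (T e))"
      by (intro sum.cong refl W.parseval) (use OpsD(2)[OF T] OpsD(2)[OF X'] in auto)
    finally show "ip (HS V W) X (finsum (HS V W) ?f ?B) = ip (HS V W) X T" by simp
  qed
  then show ?thesis using sM by simp
qed

lemma fd_space_HS: "fd_space (HS V W)"
proof -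
  interpret H: ip_space "HS V W" by (rule ip_space_HS)
  show ?thesis
  proof (unfold_locales)
    let ?S = "(\<lambda>(f, e). rank1 f e) ` (W.basis \<times> V.basis)"
    have S: "?S \<subseteq> carrier (Ops V W)" by (auto intro!: rank1_closed)
    then have S': "?S \<subseteq> carrier (HS V W)" by simp
    have "submodule (lspan (HS V W) ?S) CC (Ops V W)"
      using H.lspan_submodule[OF S'] by (simp add: submodule_HS)
    then have "T \<in> lspan (HS V W) ?S" if "T \<in> carrier (Ops V W)" for T
      using rank1_span[OF _ _ that] H.lspan_base[of ?S] by force
    then have "lspan (HS V W) ?S = carrier (HS V W)" using H.lspan_carrier[OF S'] by auto
    then show "fin_dim (HS V W)" unfolding fin_dim_def using S' by (intro exI[of _ ?S]) simp
  qed
qed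

sublocale HS: fd_space "HS V W" by (rule fd_space_HS)

lemma Ops_bdd: "T \<in> carrier (Ops V W) \<Longrightarrow> bdd_above ((\<lambda>x. nrm W (T x)) ` {x \<in> carrier V. nrm V x \<le> 1})"
proof -
  assume T: "T \<in> carrier (Ops V W)"
  then have "\<exists>C. \<forall>x\<in>carrier V. nrm W (T x) \<le> C * nrm V x" by (simp add: Ops_def)
  then obtain C where C: "\<And>x. x \<in> carrier V \<Longrightarrow> nrm W (T x) \<le> C * nrm V x" by blast
  show ?thesis
  proof (rule bdd_aboveI2)
    fix x assume "x \<in> {x \<in> carrier V. nrm V x \<le> 1}"
    then have x: "x \<in> carrier V" "nrm V x \<le> 1" by auto
    have "C * nrm V x \<le> \<bar>C\<bar> * 1" using x V.nrm_nonneg[OF x(1)] by (intro mult_mono) auto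
    then show "nrm W (T x) \<le> \<bar>C\<bar>" using C[OF x(1)] by simp
  qed
qed

lemma HS_nrm_le:
  assumes T: "T \<in> carrier (Ops V W)"
  shows "nrm (HS V W) T \<le> (1 + real (card V.basis)) * nrm (Ops V W) T"
proof -
  let ?n = "nrm (Ops V W) T"
  have e: "nrm W (T e) \<le> ?n" if "e \<in> V.basis" for e
    unfolding Ops_simps
    by (rule cSUP_upper[OF _ Ops_bdd[OF T]]) (use that V.nrm_eq V.ip_basis in auto)
  have z: "nrm W (T \<zero>\<^bsub>V\<^esub>) \<le> ?n"
    unfolding Ops_simps by (rule cSUP_upper[OF _ Ops_bdd[OF T]]) auto
  have n0: "0 \<le> ?n" using z Ops_zero[OF T] by simp
  have "Re (\<Sum>e\<in>V.basis. ip W (T e) (T e)) = (\<Sum>e\<in>V.basis. (nrm W (T e))\<^sup>2)"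
    using OpsD(2)[OF T] by (simp add: W.ip_self flip: of_real_power)
  also have "... \<le> (\<Sum>e\<in>V.basis. ?n\<^sup>2)"
    using e OpsD(2)[OF T] by (intro sum_mono power_mono) auto
  also have "... \<le> ((1 + real (card V.basis)) * ?n)\<^sup>2"
  proof -
    have "real (card V.basis) \<le> (1 + real (card V.basis))\<^sup>2" by (simp add: power2_eq_square algebra_simps)
    then show ?thesis by (simp add: power_mult_distrib mult_right_mono)
  qed
  finally show ?thesis using n0 by (simp add: real_le_lsqrt del: Re_sum)
qed

text \<open>
  Linear spans of operators are closed in operator norm, because the operator norm dominates the
  Hilbert--Schmidt norm up to a constant.
\<close>

lemma cspan_Ops:
  assumes Y: "Y \<subseteq> carrier (Ops V W)" shows "cspan (Ops V W) Y = lspan (Ops V W) Y"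
proof
  have sm: "submodule (lspan (Ops V W) Y) CC (HS V W)" using O.lspan_submodule[OF Y] submodule_HS by blast
  show "cspan (Ops V W) Y \<subseteq> lspan (Ops V W) Y"
  proof
    fix T assume "T \<in> cspan (Ops V W) Y"
    then have T: "T \<in> carrier (Ops V W)" and ap: "\<And>e. e > 0 \<Longrightarrow> \<exists>S\<in>lspan (Ops V W) Y. nrm (Ops V W) (T \<ominus>\<^bsub>Ops V W\<^esub> S) < e"
      unfolding cspan_def by auto
    show "T \<in> lspan (Ops V W) Y"
    proof (rule HS.submodule_approx[OF sm])
      show "T \<in> carrier (HS V W)" using T by simp
      fix e :: real assume e: "e > 0"
      let ?k = "1 + real (card V.basis)"
      have "e / ?k > 0" using e by simp
      then obtain S where S: "S \<in> lspan (Ops V W) Y" "nrm (Ops V W) (T \<ominus>\<^bsub>Ops V W\<^esub> S) < e / ?k"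
        using ap by blast
      have "T \<ominus>\<^bsub>Ops V W\<^esub> S \<in> carrier (Ops V W)" using T S O.lspan_carrier[OF Y] by auto
      then have "nrm (HS V W) (T \<ominus>\<^bsub>Ops V W\<^esub> S) \<le> ?k * nrm (Ops V W) (T \<ominus>\<^bsub>Ops V W\<^esub> S)" by (rule HS_nrm_le)
      also have "... < e" using S(2) by (simp add: pos_less_divide_eq mult.commute)
      finally show "\<exists>y\<in>lspan (Ops V W) Y. nrm (HS V W) (T \<ominus>\<^bsub>HS V W\<^esub> y) < e" using S a_minus_HS by metis
    qed
  qed
  show "lspan (Ops V W) Y \<subseteq> cspan (Ops V W) Y"
  proof
    fix T assume T: "T \<in> lspan (Ops V W) Y"
    then have Tc: "T \<in> carrier (Ops V W)" using O.lspan_carrier[OF Y] by auto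
    have "T \<ominus>\<^bsub>Ops V W\<^esub> T = zero (Ops V W)" using Tc by (simp add: a_minus_def O.M.r_neg)
    moreover have "nrm (Ops V W) (zero (Ops V W)) = 0"
    proof -
      have "\<zero>\<^bsub>V\<^esub> \<in> {x \<in> carrier V. nrm V x \<le> 1}" by simp
      then have "{x \<in> carrier V. nrm V x \<le> 1} \<noteq> {}" by blast
      then show ?thesis unfolding Ops_simps by (simp cong: SUP_cong_simp)
    qed
    ultimately show "T \<in> cspan (Ops V W) Y" using T Tc unfolding cspan_def by force
  qed
qed

end

lemma (in fd_space) cspan_Lalg_eq:
  assumes "Y \<subseteq> carrier (Ops V V)" shows "cspan (Lalg V) Y = lspan (Ops V V) Y"
proof -
  interpret fd_pair V V ..
  show ?thesis using cspan_Ops[OF assms] cspan_Lalg[of V Y] by metis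
qed

text \<open>Unital *-subalgebras of the operators on a finite-dimensional Hilbert space.\<close>

locale star_subalg = K: fd_space K for K :: "('k, 'm) hilb_scheme" +
  fixes B :: "('k \<Rightarrow> 'k) set"
  assumes sub: "submodule B CC (Ops K K)"
    and mult: "\<And>S T. S \<in> B \<Longrightarrow> T \<in> B \<Longrightarrow> compose (carrier K) S T \<in> B"
    and star: "\<And>T. T \<in> B \<Longrightarrow> adj K K T \<in> B"
    and unit: "(\<lambda>x\<in>carrier K. x) \<in> B"
begin

sublocale KK: fd_pair K K ..

lemma B_closed: "b \<in> B \<Longrightarrow> b \<in> carrier (Ops K K)"
  using KK.O.submoduleD(1)[OF sub] by auto

lemma commutantD:
  assumes "t \<in> commutant K B"
  shows "t \<in> carrier (Ops K K)" "b \<in> B \<Longrightarrow> k \<in> carrier K \<Longrightarrow> t (b k) = b (t k)"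
proof -
  show "t \<in> carrier (Ops K K)" using assms by (simp add: commutant_def)
  assume b: "b \<in> B" and k: "k \<in> carrier K"
  have "compose (carrier K) t b = compose (carrier K) b t" using assms b by (simp add: commutant_def)
  then show "t (b k) = b (t k)" using k by (metis compose_eq)
qed

lemma commutantI:
  assumes "t \<in> carrier (Ops K K)" "\<And>b k. b \<in> B \<Longrightarrow> k \<in> carrier K \<Longrightarrow> t (b k) = b (t k)"
  shows "t \<in> commutant K B"
  using assms unfolding commutant_def by (auto simp: compose_def fun_eq_iff)

lemma compose_closed: "S \<in> carrier (Ops K K) \<Longrightarrow> T \<in> carrier (Ops K K) \<Longrightarrow> compose (carrier K) S T \<in> carrier (Ops K K)"
  using compose_Ops K.fd_space_axioms by blast

lemma commutant_adj:
  assumes t: "t \<in> commutant K B" shows "adj K K t \<in> commutant K B"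
proof (rule commutantI)
  note T = commutantD(1)[OF t]
  show "adj K K t \<in> carrier (Ops K K)" using KK.adj_closed[OF T] .
  fix b k assume b: "b \<in> B" and k: "k \<in> carrier K"
  note bc = B_closed[OF b] and bs = star[OF b]
  note bsc = B_closed[OF bs]
  show "adj K K t (b k) = b (adj K K t k)"
  proof (rule K.ip_eqI)
    fix z assume z: "z \<in> carrier K"
    have "ip K z (adj K K t (b k)) = ip K (t z) (b k)"
      using KK.adj_ip[OF T] z k OpsD(2)[OF bc] by simp
    also have "... = ip K (adj K K b (t z)) k"
      using KK.adj_ip2[OF bc] OpsD(2)[OF T] z k by simp
    also have "... = ip K (t (adj K K b z)) k" using commutantD(2)[OF t bs z] by simp
    also have "... = ip K (adj K K b z) (adj K K t k)" using KK.adj_ip[OF T] z k OpsD(2)[OF bsc] by simp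
    also have "... = ip K z (b (adj K K t k))"
      using KK.adj_ip2[OF bc] z k OpsD(2)[OF KK.adj_closed[OF T]] by simp
    finally show "ip K z (adj K K t (b k)) = ip K z (b (adj K K t k))" .
  qed (use k OpsD(2)[OF bc] OpsD(2)[OF KK.adj_closed[OF T]] in auto)
qed

text \<open>
  Let \<open>P\<close> be the Hilbert--Schmidt projection onto \<open>B\<close>. It commutes with left multiplication by \<open>B\<close>;
  hence each \<open>k \<mapsto> P(|k\<rangle>\<langle>e|) x\<close> is in \<open>B'\<close> and commutes with \<open>T\<close>, and so \<open>P(T X) = T P(X)\<close> for all \<open>X\<close>.
  For \<open>X = 1\<close> this gives \<open>P T = T\<close>.
\<close>

theorem bicommutant:
  assumes T: "T \<in> carrier (Ops K K)" and c: "\<And>t k. t \<in> commutant K B \<Longrightarrow> k \<in> carrier K \<Longrightarrow> T (t k) = t (T k)"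
  shows "T \<in> B"
proof -
  have subH: "submodule B CC (HS K K)" using sub submodule_HS by blast
  obtain E where E: "KK.HS.orthonormal E" "E \<subseteq> B" "\<forall>x\<in>B. KK.HS.proj E x = x" using KK.HS.submodule_onb[OF subH] by auto
  let ?P = "KK.HS.proj E"
  note Bc = KK.HS.submoduleD(1)[OF subH]
  have Pc: "?P X \<in> carrier (Ops K K)" if "X \<in> carrier (Ops K K)" for X
    using KK.HS.proj_closed[OF E(1), of X] that by simp
  have PB: "?P X \<in> B" if "X \<in> carrier (Ops K K)" for X
    using KK.HS.proj_in_submodule[OF E(1) subH E(2), of X] that by simp
  have Pb: "?P (compose (carrier K) b X) = compose (carrier K) b (?P X)" if b: "b \<in> B" and X: "X \<in> carrier (Ops K K)" for b X
  proof (rule KK.HS.proj_eqI[OF E subH])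
    note bc = B_closed[OF b]
    show "compose (carrier K) b X \<in> carrier (HS K K)" using compose_closed[OF bc X] by simp
    show "compose (carrier K) b (?P X) \<in> B" using mult[OF b PB[OF X]] .
    fix m assume m: "m \<in> B"
    let ?m = "compose (carrier K) (adj K K b) m"
    have mB: "?m \<in> B" using mult[OF star[OF b] m] .
    note mc = B_closed[OF m]
    have d: "X \<ominus>\<^bsub>Ops K K\<^esub> ?P X \<in> carrier (Ops K K)" using X Pc by simp
    have "ip (HS K K) m (compose (carrier K) b X \<ominus>\<^bsub>HS K K\<^esub> compose (carrier K) b (?P X))
       = (\<Sum>e\<in>K.basis. ip K (m e) (b (X e) \<ominus>\<^bsub>K\<^esub> b (?P X e)))"
      unfolding HS_simps a_minus_HS
      by (rule sum.cong) (simp_all add: KK.Ops_diff_apply compose_closed bc X Pc compose_eq)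
    also have "... = (\<Sum>e\<in>K.basis. ip K (?m e) (X e \<ominus>\<^bsub>K\<^esub> ?P X e))"
    proof (rule sum.cong[OF refl])
      fix e assume "e \<in> K.basis"
      then have ec: "e \<in> carrier K" by simp
      note cs = OpsD(2)[OF mc ec] OpsD(2)[OF X ec] OpsD(2)[OF Pc[OF X] ec]
      note cb = OpsD(2)[OF bc cs(2)] OpsD(2)[OF bc cs(3)] OpsD(2)[OF KK.adj_closed[OF bc] cs(1)]
      show "ip K (m e) (b (X e) \<ominus>\<^bsub>K\<^esub> b (?P X e)) = ip K (?m e) (X e \<ominus>\<^bsub>K\<^esub> ?P X e)"
        using cs cb ec by (simp add: compose_eq K.ip_diff_right KK.adj_ip2[OF bc])
    qed
    also have "... = ip (HS K K) ?m (X \<ominus>\<^bsub>HS K K\<^esub> ?P X)"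
      unfolding HS_simps a_minus_HS by (rule sum.cong) (simp_all add: KK.Ops_diff_apply X Pc)
    also have "... = 0"
      using KK.HS.proj_orth[OF E(1,3) Bc _ mB] X by simp
    finally show "ip (HS K K) m (compose (carrier K) b X \<ominus>\<^bsub>HS K K\<^esub> compose (carrier K) b (?P X)) = 0" .
  qed
  \<comment> \<open>\<open>P (T X) = T P X\<close> is linear in \<open>X\<close>, so it is enough to verify it for \<open>X\<close> of rank one.\<close>
  let ?M = "{X \<in> carrier (Ops K K). ?P (compose (carrier K) T X) = compose (carrier K) T (?P X)}"
  have "submodule ?M CC (Ops K K)"
  proof (rule KK.O.submoduleI')
    note cc = compose_closed[OF T]
    have z: "?P (zero (Ops K K)) = zero (Ops K K)"
      using E(3) KK.O.submoduleD(2)[OF sub] by blast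
    have z2: "compose (carrier K) T (zero (Ops K K)) = zero (Ops K K)"
      by (rule Ops_eqI[OF cc]) (use KK.Ops_zero_closed KK.Ops_zero[OF T] in \<open>auto simp: compose_eq\<close>)
    show "zero (Ops K K) \<in> ?M" using z z2 KK.Ops_zero_closed by simp
  next
    fix X Y assume "X \<in> ?M" "Y \<in> ?M"
    then have X: "X \<in> carrier (Ops K K)" "?P (compose (carrier K) T X) = compose (carrier K) T (?P X)"
      and Y: "Y \<in> carrier (Ops K K)" "?P (compose (carrier K) T Y) = compose (carrier K) T (?P Y)" by auto
    have ad: "compose (carrier K) T (S \<oplus>\<^bsub>Ops K K\<^esub> R) = compose (carrier K) T S \<oplus>\<^bsub>Ops K K\<^esub> compose (carrier K) T R"
      if "S \<in> carrier (Ops K K)" "R \<in> carrier (Ops K K)" for S R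
      by (rule Ops_eqI) (use that T KK.Ops_add_closed compose_closed OpsD(2)[OF that(1)] OpsD(2)[OF that(2)] OpsD(3)[OF T] in \<open>auto simp: compose_eq\<close>)
    have pa: "?P (S \<oplus>\<^bsub>Ops K K\<^esub> R) = ?P S \<oplus>\<^bsub>Ops K K\<^esub> ?P R"
      if "S \<in> carrier (Ops K K)" "R \<in> carrier (Ops K K)" for S R
      using KK.HS.proj_add[OF E(1), of S R] that by simp
    show "X \<oplus>\<^bsub>Ops K K\<^esub> Y \<in> ?M" using X Y by (simp add: ad pa Pc compose_closed T)
  next
    fix a X assume "X \<in> ?M"
    then have X: "X \<in> carrier (Ops K K)" "?P (compose (carrier K) T X) = compose (carrier K) T (?P X)" by auto
    have ad: "compose (carrier K) T (a \<odot>\<^bsub>Ops K K\<^esub> S) = a \<odot>\<^bsub>Ops K K\<^esub> compose (carrier K) T S"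
      if "S \<in> carrier (Ops K K)" for S
      by (rule Ops_eqI) (use that T KK.Ops_smult_closed compose_closed OpsD(2)[OF that] OpsD(4)[OF T] in \<open>auto simp: compose_eq\<close>)
    have pa: "?P (a \<odot>\<^bsub>Ops K K\<^esub> S) = a \<odot>\<^bsub>Ops K K\<^esub> ?P S"
      if "S \<in> carrier (Ops K K)" for S
      using KK.HS.proj_smult[OF E(1), of S a] that by simp
    show "a \<odot>\<^bsub>Ops K K\<^esub> X \<in> ?M" using X KK.Ops_smult_closed by (simp add: ad pa Pc compose_closed T)
  qed auto
  moreover have "KK.rank1 f e \<in> ?M" if f: "f \<in> K.basis" and e: "e \<in> K.basis" for f e
  proof -
    have fc: "f \<in> carrier K" and ec: "e \<in> carrier K" using f e by auto
    note rc = KK.rank1_closed[OF _ ec]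
    have cr: "compose (carrier K) S (KK.rank1 k e) = KK.rank1 (S k) e" if "S \<in> carrier (Ops K K)" "k \<in> carrier K" for S k
      by (rule Ops_eqI) (use that rc compose_closed ec OpsD(2)[OF that(1)] OpsD(4)[OF that(1)] in \<open>auto simp: compose_eq\<close>)
    have tl: "(\<lambda>k\<in>carrier K. ?P (KK.rank1 k e) x) \<in> commutant K B" if x: "x \<in> carrier K" for x
    proof (rule commutantI)
      show "(\<lambda>k\<in>carrier K. ?P (KK.rank1 k e) x) \<in> carrier (Ops K K)"
      proof (rule KK.restrict_OpsI)
        fix k assume "k \<in> carrier K"
        then show "?P (KK.rank1 k e) x \<in> carrier K" using OpsD(2)[OF Pc[OF rc] x] by blast
      next
        fix k l assume k: "k \<in> carrier K" and l: "l \<in> carrier K"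
        have "KK.rank1 (k \<oplus>\<^bsub>K\<^esub> l) e = KK.rank1 k e \<oplus>\<^bsub>Ops K K\<^esub> KK.rank1 l e"
          by (rule Ops_eqI) (use k l ec rc KK.Ops_add_closed K.smult_r_distr in auto)
        then have "?P (KK.rank1 (k \<oplus>\<^bsub>K\<^esub> l) e) = ?P (KK.rank1 k e) \<oplus>\<^bsub>Ops K K\<^esub> ?P (KK.rank1 l e)"
          using KK.HS.proj_add[OF E(1), of "KK.rank1 k e" "KK.rank1 l e"] rc k l by simp
        then show "?P (KK.rank1 (k \<oplus>\<^bsub>K\<^esub> l) e) x = ?P (KK.rank1 k e) x \<oplus>\<^bsub>K\<^esub> ?P (KK.rank1 l e) x" using x by simp
      next
        fix a k assume k: "k \<in> carrier K"
        have "KK.rank1 (a \<odot>\<^bsub>K\<^esub> k) e = a \<odot>\<^bsub>Ops K K\<^esub> KK.rank1 k e"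
          by (rule Ops_eqI) (use k ec rc KK.Ops_smult_closed in \<open>auto simp: mult.commute simp flip: K.smult_assoc1[simplified]\<close>)
        then have "?P (KK.rank1 (a \<odot>\<^bsub>K\<^esub> k) e) = a \<odot>\<^bsub>Ops K K\<^esub> ?P (KK.rank1 k e)"
          using KK.HS.proj_smult[OF E(1), of "KK.rank1 k e" a] rc k by simp
        then show "?P (KK.rank1 (a \<odot>\<^bsub>K\<^esub> k) e) x = a \<odot>\<^bsub>K\<^esub> ?P (KK.rank1 k e) x" using x by simp
      qed
      fix b k assume b: "b \<in> B" and k: "k \<in> carrier K"
      have "?P (KK.rank1 (b k) e) = compose (carrier K) b (?P (KK.rank1 k e))"
        using cr[OF B_closed[OF b] k] Pb[OF b rc[OF k]] by simp
      then show "(\<lambda>k\<in>carrier K. ?P (KK.rank1 k e) x) (b k) = b ((\<lambda>k\<in>carrier K. ?P (KK.rank1 k e) x) k)"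
        using x k OpsD(2)[OF B_closed[OF b] k] by (simp add: compose_eq)
    qed
    have "?P (compose (carrier K) T (KK.rank1 f e)) = compose (carrier K) T (?P (KK.rank1 f e))"
    proof (rule Ops_eqI)
      show "?P (compose (carrier K) T (KK.rank1 f e)) \<in> carrier (Ops K K)"
        "compose (carrier K) T (?P (KK.rank1 f e)) \<in> carrier (Ops K K)"
        using Pc compose_closed T rc fc by auto
      fix x assume x: "x \<in> carrier K"
      have "T (?P (KK.rank1 f e) x) = ?P (KK.rank1 (T f) e) x"
        using c[OF tl[OF x] fc] fc OpsD(2)[OF T fc] by simp
      then show "?P (compose (carrier K) T (KK.rank1 f e)) x = compose (carrier K) T (?P (KK.rank1 f e)) x"
        using x cr[OF T fc] by (simp add: compose_eq)
    qed
    then show ?thesis using rc fc by simp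
  qed
  ultimately have all: "X \<in> ?M" if "X \<in> carrier (Ops K K)" for X using KK.rank1_span that by blast
  let ?I = "\<lambda>x\<in>carrier K. x"
  have I: "?I \<in> ?M" using all B_closed[OF unit] by blast
  have "compose (carrier K) T ?I = T"
    using OpsD(2,5)[OF T] by (intro extensionalityI[of _ "carrier K"]) (auto simp: compose_def)
  moreover have "?P ?I = ?I" using E(3) unit by blast
  ultimately have "?P T = T" using I by simp
  then show ?thesis using PB[OF T] by simp
qed

end

section \<open>Spans of kets as spaces of intertwiners\<close>

text \<open>
  The common abstract form of the two kinds of kets: a family \<open>L\<close> of operators from \<open>K\<close> to \<open>W\<close> with
  \<open>L*L \<subseteq> B\<close> whose ranges span \<open>W\<close>, together with operators \<open>\<tau> t\<close> on \<open>W\<close> for \<open>t \<in> B'\<close> such that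
  \<open>\<tau>(t) l = l t\<close>. For the kets \<open>|a\<rangle>\<^sub>[\<^sub>1\<^sub>]\<close> the operator \<open>\<tau> t\<close> is \<open>1 \<otimes> t\<close>.
\<close>

locale ket_system = star_subalg K B + W: fd_space W
  for K :: "('k, 'm) hilb_scheme" and B and W :: "('w, 'n) hilb_scheme" +
  fixes L :: "('k \<Rightarrow> 'w) set" and \<tau> :: "('k \<Rightarrow> 'k) \<Rightarrow> 'w \<Rightarrow> 'w"
  assumes L_closed: "l \<in> L \<Longrightarrow> l \<in> carrier (Ops K W)"
    and LL: "l \<in> L \<Longrightarrow> l' \<in> L \<Longrightarrow> compose (carrier K) (adj K W l) l' \<in> B"
    and L_total: "w \<in> carrier W \<Longrightarrow> (\<And>l k. l \<in> L \<Longrightarrow> k \<in> carrier K \<Longrightarrow> ip W (l k) w = 0) \<Longrightarrow> w = \<zero>\<^bsub>W\<^esub>"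
    and \<tau>_closed: "t \<in> commutant K B \<Longrightarrow> \<tau> t \<in> carrier (Ops W W)"
    and \<tau>_ket: "t \<in> commutant K B \<Longrightarrow> l \<in> L \<Longrightarrow> k \<in> carrier K \<Longrightarrow> \<tau> t (l k) = l (t k)"
begin

sublocale KW: fd_pair K W ..
sublocale WW: fd_pair W W ..

lemma ket_closed: "l \<in> L \<Longrightarrow> k \<in> carrier K \<Longrightarrow> l k \<in> carrier W"
  using OpsD(2)[OF L_closed] by blast

lemma ket_span:
  assumes "submodule M CC W" "\<And>l k. l \<in> L \<Longrightarrow> k \<in> carrier K \<Longrightarrow> l k \<in> M" "w \<in> carrier W"
  shows "w \<in> M"
proof -
  have "M = carrier W"
    by (rule W.submodule_total[OF assms(1)]) (use assms(2) L_total in blast)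
  then show ?thesis using assms(3) by simp
qed

lemma adj_ket_closed: "l \<in> L \<Longrightarrow> w \<in> carrier W \<Longrightarrow> adj K W l w \<in> carrier K"
  using OpsD(2)[OF KW.adj_closed[OF L_closed]] by blast

lemma adj_ket_\<tau>:
  assumes l: "l \<in> L" and t: "t \<in> commutant K B" and w: "w \<in> carrier W"
  shows "adj K W l (\<tau> t w) = t (adj K W l w)"
proof -
  note T = commutantD(1)[OF t] and A = KW.adj_closed[OF L_closed[OF l]] and S = \<tau>_closed[OF t]
  interpret WK: fd_pair W K ..
  have "w \<in> {w \<in> carrier W. adj K W l (\<tau> t w) = t (adj K W l w)}"
  proof (rule ket_span[OF _ _ w])
    show "submodule {w \<in> carrier W. adj K W l (\<tau> t w) = t (adj K W l w)} CC W"
      by (rule W.submoduleI')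
        (auto simp: WW.Ops_zero[OF S] WK.Ops_zero[OF A] KK.Ops_zero[OF T]
          OpsD(2-4)[OF S] OpsD(2-4)[OF A] OpsD(2-4)[OF T])
    fix l' k assume l': "l' \<in> L" and k: "k \<in> carrier K"
    have tk: "t k \<in> carrier K" using OpsD(2)[OF T k] .
    have "adj K W l (l' (t k)) = compose (carrier K) (adj K W l) l' (t k)" using tk by (simp add: compose_eq)
    also have "... = t (compose (carrier K) (adj K W l) l' k)"
      using commutantD(2)[OF t LL[OF l l'] k] by simp
    finally show "l' k \<in> {w \<in> carrier W. adj K W l (\<tau> t w) = t (adj K W l w)}"
      using k ket_closed[OF l' k] \<tau>_ket[OF t l' k] by (simp add: compose_eq)
  qed
  then show ?thesis by simp
qed

lemma adj_\<tau>_ket: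
  assumes l: "l \<in> L" and t: "t \<in> commutant K B" and k: "k \<in> carrier K"
  shows "adj W W (\<tau> t) (l k) = l (adj K K t k)"
proof (rule W.ip_eqI)
  note T = commutantD(1)[OF t] and S = \<tau>_closed[OF t] and lc = L_closed[OF l]
  have tk: "adj K K t k \<in> carrier K" using OpsD(2)[OF KK.adj_closed[OF T] k] .
  show "adj W W (\<tau> t) (l k) \<in> carrier W" "l (adj K K t k) \<in> carrier W"
    using ket_closed l k tk OpsD(2)[OF WW.adj_closed[OF S]] by auto
  fix w assume w: "w \<in> carrier W"
  have lw: "adj K W l w \<in> carrier K" using adj_ket_closed[OF l w] .
  have "ip W w (adj W W (\<tau> t) (l k)) = ip W (\<tau> t w) (l k)"
    using WW.adj_ip[OF S w] ket_closed[OF l k] by simp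
  also have "... = ip K (t (adj K W l w)) k"
    using KW.adj_ip2[OF lc k] OpsD(2)[OF S w] adj_ket_\<tau>[OF l t w] by simp
  also have "... = ip K (adj K W l w) (adj K K t k)" using KK.adj_ip[OF T lw k] .
  also have "... = ip W w (l (adj K K t k))" using KW.adj_ip2[OF lc tk w] by simp
  finally show "ip W w (adj W W (\<tau> t) (l k)) = ip W w (l (adj K K t k))" .
qed

lemma Ops_eq_on_kets:
  assumes S: "S \<in> carrier (Ops W W)" and T: "T \<in> carrier (Ops W W)"
    and e: "\<And>l k. l \<in> L \<Longrightarrow> k \<in> carrier K \<Longrightarrow> S (l k) = T (l k)" and w: "w \<in> carrier W"
  shows "S w = T w"
proof -
  have "w \<in> {w \<in> carrier W. S w = T w}"
  proof (rule ket_span[OF _ _ w])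
    show "submodule {w \<in> carrier W. S w = T w} CC W"
      by (rule W.submoduleI')
        (auto simp: WW.Ops_zero[OF S] WW.Ops_zero[OF T] OpsD(2-4)[OF S] OpsD(2-4)[OF T])
  qed (use e ket_closed in auto)
  then show ?thesis by simp
qed

lemma adj_\<tau>:
  assumes t: "t \<in> commutant K B" and w: "w \<in> carrier W"
  shows "adj W W (\<tau> t) w = \<tau> (adj K K t) w"
  by (rule Ops_eq_on_kets[OF WW.adj_closed[OF \<tau>_closed[OF t]] \<tau>_closed[OF commutant_adj[OF t]] _ w])
     (simp add: adj_\<tau>_ket[OF _ t] \<tau>_ket[OF commutant_adj[OF t]])

text \<open>The space \<open>[L B]\<close>.\<close>

abbreviation "X1 \<equiv> lspan (Ops K W) {compose (carrier K) l b |l b. l \<in> L \<and> b \<in> B}"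

lemma gens_closed: "{compose (carrier K) l b |l b. l \<in> L \<and> b \<in> B} \<subseteq> carrier (Ops K W)"
  using compose_Ops[OF K.fd_space_axioms K.fd_space_axioms W.fd_space_axioms B_closed L_closed] by auto

lemma X1_sub: "submodule X1 CC (Ops K W)"
  using KW.O.lspan_submodule[OF gens_closed] .

lemma X1_intertwines:
  assumes X: "X \<in> X1" and t: "t \<in> commutant K B" and k: "k \<in> carrier K"
  shows "X (t k) = \<tau> t (X k)"
proof -
  note T = commutantD(1)[OF t] and S = \<tau>_closed[OF t]
  let ?M = "{X \<in> carrier (Ops K W). \<forall>k\<in>carrier K. X (t k) = \<tau> t (X k)}"
  have "X1 \<subseteq> ?M"
  proof (rule KW.O.lspan_least)
    show "submodule ?M CC (Ops K W)"
      by (rule KW.O.submoduleI')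
        (auto simp: WW.Ops_zero[OF S] OpsD(2-4)[OF S] OpsD(2)[OF T] OpsD(2)[where V=K and W=W]
          intro: KW.Ops_zero_closed KW.Ops_add_closed KW.Ops_smult_closed)
    show "{compose (carrier K) l b |l b. l \<in> L \<and> b \<in> B} \<subseteq> ?M"
    proof
      fix Y assume Y: "Y \<in> {compose (carrier K) l b |l b. l \<in> L \<and> b \<in> B}"
      then obtain l b where lb: "l \<in> L" "b \<in> B" "Y = compose (carrier K) l b" by auto
      have "Y (t k) = \<tau> t (Y k)" if k: "k \<in> carrier K" for k
        using lb k OpsD(2)[OF T k] OpsD(2)[OF B_closed[OF lb(2)] k] \<tau>_ket[OF t lb(1)] commutantD(2)[OF t lb(2) k]
        by (simp add: compose_eq)
      then show "Y \<in> ?M" using gens_closed Y by blast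
    qed
  qed
  then show ?thesis using X k by auto
qed

text \<open>
  Let \<open>P\<close> be the projection of \<open>X\<close> onto \<open>[L B]\<close> and \<open>Y = X - P\<close>. Then \<open>b = l*Y\<close> is in \<open>B\<close> by the
  bicommutant theorem, and \<open>Y\<close> is orthogonal to \<open>l b\<close>, which forces \<open>\<langle>b|b\<rangle> = 0\<close>. So \<open>l*Y = 0\<close> for
  all \<open>l\<close>, and \<open>Y = 0\<close>.
\<close>

lemma X1I:
  assumes X: "X \<in> carrier (Ops K W)" and c: "\<And>t k. t \<in> commutant K B \<Longrightarrow> k \<in> carrier K \<Longrightarrow> X (t k) = \<tau> t (X k)"
  shows "X \<in> X1"
proof -
  interpret WK: fd_pair W K ..
  have subH: "submodule X1 CC (HS K W)" using X1_sub submodule_HS by blast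
  obtain E where E: "KW.HS.orthonormal E" "E \<subseteq> X1" "\<forall>x\<in>X1. KW.HS.proj E x = x"
    using KW.HS.submodule_onb[OF subH] by auto
  let ?P = "KW.HS.proj E X"
  have P: "?P \<in> X1" using KW.HS.proj_in_submodule[OF E(1) subH E(2), of X] X by simp
  have Pc: "?P \<in> carrier (Ops K W)" using P KW.O.submoduleD(1)[OF X1_sub] by auto
  let ?Y = "X \<ominus>\<^bsub>Ops K W\<^esub> ?P"
  have Yc: "?Y \<in> carrier (Ops K W)" using X Pc by simp
  have cc: "compose (carrier K) (adj K W l) Z \<in> carrier (Ops K K)" if "l \<in> L" "Z \<in> carrier (Ops K W)" for l Z
    using compose_Ops[OF K.fd_space_axioms W.fd_space_axioms K.fd_space_axioms that(2) KW.adj_closed[OF L_closed[OF that(1)]]] .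
  have bX: "compose (carrier K) (adj K W l) X \<in> B" if l: "l \<in> L" for l
  proof (rule bicommutant[OF cc[OF l X]])
    fix t k assume t: "t \<in> commutant K B" and k: "k \<in> carrier K"
    show "compose (carrier K) (adj K W l) X (t k) = t (compose (carrier K) (adj K W l) X k)"
      using k OpsD(2)[OF commutantD(1)[OF t] k] c[OF t k] adj_ket_\<tau>[OF l t OpsD(2)[OF X k]]
      by (simp add: compose_eq)
  qed
  have bP: "compose (carrier K) (adj K W l) ?P \<in> B" if l: "l \<in> L" for l
  proof -
    note A = KW.adj_closed[OF L_closed[OF l]]
    let ?M = "{Z \<in> carrier (Ops K W). compose (carrier K) (adj K W l) Z \<in> B}"
    have "X1 \<subseteq> ?M"
    proof (rule KW.O.lspan_least)
      show "submodule ?M CC (Ops K W)"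
      proof (rule KW.O.submoduleI')
        have "compose (carrier K) (adj K W l) (zero (Ops K W)) = zero (Ops K K)"
          by (rule Ops_eqI[OF cc[OF l KW.Ops_zero_closed] KK.Ops_zero_closed]) (simp add: compose_eq WK.Ops_zero[OF A])
        then show "zero (Ops K W) \<in> ?M" using KK.O.submoduleD(2)[OF sub] KW.Ops_zero_closed by simp
      next
        fix Z Z' assume "Z \<in> ?M" "Z' \<in> ?M"
        then have Z: "Z \<in> carrier (Ops K W)" "compose (carrier K) (adj K W l) Z \<in> B"
          and Z': "Z' \<in> carrier (Ops K W)" "compose (carrier K) (adj K W l) Z' \<in> B" by auto
        have "compose (carrier K) (adj K W l) (Z \<oplus>\<^bsub>Ops K W\<^esub> Z') = compose (carrier K) (adj K W l) Z \<oplus>\<^bsub>Ops K K\<^esub> compose (carrier K) (adj K W l) Z'"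
          by (rule Ops_eqI[OF cc[OF l KW.Ops_add_closed[OF Z(1) Z'(1)]] KK.Ops_add_closed[OF cc[OF l Z(1)] cc[OF l Z'(1)]]])
             (simp add: compose_eq OpsD(3)[OF A] OpsD(2)[OF Z(1)] OpsD(2)[OF Z'(1)])
        then show "Z \<oplus>\<^bsub>Ops K W\<^esub> Z' \<in> ?M" using KW.Ops_add_closed[OF Z(1) Z'(1)] KK.O.submoduleD(3)[OF sub Z(2) Z'(2)] by simp
      next
        fix a Z assume "Z \<in> ?M"
        then have Z: "Z \<in> carrier (Ops K W)" "compose (carrier K) (adj K W l) Z \<in> B" by auto
        have "compose (carrier K) (adj K W l) (a \<odot>\<^bsub>Ops K W\<^esub> Z) = a \<odot>\<^bsub>Ops K K\<^esub> compose (carrier K) (adj K W l) Z"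
          by (rule Ops_eqI[OF cc[OF l KW.Ops_smult_closed[OF Z(1)]] KK.Ops_smult_closed[OF cc[OF l Z(1)]]])
             (simp add: compose_eq OpsD(4)[OF A] OpsD(2)[OF Z(1)])
        then show "a \<odot>\<^bsub>Ops K W\<^esub> Z \<in> ?M" using KW.Ops_smult_closed[OF Z(1)] KK.O.submoduleD(4)[OF sub Z(2)] by simp
      qed auto
      show "{compose (carrier K) l b |l b. l \<in> L \<and> b \<in> B} \<subseteq> ?M"
      proof
        fix Z assume Z: "Z \<in> {compose (carrier K) l b |l b. l \<in> L \<and> b \<in> B}"
        then obtain l' b where lb: "l' \<in> L" "b \<in> B" "Z = compose (carrier K) l' b" by auto
        have "compose (carrier K) (adj K W l) Z = compose (carrier K) (compose (carrier K) (adj K W l) l') b"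
          unfolding lb(3) using OpsD(2)[OF B_closed[OF lb(2)]] by (auto simp: compose_def fun_eq_iff)
        then have "compose (carrier K) (adj K W l) Z \<in> B" using mult[OF LL[OF l lb(1)] lb(2)] by simp
        then show "Z \<in> ?M" using gens_closed Z by blast
      qed
    qed
    then show ?thesis using P by auto
  qed
  have Y0: "adj K W l (?Y k) = \<zero>\<^bsub>K\<^esub>" if l: "l \<in> L" and k: "k \<in> carrier K" for l k
  proof -
    note A = KW.adj_closed[OF L_closed[OF l]] and lc = L_closed[OF l]
    define b where "b = compose (carrier K) (adj K W l) X \<ominus>\<^bsub>Ops K K\<^esub> compose (carrier K) (adj K W l) ?P"
    have bB: "b \<in> B" unfolding b_def using KK.O.submodule_diff[OF sub bX[OF l] bP[OF l]] .
    note bc = B_closed[OF bB]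
    have b: "b x = adj K W l (?Y x)" if x: "x \<in> carrier K" for x
    proof -
      have cs: "X x \<in> carrier W" "?P x \<in> carrier W" "?Y x \<in> carrier W" using OpsD(2)[OF X x] OpsD(2)[OF Pc x] OpsD(2)[OF Yc x] by simp_all
      have "b x = adj K W l (X x) \<ominus>\<^bsub>K\<^esub> adj K W l (?P x)"
        unfolding b_def using KK.Ops_diff_apply[OF cc[OF l X] cc[OF l Pc] x] x by (simp add: compose_eq)
      moreover have "adj K W l (X x) = adj K W l (?Y x) \<oplus>\<^bsub>K\<^esub> adj K W l (?P x)"
      proof -
        have "X x = ?Y x \<oplus>\<^bsub>W\<^esub> ?P x" using KW.Ops_diff_apply[OF X Pc x] cs
          by (simp add: a_minus_def W.M.add.m_assoc W.M.l_neg)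
        then show ?thesis using OpsD(3)[OF A cs(3) cs(2)] by simp
      qed
      ultimately show ?thesis using OpsD(2)[OF A cs(2)] OpsD(2)[OF A cs(3)]
        by (simp add: a_minus_def K.M.add.m_assoc K.M.r_neg)
    qed
    have lb: "compose (carrier K) l b \<in> X1" by (rule subsetD[OF KW.O.lspan_base]) (use l bB in auto)
    have "ip (HS K K) b b = (\<Sum>e\<in>K.basis. ip K (b e) (adj K W l (?Y e)))"
      by (simp add: b)
    also have "... = (\<Sum>e\<in>K.basis. ip W (l (b e)) (?Y e))"
      using OpsD(2)[OF bc] OpsD(2)[OF Yc] by (intro sum.cong refl) (simp add: KW.adj_ip[OF lc])
    also have "... = ip (HS K W) (compose (carrier K) l b) ?Y"
      unfolding HS_simps by (intro sum.cong refl) (simp add: compose_eq)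
    also have "... = 0"
      using KW.HS.proj_orth[OF E(1,3) KW.HS.submoduleD(1)[OF subH] _ lb, of X] X by (simp add: a_minus_HS)
    finally have "b = zero (Ops K K)" using KK.HS.ip_self_zero[of b] bc by simp
    then show ?thesis using b[OF k] k by simp
  qed
  have "X = ?P"
  proof (rule Ops_eqI[OF X Pc])
    fix k assume k: "k \<in> carrier K"
    have cs: "X k \<in> carrier W" "?P k \<in> carrier W" "?Y k \<in> carrier W" using OpsD(2)[OF X k] OpsD(2)[OF Pc k] OpsD(2)[OF Yc k] by simp_all
    have "?Y k = \<zero>\<^bsub>W\<^esub>"
      by (rule L_total[OF cs(3)]) (simp add: KW.adj_ip[OF L_closed] cs Y0 k)
    then show "X k = ?P k" using KW.Ops_diff_apply[OF X Pc k] W.diff_zero_eq[OF cs(1,2)] by simp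
  qed
  then show ?thesis using P by simp
qed

theorem commutes_iff_ket:
  assumes T: "T \<in> carrier (Ops W W)"
  shows "(\<forall>t\<in>commutant K B. \<forall>w\<in>carrier W. T (\<tau> t w) = \<tau> t (T w)) \<longleftrightarrow>
    (\<forall>l\<in>L. compose (carrier K) T l \<in> X1 \<and> compose (carrier K) (adj W W T) l \<in> X1)"
proof
  have X1: "compose (carrier K) S l \<in> X1"
    if c: "\<forall>t\<in>commutant K B. \<forall>w\<in>carrier W. S (\<tau> t w) = \<tau> t (S w)" and l: "l \<in> L" and S: "S \<in> carrier (Ops W W)" for S l
  proof (rule X1I)
    show "compose (carrier K) S l \<in> carrier (Ops K W)"
      using compose_Ops[OF K.fd_space_axioms W.fd_space_axioms W.fd_space_axioms L_closed[OF l] S] .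
    fix t k assume t: "t \<in> commutant K B" and k: "k \<in> carrier K"
    have "S (l (t k)) = \<tau> t (S (l k))" using c t \<tau>_ket[OF t l k] ket_closed[OF l k] by metis
    then show "compose (carrier K) S l (t k) = \<tau> t (compose (carrier K) S l k)"
      using k OpsD(2)[OF commutantD(1)[OF t] k] by (simp add: compose_eq)
  qed
  assume c: "\<forall>t\<in>commutant K B. \<forall>w\<in>carrier W. T (\<tau> t w) = \<tau> t (T w)"
  have "\<forall>t\<in>commutant K B. \<forall>w\<in>carrier W. adj W W T (\<tau> t w) = \<tau> t (adj W W T w)"
  proof (intro ballI)
    fix t w assume t: "t \<in> commutant K B" and w: "w \<in> carrier W"
    note s = commutant_adj[OF t]
    note S = \<tau>_closed[OF s] and Tc = \<tau>_closed[OF t]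
    have e: "adj W W (\<tau> (adj K K t)) v = \<tau> t v" if "v \<in> carrier W" for v
      using adj_\<tau>[OF s that] KK.adj_adj[OF commutantD(1)[OF t]] by simp
    show "adj W W T (\<tau> t w) = \<tau> t (adj W W T w)"
    proof (rule W.ip_eqI)
      show "adj W W T (\<tau> t w) \<in> carrier W" "\<tau> t (adj W W T w) \<in> carrier W"
        using OpsD(2)[OF WW.adj_closed[OF T]] OpsD(2)[OF Tc] w by auto
      fix v assume v: "v \<in> carrier W"
      have "ip W v (adj W W T (\<tau> t w)) = ip W (T v) (adj W W (\<tau> (adj K K t)) w)"
        using WW.adj_ip[OF T v] OpsD(2)[OF Tc w] e[OF w] by simp
      also have "... = ip W (\<tau> (adj K K t) (T v)) w" using WW.adj_ip[OF S OpsD(2)[OF T v] w] by simp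
      also have "... = ip W (T (\<tau> (adj K K t) v)) w" using c s v by simp
      also have "... = ip W (\<tau> (adj K K t) v) (adj W W T w)" using WW.adj_ip[OF T OpsD(2)[OF S v] w] .
      also have "... = ip W v (\<tau> t (adj W W T w))"
        using WW.adj_ip[OF S v] OpsD(2)[OF WW.adj_closed[OF T] w] e by simp
      finally show "ip W v (adj W W T (\<tau> t w)) = ip W v (\<tau> t (adj W W T w))" .
    qed
  qed
  then show "\<forall>l\<in>L. compose (carrier K) T l \<in> X1 \<and> compose (carrier K) (adj W W T) l \<in> X1"
    using X1 c T WW.adj_closed[OF T] by blast
next
  assume r: "\<forall>l\<in>L. compose (carrier K) T l \<in> X1 \<and> compose (carrier K) (adj W W T) l \<in> X1"
  show "\<forall>t\<in>commutant K B. \<forall>w\<in>carrier W. T (\<tau> t w) = \<tau> t (T w)"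
  proof (intro ballI)
    fix t w assume t: "t \<in> commutant K B" and w: "w \<in> carrier W"
    note Tc = \<tau>_closed[OF t]
    have "compose (carrier W) T (\<tau> t) w = compose (carrier W) (\<tau> t) T w"
    proof (rule Ops_eq_on_kets[OF _ _ _ w])
      show "compose (carrier W) T (\<tau> t) \<in> carrier (Ops W W)" "compose (carrier W) (\<tau> t) T \<in> carrier (Ops W W)"
        using compose_Ops W.fd_space_axioms T Tc by blast+
      fix l k assume l: "l \<in> L" and k: "k \<in> carrier K"
      have "compose (carrier K) T l (t k) = \<tau> t (compose (carrier K) T l k)"
        using X1_intertwines[OF _ t k] r l by blast
      then show "compose (carrier W) T (\<tau> t) (l k) = compose (carrier W) (\<tau> t) T (l k)"
        using k ket_closed[OF l k] OpsD(2)[OF commutantD(1)[OF t] k] \<tau>_ket[OF t l k] by (simp add: compose_eq)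
    qed
    then show "T (\<tau> t w) = \<tau> t (T w)" using w by (simp add: compose_eq)
  qed
qed

end

section \<open>Linear maps prescribed on spanning families\<close>

context fd_pair begin

lemma Ops_eq_on_span:
  assumes S: "S \<in> carrier (Ops V W)" and T: "T \<in> carrier (Ops V W)"
    and Y: "Y \<subseteq> carrier V" "lspan V Y = carrier V" and e: "\<And>y. y \<in> Y \<Longrightarrow> S y = T y"
  shows "S = T"
proof (rule Ops_eqI[OF S T])
  have "submodule {w \<in> carrier V. S w = T w} CC V"
    by (rule V.submoduleI')
      (auto simp: Ops_zero[OF S] Ops_zero[OF T] OpsD(2-4)[OF S] OpsD(2-4)[OF T])
  moreover have "Y \<subseteq> {w \<in> carrier V. S w = T w}" using Y e by auto
  ultimately have "carrier V \<subseteq> {w \<in> carrier V. S w = T w}" by (rule V.lspan_least[of _ Y, unfolded Y(2)])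
  then show "\<And>x. x \<in> carrier V \<Longrightarrow> S x = T x" by auto
qed

text \<open>
  A prescription \<open>c\<^sub>i \<mapsto> g\<^sub>i\<close> on a spanning family extends to a linear map as soon as the numbers
  \<open>\<langle>d\<^sub>j|g\<^sub>i\<rangle>\<close>, for a spanning family \<open>d\<close>, have the form \<open>\<langle>v\<^sub>j|c\<^sub>i\<rangle>\<close>; the \<open>v\<^sub>j\<close> are the would-be values
  of the adjoint.
\<close>

lemma Ops_extend:
  assumes c: "c \<in> I \<rightarrow> carrier V" "lspan V (c ` I) = carrier V" and g: "g \<in> I \<rightarrow> carrier W"
    and d: "d \<in> J \<rightarrow> carrier W" "lspan W (d ` J) = carrier W" and v: "v \<in> J \<rightarrow> carrier V"
    and e: "\<And>i j. i \<in> I \<Longrightarrow> j \<in> J \<Longrightarrow> ip W (d j) (g i) = ip V (v j) (c i)"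
  shows "\<exists>F \<in> carrier (Ops V W). \<forall>i\<in>I. F (c i) = g i"
proof -
  have dt: "w = w'" if w: "w \<in> carrier W" "w' \<in> carrier W" and o: "\<And>j. j \<in> J \<Longrightarrow> ip W (d j) w = ip W (d j) w'" for w w'
  proof (rule W.ip_eqI[OF w])
    have "submodule {z \<in> carrier W. ip W z w = ip W z w'} CC W"
      by (rule W.submoduleI') (auto simp: w W.ip_add_left W.ip_smult_left)
    then have "carrier W \<subseteq> {z \<in> carrier W. ip W z w = ip W z w'}"
      using W.lspan_least[of "{z \<in> carrier W. ip W z w = ip W z w'}" "d ` J"] d o by auto
    then show "\<And>z. z \<in> carrier W \<Longrightarrow> ip W z w = ip W z w'" by auto
  qed
  have dc: "\<And>j. j \<in> J \<Longrightarrow> d j \<in> carrier W" and vc: "\<And>j. j \<in> J \<Longrightarrow> v j \<in> carrier V" using d(1) v by auto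
  let ?M = "{x \<in> carrier V. \<exists>z\<in>carrier W. \<forall>j\<in>J. ip W (d j) z = ip V (v j) x}"
  have "submodule ?M CC V"
  proof (rule V.submoduleI')
    show "\<zero>\<^bsub>V\<^esub> \<in> ?M" using dc vc by (auto intro!: bexI[of _ "\<zero>\<^bsub>W\<^esub>"])
  next
    fix x y assume "x \<in> ?M" "y \<in> ?M"
    then obtain z w where x: "x \<in> carrier V" "z \<in> carrier W" "\<forall>j\<in>J. ip W (d j) z = ip V (v j) x"
      and y: "y \<in> carrier V" "w \<in> carrier W" "\<forall>j\<in>J. ip W (d j) w = ip V (v j) y" by auto
    have "\<forall>j\<in>J. ip W (d j) (z \<oplus>\<^bsub>W\<^esub> w) = ip V (v j) (x \<oplus>\<^bsub>V\<^esub> y)"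
      using x y d(1) v by (auto simp: W.ip_add_right V.ip_add_right Pi_def)
    then show "x \<oplus>\<^bsub>V\<^esub> y \<in> ?M" using x y by (auto intro!: bexI[of _ "z \<oplus>\<^bsub>W\<^esub> w"])
  next
    fix a x assume "x \<in> ?M"
    then obtain z where x: "x \<in> carrier V" "z \<in> carrier W" "\<forall>j\<in>J. ip W (d j) z = ip V (v j) x" by auto
    have "\<forall>j\<in>J. ip W (d j) (a \<odot>\<^bsub>W\<^esub> z) = ip V (v j) (a \<odot>\<^bsub>V\<^esub> x)"
      using x d(1) v by (auto simp: W.ip_smult_right V.ip_smult_right Pi_def)
    then show "a \<odot>\<^bsub>V\<^esub> x \<in> ?M" using x by (auto intro!: bexI[of _ "a \<odot>\<^bsub>W\<^esub> z"])
  qed auto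
  moreover have "c ` I \<subseteq> ?M" using c(1) g e by (auto intro!: bexI[of _ "g _"])
  ultimately have "carrier V \<subseteq> ?M" by (rule V.lspan_least[of _ "c ` I", unfolded c(2)])
  then have "\<forall>x\<in>carrier V. \<exists>z. z \<in> carrier W \<and> (\<forall>j\<in>J. ip W (d j) z = ip V (v j) x)" by blast
  then obtain F where F: "\<And>x. x \<in> carrier V \<Longrightarrow> F x \<in> carrier W"
    "\<And>x j. x \<in> carrier V \<Longrightarrow> j \<in> J \<Longrightarrow> ip W (d j) (F x) = ip V (v j) x" by metis
  have "(\<lambda>x\<in>carrier V. F x) \<in> carrier (Ops V W)"
    by (rule restrict_OpsI; (rule dt)?)
       (simp_all add: F W.ip_add_right W.ip_smult_right V.ip_add_right V.ip_smult_right dc vc)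
  moreover have "F (c i) = g i" if i: "i \<in> I" for i
  proof (rule dt)
    have ci: "c i \<in> carrier V" using c(1) i by auto
    show "F (c i) \<in> carrier W" "g i \<in> carrier W" using F(1)[OF ci] g i by auto
    show "\<And>j. j \<in> J \<Longrightarrow> ip W (d j) (F (c i)) = ip W (d j) (g i)" using F(2)[OF ci] e[OF i] by simp
  qed
  ultimately show ?thesis using c(1) by (intro bexI[of _ "\<lambda>x\<in>carrier V. F x"]) auto
qed

lemma unitary_extend:
  assumes c: "c \<in> I \<rightarrow> carrier V" "lspan V (c ` I) = carrier V"
    and g: "g \<in> I \<rightarrow> carrier W" "lspan W (g ` I) = carrier W"
    and e: "\<And>i j. i \<in> I \<Longrightarrow> j \<in> I \<Longrightarrow> ip W (g j) (g i) = ip V (c j) (c i)"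
  shows "\<exists>F. unitary V W F \<and> (\<forall>i\<in>I. F (c i) = g i)"
proof -
  obtain F where F: "F \<in> carrier (Ops V W)" "\<forall>i\<in>I. F (c i) = g i"
    using Ops_extend[OF c g(1) g c(1) e] by blast
  note Fc = OpsD(2)[OF F(1)]
  have cc: "\<And>i. i \<in> I \<Longrightarrow> c i \<in> carrier V" using c(1) by auto
  have iso1: "ip W (F (c j)) (F y) = ip V (c j) y" if j: "j \<in> I" and y: "y \<in> carrier V" for j y
  proof -
    have "submodule {y \<in> carrier V. ip W (F (c j)) (F y) = ip V (c j) y} CC V"
      by (rule V.submoduleI')
        (use j cc Fc in \<open>auto simp: Ops_zero[OF F(1)] OpsD(3,4)[OF F(1)] W.ip_add_right W.ip_smult_right V.ip_add_right V.ip_smult_right\<close>)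
    moreover have "c ` I \<subseteq> {y \<in> carrier V. ip W (F (c j)) (F y) = ip V (c j) y}" using cc e F(2) j by auto
    ultimately have "carrier V \<subseteq> {y \<in> carrier V. ip W (F (c j)) (F y) = ip V (c j) y}"
      by (rule V.lspan_least[of _ "c ` I", unfolded c(2)])
    then show ?thesis using y by auto
  qed
  have iso: "ip W (F x) (F y) = ip V x y" if x: "x \<in> carrier V" and y: "y \<in> carrier V" for x y
  proof -
    have "submodule {x \<in> carrier V. ip W (F x) (F y) = ip V x y} CC V"
      by (rule V.submoduleI')
        (use y cc Fc in \<open>auto simp: Ops_zero[OF F(1)] OpsD(3,4)[OF F(1)] W.ip_add_left W.ip_smult_left V.ip_add_left V.ip_smult_left\<close>)
    moreover have "c ` I \<subseteq> {x \<in> carrier V. ip W (F x) (F y) = ip V x y}" using cc iso1 y by auto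
    ultimately have "carrier V \<subseteq> {x \<in> carrier V. ip W (F x) (F y) = ip V x y}"
      by (rule V.lspan_least[of _ "c ` I", unfolded c(2)])
    then show ?thesis using x by auto
  qed
  have inj: "inj_on F (carrier V)"
  proof (rule inj_onI)
    fix x y assume xy: "x \<in> carrier V" "y \<in> carrier V" "F x = F y"
    show "x = y"
    proof (rule V.ip_eqI[OF xy(1,2)])
      fix z assume z: "z \<in> carrier V"
      show "ip V z x = ip V z y" using iso[OF z xy(1)] iso[OF z xy(2)] xy(3) by simp
    qed
  qed
  have "submodule (F ` carrier V) CC W"
  proof (rule W.submoduleI')
    show "\<zero>\<^bsub>W\<^esub> \<in> F ` carrier V" using Ops_zero[OF F(1)] V.M.zero_closed by force
  next
    fix x y assume "x \<in> F ` carrier V" "y \<in> F ` carrier V"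
    then obtain x' y' where "x' \<in> carrier V" "y' \<in> carrier V" "x = F x'" "y = F y'" by auto
    then show "x \<oplus>\<^bsub>W\<^esub> y \<in> F ` carrier V" by (intro image_eqI[of _ _ "x' \<oplus>\<^bsub>V\<^esub> y'"]) (simp_all add: OpsD(3)[OF F(1)])
  next
    fix a x assume "x \<in> F ` carrier V"
    then obtain x' where "x' \<in> carrier V" "x = F x'" by auto
    then show "a \<odot>\<^bsub>W\<^esub> x \<in> F ` carrier V" by (intro image_eqI[of _ _ "a \<odot>\<^bsub>V\<^esub> x'"]) (simp_all add: OpsD(4)[OF F(1)])
  qed (use Fc in auto)
  moreover have "g ` I \<subseteq> F ` carrier V" using F(2) cc by force
  ultimately have "carrier W \<subseteq> F ` carrier V" by (rule W.lspan_least[of _ "g ` I", unfolded g(2)])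
  then have "bij_betw F (carrier V) (carrier W)" using inj Fc unfolding bij_betw_def by auto
  then show ?thesis using F iso unfolding unitary_def by blast
qed

end

text \<open>A space that is spanned by the values of a bilinear map is finite-dimensional.\<close>

lemma fin_dim_bilinear:
  assumes H: "fd_space H" and K: "fd_space K" and W: "ip_space W"
    and w: "\<And>h k. h \<in> carrier H \<Longrightarrow> k \<in> carrier K \<Longrightarrow> w h k \<in> carrier W"
    and l: "\<And>h h' k. h \<in> carrier H \<Longrightarrow> h' \<in> carrier H \<Longrightarrow> k \<in> carrier K \<Longrightarrow> w (h \<oplus>\<^bsub>H\<^esub> h') k = w h k \<oplus>\<^bsub>W\<^esub> w h' k"
      "\<And>a h k. h \<in> carrier H \<Longrightarrow> k \<in> carrier K \<Longrightarrow> w (a \<odot>\<^bsub>H\<^esub> h) k = a \<odot>\<^bsub>W\<^esub> w h k"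
    and r: "\<And>h k k'. h \<in> carrier H \<Longrightarrow> k \<in> carrier K \<Longrightarrow> k' \<in> carrier K \<Longrightarrow> w h (k \<oplus>\<^bsub>K\<^esub> k') = w h k \<oplus>\<^bsub>W\<^esub> w h k'"
      "\<And>a h k. h \<in> carrier H \<Longrightarrow> k \<in> carrier K \<Longrightarrow> w h (a \<odot>\<^bsub>K\<^esub> k) = a \<odot>\<^bsub>W\<^esub> w h k"
    and s: "lspan W {w h k |h k. h \<in> carrier H \<and> k \<in> carrier K} = carrier W"
  shows "fd_space W"
proof -
  interpret H: fd_space H by fact
  interpret K: fd_space K by fact
  interpret W: ip_space W by fact
  let ?S = "(\<lambda>(h, k). w h k) ` (H.basis \<times> K.basis)"
  have S: "?S \<subseteq> carrier W" using w by auto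
  let ?M = "lspan W ?S"
  note M = W.lspan_submodule[OF S]
  have z1: "w \<zero>\<^bsub>H\<^esub> k = \<zero>\<^bsub>W\<^esub>" if "k \<in> carrier K" for k
    using l(2)[of "\<zero>\<^bsub>H\<^esub>" k 0] w[OF _ that] that by simp
  have z2: "w h \<zero>\<^bsub>K\<^esub> = \<zero>\<^bsub>W\<^esub>" if "h \<in> carrier H" for h
    using r(2)[of h "\<zero>\<^bsub>K\<^esub>" 0] w[OF that] that by simp
  have 1: "w h k \<in> ?M" if h: "h \<in> H.basis" and k: "k \<in> carrier K" for h k
  proof -
    have "k \<in> {k \<in> carrier K. w h k \<in> ?M}"
    proof (rule K.basis_span[OF K.submoduleI'])
      show "K.basis \<subseteq> {k \<in> carrier K. w h k \<in> ?M}" using W.lspan_base[of ?S] h by auto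
    qed (use h k z2 r W.submoduleD[OF M] in auto)
    then show ?thesis by simp
  qed
  have 2: "w h k \<in> ?M" if h: "h \<in> carrier H" and k: "k \<in> carrier K" for h k
  proof -
    have "h \<in> {h \<in> carrier H. w h k \<in> ?M}"
      by (rule H.basis_span[OF H.submoduleI']) (use h k z1 l 1 W.submoduleD[OF M] in auto)
    then show ?thesis by simp
  qed
  have "carrier W \<subseteq> ?M" using W.lspan_least[OF M, of "{w h k |h k. h \<in> carrier H \<and> k \<in> carrier K}"] 2 s by auto
  then have "?M = carrier W" using W.lspan_carrier[OF S] by auto
  then have "fin_dim W" unfolding fin_dim_def using S by (intro exI[of _ ?S]) simp
  then show ?thesis by unfold_locales
qed

section \<open>Separated spaces of positive sesquilinear forms\<close>

text \<open>Scalar multiplication in the free vector space.\<close>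

abbreviation scl :: "complex \<Rightarrow> ('x \<Rightarrow>\<^sub>0 complex) \<Rightarrow> 'x \<Rightarrow>\<^sub>0 complex" where
  "scl c \<equiv> Poly_Mapping.map ((*) c)"

lemma lookup_scl [simp]: "Poly_Mapping.lookup (scl c u) x = c * Poly_Mapping.lookup u x"
  by (simp add: Poly_Mapping.map.rep_eq when_def)

lemma scl_add: "scl c (u + v) = scl c u + scl c v"
  by (rule poly_mapping_eqI) (simp add: lookup_add distrib_left)

lemma scl_scl: "scl c (scl d u) = scl (c * d) u"
  by (rule poly_mapping_eqI) simp

lemma scl_add_left: "scl (c + d) u = scl c u + scl d u"
  by (rule poly_mapping_eqI) (simp add: lookup_add distrib_right)

lemma scl_1 [simp]: "scl 1 u = u"
  by (rule poly_mapping_eqI) simp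

lemma scl_minus_1: "scl (-1) u = - u"
  by (rule poly_mapping_eqI) simp

lemma keys_scl: "Poly_Mapping.keys (scl c u) \<subseteq> Poly_Mapping.keys u"
  by (auto simp: in_keys_iff)

lemma free_space_simps [simp]:
  "carrier (free_space X) = {u. Poly_Mapping.keys u \<subseteq> X}" "zero (free_space X) = 0"
  "add (free_space X) = (+)" "smult (free_space X) = scl"
  by (simp_all add: free_space_def)

lemma sesq_superset:
  assumes "finite A" "Poly_Mapping.keys u \<subseteq> A" "finite B" "Poly_Mapping.keys v \<subseteq> B"
  shows "sesq \<phi> u v = (\<Sum>x\<in>A. \<Sum>y\<in>B. cnj (Poly_Mapping.lookup u x) * Poly_Mapping.lookup v y * \<phi> x y)"
proof -
  have "sesq \<phi> u v = (\<Sum>x\<in>Poly_Mapping.keys u. \<Sum>y\<in>B. cnj (Poly_Mapping.lookup u x) * Poly_Mapping.lookup v y * \<phi> x y)"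
    unfolding sesq_def
    by (intro sum.cong refl sum.mono_neutral_left) (use assms in \<open>auto simp: in_keys_iff\<close>)
  also have "... = (\<Sum>x\<in>A. \<Sum>y\<in>B. cnj (Poly_Mapping.lookup u x) * Poly_Mapping.lookup v y * \<phi> x y)"
    by (intro sum.mono_neutral_left) (use assms in \<open>auto simp: in_keys_iff\<close>)
  finally show ?thesis .
qed

lemma sesq_add_right: "sesq \<phi> u (v + w) = sesq \<phi> u v + sesq \<phi> u w"
proof -
  let ?A = "Poly_Mapping.keys u" and ?B = "Poly_Mapping.keys v \<union> Poly_Mapping.keys w"
  have *: "sesq \<phi> u z = (\<Sum>x\<in>?A. \<Sum>y\<in>?B. cnj (Poly_Mapping.lookup u x) * Poly_Mapping.lookup z y * \<phi> x y)"
    if "Poly_Mapping.keys z \<subseteq> ?B" for z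
    by (rule sesq_superset) (use that in auto)
  show ?thesis
    using *[of "v + w"] *[of v] *[of w] Poly_Mapping.keys_add[of v w]
    by (simp add: lookup_add algebra_simps sum.distrib)
qed

lemma sesq_scl_right: "sesq \<phi> u (scl c v) = c * sesq \<phi> u v"
  using sesq_superset[OF finite_keys order_refl finite_keys keys_scl[of c v], of \<phi> u]
  by (simp add: sesq_def[of \<phi> u v] sum_distrib_left algebra_simps)

lemma sesq_single [simp]: "sesq \<phi> (Poly_Mapping.single x 1) (Poly_Mapping.single y 1) = \<phi> x y"
  by (simp add: sesq_def)

text \<open>A kernel on \<open>X\<close> whose sesquilinear extension to the free vector space is positive.\<close>

locale pos_form =
  fixes X :: "'x set" and \<phi> :: "'x \<Rightarrow> 'x \<Rightarrow> complex"
  assumes herm: "x \<in> X \<Longrightarrow> y \<in> X \<Longrightarrow> \<phi> y x = cnj (\<phi> x y)"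
    and psd: "Poly_Mapping.keys u \<subseteq> X \<Longrightarrow> Re (sesq \<phi> u u) \<ge> 0"
begin

abbreviation "free \<equiv> {u :: 'x \<Rightarrow>\<^sub>0 complex. Poly_Mapping.keys u \<subseteq> X}"

abbreviation "S \<equiv> sep_space X \<phi>"

abbreviation "cls u \<equiv> null_space X \<phi> +>\<^bsub>free_space X\<^esub> u"

lemma free_add: "u \<in> free \<Longrightarrow> v \<in> free \<Longrightarrow> u + v \<in> free"
  using Poly_Mapping.keys_add[of u v] by auto

lemma free_scl: "u \<in> free \<Longrightarrow> scl c u \<in> free"
  using keys_scl[of c u] by auto

lemma free_minus: "u \<in> free \<Longrightarrow> - u \<in> free"
  using free_scl[of u "-1"] by (simp add: scl_minus_1)

lemma sesq_herm:
  assumes "u \<in> free" "v \<in> free" shows "sesq \<phi> v u = cnj (sesq \<phi> u v)"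
proof -
  have "cnj (sesq \<phi> u v) = (\<Sum>x\<in>Poly_Mapping.keys u. \<Sum>y\<in>Poly_Mapping.keys v. Poly_Mapping.lookup u x * cnj (Poly_Mapping.lookup v y) * cnj (\<phi> x y))"
    by (simp add: sesq_def)
  also have "... = (\<Sum>y\<in>Poly_Mapping.keys v. \<Sum>x\<in>Poly_Mapping.keys u. Poly_Mapping.lookup u x * cnj (Poly_Mapping.lookup v y) * cnj (\<phi> x y))"
    by (rule sum.swap)
  also have "... = sesq \<phi> v u"
    unfolding sesq_def
    by (intro sum.cong refl) (use assms in \<open>auto simp: herm[symmetric] subset_iff simp del: in_keys_iff\<close>)
  finally show ?thesis ..
qed

lemma sesq_add_left: "u \<in> free \<Longrightarrow> v \<in> free \<Longrightarrow> w \<in> free \<Longrightarrow> sesq \<phi> (u + v) w = sesq \<phi> u w + sesq \<phi> v w"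
  using sesq_herm[of w "u + v"] sesq_herm[of w u] sesq_herm[of w v] free_add sesq_add_right[of \<phi> w u v] by simp

lemma sesq_scl_left: "u \<in> free \<Longrightarrow> w \<in> free \<Longrightarrow> sesq \<phi> (scl c u) w = cnj c * sesq \<phi> u w"
  using sesq_herm[of w "scl c u"] sesq_herm[of w u] free_scl sesq_scl_right[of \<phi> w c u] by simp

lemma null_iff: "u \<in> null_space X \<phi> \<longleftrightarrow> u \<in> free \<and> (\<forall>v\<in>free. sesq \<phi> u v = 0)"
  by (simp add: null_space_def)

text \<open>The Cauchy--Schwarz inequality for a vector of length zero.\<close>

lemma null_isotropic:
  assumes u: "u \<in> free" and z: "Re (sesq \<phi> u u) = 0" shows "u \<in> null_space X \<phi>"
proof -
  have "sesq \<phi> v u = 0" if v: "v \<in> free" for v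
  proof (rule ccontr)
    assume p0: "sesq \<phi> v u \<noteq> 0"
    define p where "p = sesq \<phi> v u"
    define a where "a = Re (sesq \<phi> v v)"
    \<comment> \<open>With this \<open>t\<close> the vector \<open>v - t cnj p u\<close> has squared length \<open>a - 2 t |p|\<^sup>2 = -1\<close>.\<close>
    define t where "t = (a + 1) / (2 * (cmod p)\<^sup>2)"
    let ?w = "v + scl (- of_real t * cnj p) u"
    have E: "sesq \<phi> ?w ?w = sesq \<phi> v v + (- of_real t * cnj p) * p + (cnj (- of_real t * cnj p)) * cnj p
       + (cnj (- of_real t * cnj p)) * (- of_real t * cnj p) * sesq \<phi> u u"
      using u v sesq_herm[OF v u] free_scl[OF u, of "- of_real t * cnj p"]
      by (simp add: free_add sesq_add_left sesq_add_right sesq_scl_left sesq_scl_right p_def algebra_simps)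
    have R: "Re ((- of_real t * cnj p) * p) = - t * (cmod p)\<^sup>2" "Re ((cnj (- of_real t * cnj p)) * cnj p) = - t * (cmod p)\<^sup>2"
    proof -
      have q: "cnj p * p = complex_of_real ((cmod p)\<^sup>2)" using complex_norm_square[of p] by (simp add: mult.commute)
      have "(- of_real t * cnj p) * p = complex_of_real (- t * (cmod p)\<^sup>2)" unfolding mult.assoc q by simp
      from arg_cong[OF this, of Re] show "Re ((- of_real t * cnj p) * p) = - t * (cmod p)\<^sup>2"
        by (simp only: Re_complex_of_real)
      have "(cnj (- of_real t * cnj p)) * cnj p = - of_real t * (cnj p * p)" by simp
      also have "... = complex_of_real (- t * (cmod p)\<^sup>2)" unfolding q by simp
      finally have "cnj (- of_real t * cnj p) * cnj p = complex_of_real (- t * (cmod p)\<^sup>2)" .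
      from arg_cong[OF this, of Re] show "Re ((cnj (- of_real t * cnj p)) * cnj p) = - t * (cmod p)\<^sup>2"
        by (simp only: Re_complex_of_real)
    qed
    have U: "sesq \<phi> u u = 0" using sesq_herm[OF u u] z by (simp add: complex_eq_iff)
    have "Re (sesq \<phi> ?w ?w) = a - 2 * t * (cmod p)\<^sup>2"
      unfolding E plus_complex.sel R U a_def by simp
    also have "... = -1"
    proof -
      have "2 * t * (cmod p)\<^sup>2 = a + 1" using p0 by (simp add: t_def p_def[symmetric] field_simps)
      then show ?thesis by linarith
    qed
    finally show False using psd[of ?w] free_add[OF v free_scl[OF u]] by auto
  qed
  then have "sesq \<phi> u v = 0" if "v \<in> free" for v using sesq_herm[OF that u] that by simp
  then show ?thesis using u null_iff by blast
qed

lemma null_add: "u \<in> null_space X \<phi> \<Longrightarrow> v \<in> null_space X \<phi> \<Longrightarrow> u + v \<in> null_space X \<phi>"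
  using free_add[of u v] by (auto simp: null_iff sesq_add_left)

lemma null_scl: "u \<in> null_space X \<phi> \<Longrightarrow> scl c u \<in> null_space X \<phi>"
  using free_scl[of u c] by (auto simp: null_iff sesq_scl_left)

lemma null_zero: "0 \<in> null_space X \<phi>"
  unfolding null_iff by (simp add: sesq_def)

lemma cls_def': "cls u = {z + u |z. z \<in> null_space X \<phi>}"
  by (auto simp: a_r_coset_def')

lemma cls_self: "u \<in> cls u" unfolding cls_def' using null_zero by force

lemma cls_eq: "v \<in> cls u \<Longrightarrow> cls v = cls u"
proof -
  assume "v \<in> cls u"
  then obtain z where z: "z \<in> null_space X \<phi>" "v = z + u" unfolding cls_def' by auto
  have z': "- z \<in> null_space X \<phi>" using null_scl[OF z(1), of "-1"] by (simp add: scl_minus_1)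
  show ?thesis
  proof
    show "cls v \<subseteq> cls u" unfolding cls_def' z(2) using null_add z(1) by (auto simp: add.assoc[symmetric])
    show "cls u \<subseteq> cls v"
    proof
      fix w assume "w \<in> cls u"
      then obtain y where y: "y \<in> null_space X \<phi>" "w = y + u" unfolding cls_def' by auto
      then have "w = (y + - z) + v" using z(2) by simp
      then show "w \<in> cls v" unfolding cls_def' using null_add[OF y(1) z'] by blast
    qed
  qed
qed

lemma cls_null: "u \<in> null_space X \<phi> \<Longrightarrow> cls u = null_space X \<phi>"
proof -
  assume u: "u \<in> null_space X \<phi>"
  have "u \<in> cls 0" unfolding cls_def' using u by auto
  then have "cls u = cls 0" by (rule cls_eq)
  then show ?thesis unfolding cls_def' by simp
qed

lemma sep_carrier: "carrier S = cls ` free"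
  by (auto simp: sep_space_def Let_def A_RCOSETS_def')

lemma sep_carrierE: assumes "P \<in> carrier S" obtains u where "u \<in> free" "P = cls u"
  using assms sep_carrier by auto

lemma sep_zero: "zero S = cls 0"
  using cls_null[OF null_zero] by (simp add: sep_space_def Let_def)

lemma sep_add: assumes "u \<in> free" "v \<in> free" shows "cls u \<oplus>\<^bsub>S\<^esub> cls v = cls (u + v)"
proof -
  have "cls u \<oplus>\<^bsub>S\<^esub> cls v = {a + b |a b. a \<in> cls u \<and> b \<in> cls v}"
    by (auto simp: sep_space_def Let_def set_add_def')
  also have "... = cls (u + v)"
  proof
    show "{a + b |a b. a \<in> cls u \<and> b \<in> cls v} \<subseteq> cls (u + v)"
    proof
      fix w assume "w \<in> {a + b |a b. a \<in> cls u \<and> b \<in> cls v}"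
      then obtain y z where "y \<in> null_space X \<phi>" "z \<in> null_space X \<phi>" "w = (y + u) + (z + v)" unfolding cls_def' by auto
      then have "w = (y + z) + (u + v)" "y + z \<in> null_space X \<phi>" using null_add by (auto simp: algebra_simps)
      then show "w \<in> cls (u + v)" unfolding cls_def' by blast
    qed
    show "cls (u + v) \<subseteq> {a + b |a b. a \<in> cls u \<and> b \<in> cls v}"
    proof
      fix w assume "w \<in> cls (u + v)"
      then obtain z where z: "z \<in> null_space X \<phi>" "w = z + (u + v)" unfolding cls_def' by auto
      then have "w = (z + u) + v" by (simp add: algebra_simps)
      moreover have "z + u \<in> cls u" "v \<in> cls v" using z cls_self unfolding cls_def'[of u] by auto
      ultimately show "w \<in> {a + b |a b. a \<in> cls u \<and> b \<in> cls v}" by blast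
    qed
  qed
  finally show ?thesis .
qed

lemma sep_smult: assumes "u \<in> free" shows "c \<odot>\<^bsub>S\<^esub> cls u = cls (scl c u)"
proof -
  have "c \<odot>\<^bsub>S\<^esub> cls u = (\<Union>v\<in>cls u. cls (scl c v))"
    by (simp add: sep_space_def Let_def)
  also have "... = (\<Union>v\<in>cls u. cls (scl c u))"
  proof (rule SUP_cong[OF refl])
    fix v assume "v \<in> cls u"
    then obtain z where "z \<in> null_space X \<phi>" "v = z + u" unfolding cls_def' by auto
    then have "scl c v \<in> cls (scl c u)" unfolding cls_def' using null_scl by (auto simp: scl_add)
    then show "cls (scl c v) = cls (scl c u)" by (rule cls_eq)
  qed
  also have "... = cls (scl c u)" using cls_self by auto
  finally show ?thesis .
qed

lemma sesq_null_left: "z \<in> null_space X \<phi> \<Longrightarrow> v \<in> free \<Longrightarrow> sesq \<phi> z v = 0"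
  by (simp add: null_iff)

lemma sep_ip: assumes u: "u \<in> free" and v: "v \<in> free" shows "ip S (cls u) (cls v) = sesq \<phi> u v"
proof -
  have "(SOME w. w \<in> cls u) \<in> cls u" "(SOME w. w \<in> cls v) \<in> cls v"
    using someI[of "\<lambda>w. w \<in> cls u", OF cls_self] someI[of "\<lambda>w. w \<in> cls v", OF cls_self] by auto
  then obtain y z where y: "y \<in> null_space X \<phi>" "(SOME w. w \<in> cls u) = y + u"
    and z: "z \<in> null_space X \<phi>" "(SOME w. w \<in> cls v) = z + v" unfolding cls_def' by auto
  have yf: "y \<in> free" and zf: "z \<in> free" using y z null_iff by auto
  have "ip S (cls u) (cls v) = sesq \<phi> (y + u) (z + v)"
    using y(2) z(2) by (simp add: sep_space_def Let_def sep_ip_def)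
  also have "... = sesq \<phi> u v + sesq \<phi> u z"
    using u v yf zf sesq_null_left[OF y(1)] free_add[OF zf v] by (simp add: sesq_add_left sesq_add_right)
  also have "sesq \<phi> u z = 0" using sesq_herm[OF zf u] sesq_null_left[OF z(1) u] by simp
  finally show ?thesis by simp
qed

lemma sep_nrm: "nrm S P = sqrt (Re (ip S P P))"
  by (simp add: sep_space_def Let_def)

lemma cvec_sep: "cvec S"
  unfolding cvec_def
proof (rule moduleI)
  show "cring CC" by (rule cring_CC)
  show "abelian_group S"
  proof (rule abelian_groupI)
    fix P assume "P \<in> carrier S"
    then obtain u where u: "u \<in> free" "P = cls u" by (rule sep_carrierE)
    have "cls (- u) \<oplus>\<^bsub>S\<^esub> P = \<zero>\<^bsub>S\<^esub>" "cls (- u) \<in> carrier S"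
      using u free_minus by (auto simp: sep_add sep_zero sep_carrier)
    then show "\<exists>Q\<in>carrier S. Q \<oplus>\<^bsub>S\<^esub> P = \<zero>\<^bsub>S\<^esub>" by blast
  qed (auto elim!: sep_carrierE simp: sep_add free_add[simplified] sep_zero sep_carrier algebra_simps; fail)+
qed (auto elim!: sep_carrierE simp: sep_add sep_smult free_add[simplified] free_scl[simplified] sep_carrier scl_add scl_add_left scl_scl)

lemma ip_space_sep: "ip_space S"
proof -
  interpret cvec S by (rule cvec_sep)
  show ?thesis
  proof (unfold_locales, goal_cases)
    case (1 x y z)
    then show ?case by (auto elim!: sep_carrierE simp: sep_add free_add[simplified] sep_ip sesq_add_right)
  next
    case (2 x y c)
    then show ?case by (auto elim!: sep_carrierE simp: sep_smult free_scl[simplified] sep_ip sesq_scl_right)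
  next
    case (3 x y)
    then show ?case by (auto elim!: sep_carrierE simp: sep_ip intro: sesq_herm)
  next
    case (4 x)
    then obtain u where u: "u \<in> free" "x = cls u" by (auto elim: sep_carrierE)
    have "u \<notin> null_space X \<phi>" using 4(2) u(2) cls_null null_zero sep_zero by auto
    then have "Re (sesq \<phi> u u) \<noteq> 0" using null_isotropic u by blast
    then show ?case using psd[of u] u by (simp add: sep_ip)
  next
    case (5 x) show ?case by (rule sep_nrm)
  qed
qed

sublocale S: ip_space S by (rule ip_space_sep)

lemma class_closed: "x \<in> X \<Longrightarrow> sep_class X \<phi> x \<in> carrier S"
  unfolding sep_class_def sep_carrier by (rule imageI) auto

lemma ip_class: "x \<in> X \<Longrightarrow> y \<in> X \<Longrightarrow> ip S (sep_class X \<phi> x) (sep_class X \<phi> y) = \<phi> x y"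
  unfolding sep_class_def by (subst sep_ip) auto

lemma class_span: "lspan S (sep_class X \<phi> ` X) = carrier S"
proof
  have c: "sep_class X \<phi> ` X \<subseteq> carrier S" using class_closed by auto
  note M = S.lspan_submodule[OF c]
  show "lspan S (sep_class X \<phi> ` X) \<subseteq> carrier S" using S.lspan_carrier[OF c] .
  have "Poly_Mapping.keys u \<subseteq> X \<longrightarrow> cls u \<in> lspan S (sep_class X \<phi> ` X)" for u
  proof (induction u rule: update_induct)
    case const
    show ?case using S.submoduleD(2)[OF M] sep_zero by simp
  next
    case (update u a b)
    show ?case
    proof
      assume k: "Poly_Mapping.keys (Poly_Mapping.update a b u) \<subseteq> X"
      have kk: "Poly_Mapping.keys (Poly_Mapping.update a b u) = insert a (Poly_Mapping.keys u)"
        using update by (simp add: keys_update)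
      have e: "Poly_Mapping.update a b u = u + scl b (Poly_Mapping.single a 1)"
        by (rule poly_mapping_eqI) (use update in \<open>auto simp: lookup_add lookup_update lookup_single when_def in_keys_iff\<close>)
      have a: "a \<in> X" and u: "u \<in> free" using k kk by auto
      have s: "Poly_Mapping.single a 1 \<in> free" using a by auto
      have "cls (Poly_Mapping.update a b u) = cls u \<oplus>\<^bsub>S\<^esub> b \<odot>\<^bsub>S\<^esub> sep_class X \<phi> a"
        unfolding e sep_class_def using u s free_scl[OF s] by (simp add: sep_add sep_smult)
      moreover have "sep_class X \<phi> a \<in> lspan S (sep_class X \<phi> ` X)" using S.lspan_base[of "sep_class X \<phi> ` X"] a by auto
      moreover have "cls u \<in> lspan S (sep_class X \<phi> ` X)" using update u by auto
      ultimately show "cls (Poly_Mapping.update a b u) \<in> lspan S (sep_class X \<phi> ` X)"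
        using S.submoduleD[OF M] by metis
    qed
  qed
  then show "carrier S \<subseteq> lspan S (sep_class X \<phi> ` X)" using sep_carrier by auto
qed

lemma class_eqI:
  assumes P: "P \<in> carrier S" and Q: "Q \<in> carrier S" and e: "\<And>x. x \<in> X \<Longrightarrow> ip S (sep_class X \<phi> x) P = ip S (sep_class X \<phi> x) Q"
  shows "P = Q"
proof (rule S.ip_eqI[OF P Q])
  have "submodule {z \<in> carrier S. ip S z P = ip S z Q} CC S"
    by (rule S.submoduleI') (auto simp: P Q S.ip_add_left S.ip_smult_left)
  moreover have "sep_class X \<phi> ` X \<subseteq> {z \<in> carrier S. ip S z P = ip S z Q}" using e class_closed by auto
  ultimately have "carrier S \<subseteq> {z \<in> carrier S. ip S z P = ip S z Q}"
    by (rule S.lspan_least[of _ "sep_class X \<phi> ` X", unfolded class_span])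
  then show "\<And>z. z \<in> carrier S \<Longrightarrow> ip S z P = ip S z Q" by auto
qed

end

text \<open>
  The vector \<open>v\<close> is the push-forward of \<open>u\<close> along \<open>f\<close>; since \<open>f\<close> need not be injective, its
  coefficients are sums over the fibers of \<open>f\<close>.
\<close>

lemma sesq_pullback:
  assumes f: "\<And>x. x \<in> X \<Longrightarrow> f x \<in> Y" and e: "\<And>x y. x \<in> X \<Longrightarrow> y \<in> X \<Longrightarrow> \<phi> x y = \<psi> (f x) (f y)"
    and u: "Poly_Mapping.keys u \<subseteq> X"
  shows "\<exists>v. Poly_Mapping.keys v \<subseteq> Y \<and> sesq \<phi> u u = sesq \<psi> v v"
proof -
  define v where "v = (\<Sum>x\<in>Poly_Mapping.keys u. Poly_Mapping.single (f x) (Poly_Mapping.lookup u x))"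
  have k: "Poly_Mapping.keys v \<subseteq> f ` Poly_Mapping.keys u"
  proof -
    have "Poly_Mapping.keys v \<subseteq> (\<Union>x\<in>Poly_Mapping.keys u. Poly_Mapping.keys (Poly_Mapping.single (f x) (Poly_Mapping.lookup u x)))"
      unfolding v_def by (rule keys_sum)
    also have "... \<subseteq> f ` Poly_Mapping.keys u"
      by (rule UN_least) (simp del: in_keys_iff)
    finally show ?thesis .
  qed
  have lv: "Poly_Mapping.lookup v y = (\<Sum>x\<in>Poly_Mapping.keys u. if f x = y then Poly_Mapping.lookup u x else 0)" for y
    unfolding v_def by (simp add: lookup_sum lookup_single when_def)
  let ?A = "f ` Poly_Mapping.keys u"
  have push: "(\<Sum>y\<in>?A. (\<Sum>x\<in>Poly_Mapping.keys u. if f x = y then h x else 0) * g y) = (\<Sum>x\<in>Poly_Mapping.keys u. h x * g (f x))" for h g :: "_ \<Rightarrow> complex"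
  proof -
    have "(\<Sum>y\<in>?A. (\<Sum>x\<in>Poly_Mapping.keys u. if f x = y then h x else 0) * g y) = (\<Sum>y\<in>?A. \<Sum>x\<in>Poly_Mapping.keys u. if f x = y then h x * g y else 0)"
      unfolding sum_distrib_right by (intro sum.cong refl) auto
    also have "... = (\<Sum>x\<in>Poly_Mapping.keys u. \<Sum>y\<in>?A. if f x = y then h x * g y else 0)" by (rule sum.swap)
    also have "... = (\<Sum>x\<in>Poly_Mapping.keys u. h x * g (f x))" by (intro sum.cong refl) simp
    finally show ?thesis .
  qed
  have "sesq \<psi> v v = (\<Sum>x\<in>?A. \<Sum>y\<in>?A. cnj (Poly_Mapping.lookup v x) * Poly_Mapping.lookup v y * \<psi> x y)"
    by (rule sesq_superset) (use k in auto)
  also have "... = (\<Sum>x\<in>?A. cnj (Poly_Mapping.lookup v x) * (\<Sum>y\<in>?A. Poly_Mapping.lookup v y * \<psi> x y))"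
    by (simp add: sum_distrib_left mult.assoc)
  also have "... = (\<Sum>x\<in>?A. cnj (Poly_Mapping.lookup v x) * (\<Sum>y\<in>Poly_Mapping.keys u. Poly_Mapping.lookup u y * \<psi> x (f y)))"
    unfolding lv push ..
  also have "... = (\<Sum>x\<in>?A. (\<Sum>z\<in>Poly_Mapping.keys u. if f z = x then cnj (Poly_Mapping.lookup u z) else 0) * (\<Sum>y\<in>Poly_Mapping.keys u. Poly_Mapping.lookup u y * \<psi> x (f y)))"
    unfolding lv cnj_sum by (intro sum.cong refl arg_cong2[of _ _ _ _ "(*)"]) auto
  also have "... = (\<Sum>x\<in>Poly_Mapping.keys u. cnj (Poly_Mapping.lookup u x) * (\<Sum>y\<in>Poly_Mapping.keys u. Poly_Mapping.lookup u y * \<psi> (f x) (f y)))"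
    unfolding push ..
  also have "... = sesq \<phi> u u"
    unfolding sesq_def sum_distrib_left
    by (intro sum.cong refl) (use u e in \<open>auto simp: mult.assoc subset_iff simp del: in_keys_iff\<close>)
  finally show ?thesis using k f u by (intro exI[of _ v]) auto
qed

lemma pos_form_pullback:
  fixes X :: "'x set"
  assumes P: "pos_form Y \<psi>" and f: "\<And>x. x \<in> X \<Longrightarrow> f x \<in> Y" and e: "\<And>x y. x \<in> X \<Longrightarrow> y \<in> X \<Longrightarrow> \<phi> x y = \<psi> (f x) (f y)"
  shows "pos_form X \<phi>"
proof
  fix x y assume xy: "x \<in> X" "y \<in> X"
  show "\<phi> y x = cnj (\<phi> x y)"
    using pos_form.herm[OF P f[OF xy(1)] f[OF xy(2)]] e[OF xy] e[OF xy(2,1)] by metis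
next
  fix u :: "'x \<Rightarrow>\<^sub>0 complex" assume u: "Poly_Mapping.keys u \<subseteq> X"
  obtain v where "Poly_Mapping.keys v \<subseteq> Y" "sesq \<phi> u u = sesq \<psi> v v" using sesq_pullback[where X=X and Y=Y and f=f and \<phi>="\<phi>" and \<psi>="\<psi>", OF f e u] by blast
  then show "Re (sesq \<phi> u u) \<ge> 0" using pos_form.psd[OF P] by simp
qed

section \<open>Products of commuting positive operators\<close>

context fd_space begin

text \<open>
  A positive contraction \<open>Q\<close> is the (weak) sum of the squares of \<open>q\<^sub>0 = Q\<close>, \<open>q\<^sub>n\<^sub>+\<^sub>1 = q\<^sub>n - q\<^sub>n\<^sup>2\<close>,
  which commute with everything that commutes with \<open>Q\<close>. The identity
  \<open>T - T\<^sup>2 = T\<^sup>2(1 - T) + T(1 - T)\<^sup>2\<close> shows that all \<open>q\<^sub>n\<close> are positive contractions. As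
  \<open>\<Sum>\<^sub>k\<^sub><\<^sub>n q\<^sub>k\<^sup>2 = Q - q\<^sub>n\<close>, the series \<open>\<Sum> \<Parallel>q\<^sub>k x\<Parallel>\<^sup>2\<close> converges, and so \<open>q\<^sub>n x\<close> tends to \<open>0\<close>.
\<close>

lemma positive_squares:
  assumes Q: "Q \<in> carrier (Ops V V)"
    and sa: "\<And>x y. x \<in> carrier V \<Longrightarrow> y \<in> carrier V \<Longrightarrow> ip V (Q x) y = ip V x (Q y)"
    and lb: "\<And>x. x \<in> carrier V \<Longrightarrow> 0 \<le> Re (ip V x (Q x))"
    and ub: "\<And>x. x \<in> carrier V \<Longrightarrow> Re (ip V x (Q x)) \<le> Re (ip V x x)"
  shows "\<exists>q :: nat \<Rightarrow> 'a \<Rightarrow> 'a. (\<forall>n. q n \<in> carrier (Ops V V)) \<and>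
    (\<forall>n. \<forall>x\<in>carrier V. \<forall>y\<in>carrier V. ip V (q n x) y = ip V x (q n y)) \<and>
    (\<forall>n. \<forall>R\<in>carrier (Ops V V). (\<forall>x\<in>carrier V. R (Q x) = Q (R x)) \<longrightarrow> (\<forall>x\<in>carrier V. R (q n x) = q n (R x))) \<and>
    (\<forall>x\<in>carrier V. \<forall>y\<in>carrier V. (\<lambda>n. \<Sum>k<n. ip V y (q k (q k x))) \<longlonglongrightarrow> ip V y (Q x))"
proof -
  interpret VV: fd_pair V V ..
  define st where "st = (\<lambda>T :: 'a \<Rightarrow> 'a. \<lambda>x\<in>carrier V. T x \<ominus>\<^bsub>V\<^esub> T (T x))"
  define q where "q n = (st ^^ n) Q" for n
  have q0: "q 0 = Q" by (simp add: q_def)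
  have qS: "q (Suc n) x = q n x \<ominus>\<^bsub>V\<^esub> q n (q n x)" if "x \<in> carrier V" for n x
    using that by (simp add: q_def st_def)
  have qSe: "q (Suc n) = (\<lambda>x\<in>carrier V. q n x \<ominus>\<^bsub>V\<^esub> q n (q n x))" for n
    by (simp add: q_def st_def)
  have inv: "q n \<in> carrier (Ops V V) \<and>
     (\<forall>x\<in>carrier V. \<forall>y\<in>carrier V. ip V (q n x) y = ip V x (q n y)) \<and>
     (\<forall>x\<in>carrier V. 0 \<le> Re (ip V x (q n x)) \<and> Re (ip V x (q n x)) \<le> Re (ip V x x))" for n
  proof (induction n)
    case 0 then show ?case using Q sa lb ub q0 by auto
  next
    case (Suc n)
    let ?T = "q n"
    have T: "?T \<in> carrier (Ops V V)" using Suc by blast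
    have tsa: "\<And>x y. x \<in> carrier V \<Longrightarrow> y \<in> carrier V \<Longrightarrow> ip V (?T x) y = ip V x (?T y)" using Suc by blast
    have tlb: "\<And>x. x \<in> carrier V \<Longrightarrow> 0 \<le> Re (ip V x (?T x))" and tub: "\<And>x. x \<in> carrier V \<Longrightarrow> Re (ip V x (?T x)) \<le> Re (ip V x x)"
      using Suc by blast+
    note Tc = OpsD(2)[OF T]
    have st1: "q (Suc n) \<in> carrier (Ops V V)"
      unfolding qSe
    proof (rule VV.restrict_OpsI; (rule ip_eqI)?)
      fix x y z assume "x \<in> carrier V" "y \<in> carrier V" "z \<in> carrier V"
      then show "ip V z (?T (x \<oplus>\<^bsub>V\<^esub> y) \<ominus>\<^bsub>V\<^esub> ?T (?T (x \<oplus>\<^bsub>V\<^esub> y))) = ip V z ((?T x \<ominus>\<^bsub>V\<^esub> ?T (?T x)) \<oplus>\<^bsub>V\<^esub> (?T y \<ominus>\<^bsub>V\<^esub> ?T (?T y)))"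
        using Tc by (simp add: OpsD(3)[OF T] ip_diff_right ip_add_right)
    next
      fix c x z assume "x \<in> carrier V" "z \<in> carrier V"
      then show "ip V z (?T (c \<odot>\<^bsub>V\<^esub> x) \<ominus>\<^bsub>V\<^esub> ?T (?T (c \<odot>\<^bsub>V\<^esub> x))) = ip V z (c \<odot>\<^bsub>V\<^esub> (?T x \<ominus>\<^bsub>V\<^esub> ?T (?T x)))"
        using Tc by (simp add: OpsD(4)[OF T] ip_diff_right ip_smult_right algebra_simps)
    qed (use Tc in auto)
    have st2: "ip V (q (Suc n) x) y = ip V x (q (Suc n) y)" if "x \<in> carrier V" "y \<in> carrier V" for x y
      using that Tc tsa by (simp add: qS ip_diff_left ip_diff_right)
    have st3: "0 \<le> Re (ip V x (q (Suc n) x)) \<and> Re (ip V x (q (Suc n) x)) \<le> Re (ip V x x)" if x: "x \<in> carrier V" for x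
    proof -
      let ?y = "?T x" and ?z = "x \<ominus>\<^bsub>V\<^esub> ?T x"
      have y: "?y \<in> carrier V" and z: "?z \<in> carrier V" using x Tc by auto
      have e: "ip V x (q (Suc n) x) = ip V x (?T x) - ip V ?y ?y"
        using x Tc tsa[OF x y] by (simp add: qS ip_diff_right)
      have Tz: "?T ?z = ?T x \<ominus>\<^bsub>V\<^esub> ?T (?T x)"
      proof -
        show ?thesis
        proof (rule ip_eqI)
          fix w assume w: "w \<in> carrier V"
          show "ip V w (?T ?z) = ip V w (?T x \<ominus>\<^bsub>V\<^esub> ?T (?T x))"
            using x y z w Tc tsa[OF w z] tsa[OF w x] tsa[OF w y] by (simp add: ip_diff_right)
        qed (use x y z Tc in auto)
      qed
      have "ip V ?z (?T ?z) = ip V x (?T x) - ip V x (?T (?T x)) - (ip V ?y (?T x) - ip V ?y (?T (?T x)))"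
        unfolding Tz using x y z Tc by (simp add: ip_diff_right ip_diff_left)
      then have "ip V ?z (?T ?z) = ip V x (?T x) - 2 * ip V ?y ?y + ip V ?y (?T ?y)"
        using tsa[OF x y] by simp
      then have "Re (ip V x (?T x)) - 2 * Re (ip V ?y ?y) + Re (ip V ?y (?T ?y)) \<ge> 0" using tlb[OF z] by simp
      moreover have "Re (ip V ?y (?T ?y)) \<le> Re (ip V ?y ?y)" using tub[OF y] .
      moreover have "Re (ip V ?y ?y) \<ge> 0" using ip_self[OF y] by (simp flip: of_real_power)
      ultimately show ?thesis using tub[OF x] unfolding e by simp
    qed
    show ?case using st1 st2 st3 by blast
  qed
  note qc = inv[THEN conjunct1]
  note qcl = OpsD(2)[OF qc]
  have qsa: "\<And>n x y. x \<in> carrier V \<Longrightarrow> y \<in> carrier V \<Longrightarrow> ip V (q n x) y = ip V x (q n y)" using inv by blast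
  have comm: "\<forall>x\<in>carrier V. R (q n x) = q n (R x)" if R: "R \<in> carrier (Ops V V)" and c: "\<forall>x\<in>carrier V. R (Q x) = Q (R x)" for n R
  proof (induction n)
    case 0 then show ?case using q0 c by simp
  next
    case (Suc n)
    show ?case
    proof
      fix x assume x: "x \<in> carrier V"
      note Rc = OpsD(2)[OF R]
      have "R (q n x \<ominus>\<^bsub>V\<^esub> q n (q n x)) = R (q n x) \<ominus>\<^bsub>V\<^esub> R (q n (q n x))"
      proof -
        have "q n x = (q n x \<ominus>\<^bsub>V\<^esub> q n (q n x)) \<oplus>\<^bsub>V\<^esub> q n (q n x)" using qcl x
          by (simp add: a_minus_def M.add.m_assoc M.l_neg)
        then have "R (q n x) = R (q n x \<ominus>\<^bsub>V\<^esub> q n (q n x)) \<oplus>\<^bsub>V\<^esub> R (q n (q n x))"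
          using OpsD(3)[OF R, of "q n x \<ominus>\<^bsub>V\<^esub> q n (q n x)" "q n (q n x)"] qcl x by simp
        then show ?thesis using Rc qcl x by (simp add: a_minus_def M.add.m_assoc M.r_neg)
      qed
      then show "R (q (Suc n) x) = q (Suc n) (R x)" using Suc x Rc qcl by (simp add: qS)
    qed
  qed
  have lim: "(\<lambda>n. \<Sum>k<n. ip V y (q k (q k x))) \<longlonglongrightarrow> ip V y (Q x)" if x: "x \<in> carrier V" and y: "y \<in> carrier V" for x y
  proof -
    have tel: "(\<Sum>k<n. ip V w (q k (q k x))) = ip V w (Q x) - ip V w (q n x)" if w: "w \<in> carrier V" for n w
      by (induction n) (use w x qcl in \<open>auto simp: q0 qS ip_diff_right\<close>)
    have sm: "summable (\<lambda>k. (nrm V (q k x))\<^sup>2)"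
    proof (rule summableI_nonneg_bounded)
      fix n
      have "(\<Sum>k<n. (nrm V (q k x))\<^sup>2) = Re (\<Sum>k<n. ip V x (q k (q k x)))"
        unfolding Re_sum
      proof (rule sum.cong[OF refl])
        fix k
        have "ip V x (q k (q k x)) = ip V (q k x) (q k x)" using qsa[OF x qcl[OF x]] by simp
        then show "(nrm V (q k x))\<^sup>2 = Re (ip V x (q k (q k x)))" using ip_self[OF qcl[OF x]] by (simp flip: of_real_power)
      qed
      also have "... \<le> Re (ip V x (Q x))" using tel[OF x] inv x by simp
      finally show "(\<Sum>k<n. (nrm V (q k x))\<^sup>2) \<le> Re (ip V x (Q x))" .
    qed simp
    have "(\<lambda>k. (nrm V (q k x))\<^sup>2) \<longlonglongrightarrow> 0" using summable_LIMSEQ_zero[OF sm] .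
    then have "(\<lambda>k. sqrt ((nrm V (q k x))\<^sup>2)) \<longlonglongrightarrow> sqrt 0" by (rule tendsto_real_sqrt)
    then have n0: "(\<lambda>k. nrm V (q k x)) \<longlonglongrightarrow> 0" using nrm_nonneg[OF qcl[OF x]] by simp
    have "(\<lambda>k. nrm V y * nrm V (q k x)) \<longlonglongrightarrow> 0" using tendsto_mult_right_zero[OF n0, of "nrm V y"] by (simp add: mult.commute)
    then have "(\<lambda>k. ip V y (q k x)) \<longlonglongrightarrow> 0"
      by (rule Lim_null_comparison[rotated]) (use cauchy_schwarz[OF y qcl[OF x]] in auto)
    then have "(\<lambda>n. ip V y (Q x) - ip V y (q n x)) \<longlonglongrightarrow> ip V y (Q x) - 0" by (intro tendsto_diff tendsto_const)
    then show ?thesis using tel[OF y] by simp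
  qed
  show ?thesis using qc qsa comm lim by (intro exI[of _ q]) blast
qed

text \<open>
  If the matrix \<open>(C\<^sub>i\<^sub>j S)\<close> is positive and \<open>S\<close> is positive and commutes with all \<open>C\<^sub>i\<^sub>j\<close>, then
  \<open>(S C\<^sub>i\<^sub>j S)\<close> is positive too. Nothing is assumed about \<open>C\<close> alone.
\<close>

lemma positive_product:
  assumes S: "S \<in> carrier (Ops V V)"
    and sa: "\<And>x y. x \<in> carrier V \<Longrightarrow> y \<in> carrier V \<Longrightarrow> ip V (S x) y = ip V x (S y)"
    and pos: "\<And>x. x \<in> carrier V \<Longrightarrow> 0 \<le> Re (ip V x (S x))"
    and C: "\<And>i j. i \<in> J \<Longrightarrow> j \<in> J \<Longrightarrow> C i j \<in> carrier (Ops V V)"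
    and cS: "\<And>i j x. i \<in> J \<Longrightarrow> j \<in> J \<Longrightarrow> x \<in> carrier V \<Longrightarrow> C i j (S x) = S (C i j x)"
    and psd: "\<And>y. (\<And>j. j \<in> J \<Longrightarrow> y j \<in> carrier V) \<Longrightarrow> 0 \<le> Re (\<Sum>i\<in>J. \<Sum>j\<in>J. ip V (y i) (C i j (S (y j))))"
    and y: "\<And>j. j \<in> J \<Longrightarrow> y j \<in> carrier V"
  shows "0 \<le> Re (\<Sum>i\<in>J. \<Sum>j\<in>J. ip V (S (y i)) (C i j (S (y j))))"
proof -
  interpret VV: fd_pair V V ..
  note Sc = OpsD(2)[OF S]
  have "\<exists>K. \<forall>x\<in>carrier V. nrm V (S x) \<le> K * nrm V x" using S by (simp add: Ops_def)
  then obtain K where K: "\<And>x. x \<in> carrier V \<Longrightarrow> nrm V (S x) \<le> K * nrm V x" by blast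
  \<comment> \<open>Dividing by \<open>\<kappa>\<close> makes \<open>S\<close> a contraction.\<close>
  define \<kappa> where "\<kappa> = \<bar>K\<bar> + 1"
  have \<kappa>: "\<kappa> > 0" by (simp add: \<kappa>_def)
  have K\<kappa>: "Re (ip V x (S x)) \<le> \<kappa> * Re (ip V x x)" if x: "x \<in> carrier V" for x
  proof -
    have "Re (ip V x (S x)) \<le> nrm V x * nrm V (S x)"
      using cauchy_schwarz[OF x Sc[OF x]] complex_Re_le_cmod[of "ip V x (S x)"] by linarith
    also have "... \<le> nrm V x * (\<kappa> * nrm V x)"
    proof (rule mult_left_mono)
      have "K * nrm V x \<le> \<kappa> * nrm V x" using nrm_nonneg[OF x] by (intro mult_right_mono) (auto simp: \<kappa>_def)
      then show "nrm V (S x) \<le> \<kappa> * nrm V x" using K[OF x] by linarith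
    qed (use x in simp)
    also have "... = \<kappa> * Re (ip V x x)" using ip_self[OF x] by (simp add: power2_eq_square flip: of_real_power of_real_mult)
    finally show ?thesis .
  qed
  define Q where "Q = complex_of_real (inverse \<kappa>) \<odot>\<^bsub>Ops V V\<^esub> S"
  have Q: "Q \<in> carrier (Ops V V)" unfolding Q_def using S VV.Ops_smult_closed by blast
  have Qx: "Q x = complex_of_real (inverse \<kappa>) \<odot>\<^bsub>V\<^esub> S x" if "x \<in> carrier V" for x using that by (simp add: Q_def)
  have "\<exists>q :: nat \<Rightarrow> 'a \<Rightarrow> 'a. (\<forall>n. q n \<in> carrier (Ops V V)) \<and>
    (\<forall>n. \<forall>x\<in>carrier V. \<forall>y\<in>carrier V. ip V (q n x) y = ip V x (q n y)) \<and>
    (\<forall>n. \<forall>R\<in>carrier (Ops V V). (\<forall>x\<in>carrier V. R (Q x) = Q (R x)) \<longrightarrow> (\<forall>x\<in>carrier V. R (q n x) = q n (R x))) \<and>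
    (\<forall>x\<in>carrier V. \<forall>y\<in>carrier V. (\<lambda>n. \<Sum>k<n. ip V y (q k (q k x))) \<longlonglongrightarrow> ip V y (Q x))"
  proof (rule positive_squares[OF Q])
    fix x y assume x: "x \<in> carrier V" and y: "y \<in> carrier V"
    show "ip V (Q x) y = ip V x (Q y)" using x y Sc sa[OF x y] by (simp add: Qx ip_smult_left ip_smult_right)
  next
    fix x assume x: "x \<in> carrier V"
    have e: "Re (ip V x (Q x)) = inverse \<kappa> * Re (ip V x (S x))" using x Sc by (simp add: Qx ip_smult_right flip: of_real_inverse)
    show "0 \<le> Re (ip V x (Q x))" unfolding e using pos[OF x] \<kappa> by simp
    show "Re (ip V x (Q x)) \<le> Re (ip V x x)" unfolding e using K\<kappa>[OF x] \<kappa> by (simp add: field_simps)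
  qed
  then obtain q where q: "\<And>n. q n \<in> carrier (Ops V V)"
    and qsa: "\<And>n x y. x \<in> carrier V \<Longrightarrow> y \<in> carrier V \<Longrightarrow> ip V (q n x) y = ip V x (q n y)"
    and qR: "\<And>n R x. R \<in> carrier (Ops V V) \<Longrightarrow> (\<forall>x\<in>carrier V. R (Q x) = Q (R x)) \<Longrightarrow> x \<in> carrier V \<Longrightarrow> R (q n x) = q n (R x)"
    and lim: "\<And>x y. x \<in> carrier V \<Longrightarrow> y \<in> carrier V \<Longrightarrow> (\<lambda>n. \<Sum>k<n. ip V y (q k (q k x))) \<longlonglongrightarrow> ip V y (Q x)"
    by blast
  note qcl = OpsD(2)[OF q]
  have qS: "S (q n x) = q n (S x)" if "x \<in> carrier V" for n x
    by (rule qR[OF S _ that]) (auto simp: Qx Sc OpsD(4)[OF S])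
  have qC: "C i j (q n x) = q n (C i j x)" if "i \<in> J" "j \<in> J" "x \<in> carrier V" for i j n x
    by (rule qR[OF C _ that(3)]) (use that cS in \<open>auto simp: Qx Sc OpsD(4)[OF C] OpsD(2)[OF C]\<close>)
  have CSc: "C i j (S (y j)) \<in> carrier V" if "i \<in> J" "j \<in> J" for i j
    using OpsD(2)[OF C[OF that] Sc[OF y[OF that(2)]]] .
  have l1: "(\<lambda>n. \<Sum>i\<in>J. \<Sum>j\<in>J. cnj (\<Sum>k<n. ip V (C i j (S (y j))) (q k (q k (y i)))))
     \<longlonglongrightarrow> (\<Sum>i\<in>J. \<Sum>j\<in>J. cnj (ip V (C i j (S (y j))) (Q (y i))))"
    by (intro tendsto_sum tendsto_cnj lim y CSc)
  have t: "(\<Sum>i\<in>J. \<Sum>j\<in>J. cnj (\<Sum>k<n. ip V (C i j (S (y j))) (q k (q k (y i)))))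
     = (\<Sum>k<n. \<Sum>i\<in>J. \<Sum>j\<in>J. ip V (q k (y i)) (C i j (S (q k (y j)))))" for n
  proof -
    have "(\<Sum>i\<in>J. \<Sum>j\<in>J. cnj (\<Sum>k<n. ip V (C i j (S (y j))) (q k (q k (y i)))))
      = (\<Sum>i\<in>J. \<Sum>j\<in>J. \<Sum>k<n. ip V (q k (y i)) (C i j (S (q k (y j)))))"
    proof (intro sum.cong refl, unfold cnj_sum, intro sum.cong refl)
      fix i j k assume ij: "i \<in> J" "j \<in> J"
      have "cnj (ip V (C i j (S (y j))) (q k (q k (y i)))) = ip V (q k (q k (y i))) (C i j (S (y j)))"
        using ip_commute[OF CSc[OF ij] qcl[OF qcl[OF y[OF ij(1)]]]] by simp
      also have "... = ip V (q k (y i)) (q k (C i j (S (y j))))"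
        using qsa[OF qcl[OF y[OF ij(1)]] CSc[OF ij]] .
      also have "... = ip V (q k (y i)) (C i j (S (q k (y j))))"
        using qC[OF ij Sc[OF y[OF ij(2)]]] qS[OF y[OF ij(2)]] by simp
      finally show "cnj (ip V (C i j (S (y j))) (q k (q k (y i)))) = ip V (q k (y i)) (C i j (S (q k (y j))))" .
    qed
    also have "... = (\<Sum>i\<in>J. \<Sum>k<n. \<Sum>j\<in>J. ip V (q k (y i)) (C i j (S (q k (y j)))))"
      by (intro sum.cong refl sum.swap)
    also have "... = (\<Sum>k<n. \<Sum>i\<in>J. \<Sum>j\<in>J. ip V (q k (y i)) (C i j (S (q k (y j)))))" by (rule sum.swap)
    finally show ?thesis .
  qed
  have r: "(\<Sum>i\<in>J. \<Sum>j\<in>J. cnj (ip V (C i j (S (y j))) (Q (y i)))) = complex_of_real (inverse \<kappa>) * (\<Sum>i\<in>J. \<Sum>j\<in>J. ip V (S (y i)) (C i j (S (y j))))"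
    unfolding sum_distrib_left
  proof (intro sum.cong refl)
    fix i j assume ij: "i \<in> J" "j \<in> J"
    have Qy: "Q (y i) \<in> carrier V" using OpsD(2)[OF Q y[OF ij(1)]] .
    have "cnj (ip V (C i j (S (y j))) (Q (y i))) = ip V (Q (y i)) (C i j (S (y j)))"
      using ip_commute[OF CSc[OF ij] Qy] by simp
    also have "... = complex_of_real (inverse \<kappa>) * ip V (S (y i)) (C i j (S (y j)))"
      using Qx[OF y[OF ij(1)]] ip_smult_left[OF Sc[OF y[OF ij(1)]] CSc[OF ij]] by simp
    finally show "cnj (ip V (C i j (S (y j))) (Q (y i))) = complex_of_real (inverse \<kappa>) * ip V (S (y i)) (C i j (S (y j)))" .
  qed
  have L: "(\<lambda>n. Re (\<Sum>k<n. \<Sum>i\<in>J. \<Sum>j\<in>J. ip V (q k (y i)) (C i j (S (q k (y j))))))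
     \<longlonglongrightarrow> Re (complex_of_real (inverse \<kappa>) * (\<Sum>i\<in>J. \<Sum>j\<in>J. ip V (S (y i)) (C i j (S (y j)))))"
    using tendsto_Re[OF l1] unfolding t r .
  have P: "0 \<le> Re (\<Sum>k<n. \<Sum>i\<in>J. \<Sum>j\<in>J. ip V (q k (y i)) (C i j (S (q k (y j)))))" for n
    unfolding Re_sum[of _ "{..<n}"] by (intro sum_nonneg psd qcl y)
  have "0 \<le> Re (complex_of_real (inverse \<kappa>) * (\<Sum>i\<in>J. \<Sum>j\<in>J. ip V (S (y i)) (C i j (S (y j)))))"
    by (rule LIMSEQ_le_const[OF L]) (use P in blast)
  then have "0 \<le> inverse \<kappa> * Re (\<Sum>i\<in>J. \<Sum>j\<in>J. ip V (S (y i)) (C i j (S (y j))))" by (simp del: of_real_inverse Re_sum)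
  then show ?thesis using \<kappa> by (simp add: zero_le_mult_iff del: Re_sum)
qed

lemma selfadj_surj:
  assumes S: "S \<in> carrier (Ops V V)"
    and sa: "\<And>x y. x \<in> carrier V \<Longrightarrow> y \<in> carrier V \<Longrightarrow> ip V (S x) y = ip V x (S y)"
    and inj: "\<And>x. x \<in> carrier V \<Longrightarrow> S x = \<zero>\<^bsub>V\<^esub> \<Longrightarrow> x = \<zero>\<^bsub>V\<^esub>"
    and x: "x \<in> carrier V"
  shows "\<exists>y\<in>carrier V. S y = x"
proof -
  interpret VV: fd_pair V V ..
  note Sc = OpsD(2)[OF S]
  have M: "submodule (S ` carrier V) CC V"
  proof (rule submoduleI')
    show "\<zero>\<^bsub>V\<^esub> \<in> S ` carrier V" using VV.Ops_zero[OF S] M.zero_closed by force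
  next
    fix x y assume "x \<in> S ` carrier V" "y \<in> S ` carrier V"
    then obtain x' y' where "x' \<in> carrier V" "y' \<in> carrier V" "x = S x'" "y = S y'" by auto
    then show "x \<oplus>\<^bsub>V\<^esub> y \<in> S ` carrier V" by (intro image_eqI[of _ _ "x' \<oplus>\<^bsub>V\<^esub> y'"]) (simp_all add: OpsD(3)[OF S])
  next
    fix a x assume "x \<in> S ` carrier V"
    then obtain x' where "x' \<in> carrier V" "x = S x'" by auto
    then show "a \<odot>\<^bsub>V\<^esub> x \<in> S ` carrier V" by (intro image_eqI[of _ _ "a \<odot>\<^bsub>V\<^esub> x'"]) (simp_all add: OpsD(4)[OF S])
  qed (use Sc in auto)
  have "S ` carrier V = carrier V"
  proof (rule submodule_total[OF M])
    fix z assume z: "z \<in> carrier V" and o: "\<And>m. m \<in> S ` carrier V \<Longrightarrow> ip V m z = 0"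
    have "S z = \<zero>\<^bsub>V\<^esub>"
    proof (rule ip_eqI[OF Sc[OF z]])
      fix w assume w: "w \<in> carrier V"
      show "ip V w (S z) = ip V w \<zero>\<^bsub>V\<^esub>" using sa[OF w z] o[of "S w"] w by simp
    qed simp
    then show "z = \<zero>\<^bsub>V\<^esub>" using inj z by blast
  qed
  then show ?thesis using x by (metis imageE)
qed

end

section \<open>C*-factorizations over a standard base\<close>

text \<open>
  What is used of a finite-dimensional standard C*-base: commuting sets \<open>B\<close>, \<open>Bd\<close> of operators with
  \<open>B \<zeta> = G\<close> and \<open>Bd \<zeta> = G\<close>. The two sets enter symmetrically.
\<close>

locale base = G: fd_space G for G :: "('g, 'm) hilb_scheme" +
  fixes B Bd :: "('g \<Rightarrow> 'g) set" and \<zeta> :: 'g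
  assumes B_ops: "b \<in> B \<Longrightarrow> b \<in> carrier (Ops G G)" and Bd_ops: "c \<in> Bd \<Longrightarrow> c \<in> carrier (Ops G G)"
    and BBd: "b \<in> B \<Longrightarrow> c \<in> Bd \<Longrightarrow> x \<in> carrier G \<Longrightarrow> b (c x) = c (b x)"
    and \<zeta>: "\<zeta> \<in> carrier G"
    and cyc: "x \<in> carrier G \<Longrightarrow> \<exists>b\<in>B. b \<zeta> = x" and cycd: "x \<in> carrier G \<Longrightarrow> \<exists>c\<in>Bd. c \<zeta> = x"
begin

sublocale GG: fd_pair G G ..

end

text \<open>What is used of a C*-factorization \<open>\<alpha>\<close> of \<open>H\<close>; spans are linear spans.\<close>

locale factor = base G B Bd \<zeta> + H: fd_space H
  for G :: "('g, 'm) hilb_scheme" and B Bd \<zeta> and H :: "('h, 'n) hilb_scheme" +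
  fixes \<alpha> :: "('g \<Rightarrow> 'h) set"
  assumes \<alpha>_sub: "submodule \<alpha> CC (Ops G H)"
    and \<alpha>\<alpha>: "a \<in> \<alpha> \<Longrightarrow> a' \<in> \<alpha> \<Longrightarrow> compose (carrier G) (adj G H a) a' \<in> B"
    and \<alpha>B: "a \<in> \<alpha> \<Longrightarrow> b \<in> B \<Longrightarrow> compose (carrier G) a b \<in> \<alpha>"
    and \<alpha>G: "lspan H {a \<omega> |a \<omega>. a \<in> \<alpha> \<and> \<omega> \<in> carrier G} = carrier H"
begin

sublocale GH: fd_pair G H ..
sublocale HH: fd_pair H H ..

lemma \<alpha>_ops: "a \<in> \<alpha> \<Longrightarrow> a \<in> carrier (Ops G H)"
  using GH.O.submoduleD(1)[OF \<alpha>_sub] by auto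

lemma \<alpha>_closed: "a \<in> \<alpha> \<Longrightarrow> x \<in> carrier G \<Longrightarrow> a x \<in> carrier H"
  using OpsD(2)[OF \<alpha>_ops] .

lemma \<alpha>adj: "a \<in> \<alpha> \<Longrightarrow> adj G H a \<in> carrier (Ops H G)"
  using GH.adj_closed[OF \<alpha>_ops] .

lemma \<alpha>adj_closed: "a \<in> \<alpha> \<Longrightarrow> h \<in> carrier H \<Longrightarrow> adj G H a h \<in> carrier G"
  using OpsD(2)[OF \<alpha>adj] .

lemma \<alpha>\<alpha>Bd: "a \<in> \<alpha> \<Longrightarrow> a' \<in> \<alpha> \<Longrightarrow> c \<in> Bd \<Longrightarrow> x \<in> carrier G \<Longrightarrow> adj G H a (a' (c x)) = c (adj G H a (a' x))"
  using BBd[OF \<alpha>\<alpha>, of a a' c x] OpsD(2)[OF Bd_ops, of c x] by (simp add: compose_eq)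

lemma ex_elt: "h \<in> carrier H \<Longrightarrow> \<exists>a\<in>\<alpha>. a \<zeta> = h"
proof -
  assume h: "h \<in> carrier H"
  let ?M = "{a \<zeta> |a. a \<in> \<alpha>}"
  have "submodule ?M CC H"
  proof (rule H.submoduleI')
    show "\<zero>\<^bsub>H\<^esub> \<in> ?M" using GH.O.submoduleD(2)[OF \<alpha>_sub] \<zeta> by (auto intro!: exI[of _ "zero (Ops G H)"])
  next
    fix x y assume "x \<in> ?M" "y \<in> ?M"
    then obtain a b where "a \<in> \<alpha>" "b \<in> \<alpha>" "x = a \<zeta>" "y = b \<zeta>" by auto
    then show "x \<oplus>\<^bsub>H\<^esub> y \<in> ?M" using GH.O.submoduleD(3)[OF \<alpha>_sub] \<zeta> by (auto intro!: exI[of _ "a \<oplus>\<^bsub>Ops G H\<^esub> b"])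
  next
    fix k x assume "x \<in> ?M"
    then obtain a where "a \<in> \<alpha>" "x = a \<zeta>" by auto
    then show "k \<odot>\<^bsub>H\<^esub> x \<in> ?M" using GH.O.submoduleD(4)[OF \<alpha>_sub] \<zeta> by (auto intro!: exI[of _ "k \<odot>\<^bsub>Ops G H\<^esub> a"])
  qed (use \<alpha>_closed \<zeta> in auto)
  moreover have "{a \<omega> |a \<omega>. a \<in> \<alpha> \<and> \<omega> \<in> carrier G} \<subseteq> ?M"
  proof clarify
    fix a \<omega> assume a: "a \<in> \<alpha>" and w: "\<omega> \<in> carrier G"
    obtain b where b: "b \<in> B" "b \<zeta> = \<omega>" using cyc[OF w] by auto
    show "\<exists>a'. a \<omega> = a' \<zeta> \<and> a' \<in> \<alpha>" using \<alpha>B[OF a b(1)] b(2) \<zeta> by (intro exI[of _ "compose (carrier G) a b"]) (simp add: compose_eq)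
  qed
  ultimately have "carrier H \<subseteq> ?M" by (rule H.lspan_least[of _ "{a \<omega> |a \<omega>. a \<in> \<alpha> \<and> \<omega> \<in> carrier G}", unfolded \<alpha>G])
  then show ?thesis using h by auto
qed

text \<open>
  The difference \<open>d\<close> of two such elements satisfies \<open>d \<zeta> = 0\<close>, hence
  \<open>\<Parallel>d c \<zeta>\<Parallel>\<^sup>2 = \<langle>c \<zeta>|c d*d \<zeta>\<rangle> = 0\<close> for all \<open>c \<in> Bd\<close>, as \<open>d*d \<in> B\<close> commutes with \<open>c\<close>.
\<close>

lemma elt_unique:
  assumes a: "a \<in> \<alpha>" and a': "a' \<in> \<alpha>" and e: "a \<zeta> = a' \<zeta>"
  shows "a = a'"
proof (rule Ops_eqI[OF \<alpha>_ops[OF a] \<alpha>_ops[OF a']])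
  fix x assume x: "x \<in> carrier G"
  let ?d = "a \<ominus>\<^bsub>Ops G H\<^esub> a'"
  have d: "?d \<in> \<alpha>" using GH.O.submodule_diff[OF \<alpha>_sub a a'] .
  have d0: "?d \<zeta> = \<zero>\<^bsub>H\<^esub>" using GH.Ops_diff_apply[OF \<alpha>_ops[OF a] \<alpha>_ops[OF a'] \<zeta>] e \<alpha>_closed[OF a' \<zeta>]
    by (simp add: a_minus_def H.M.r_neg)
  obtain c where c: "c \<in> Bd" "c \<zeta> = x" using cycd[OF x] by auto
  have "adj G H ?d (?d x) = c (adj G H ?d (?d \<zeta>))" using \<alpha>\<alpha>Bd[OF d d c(1) \<zeta>] c(2) by simp
  also have "adj G H ?d (?d \<zeta>) = \<zero>\<^bsub>G\<^esub>" unfolding d0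
  proof -
    interpret HG: fd_pair H G ..
    show "adj G H ?d \<zero>\<^bsub>H\<^esub> = \<zero>\<^bsub>G\<^esub>" using HG.Ops_zero[OF \<alpha>adj[OF d]] .
  qed
  also have "c \<zero>\<^bsub>G\<^esub> = \<zero>\<^bsub>G\<^esub>" using GG.Ops_zero[OF Bd_ops[OF c(1)]] .
  finally have "ip H (?d x) (?d x) = 0"
    using GH.adj_ip[OF \<alpha>_ops[OF d] x \<alpha>_closed[OF d x]] x by simp
  then have "?d x = \<zero>\<^bsub>H\<^esub>" using H.ip_self_zero[OF \<alpha>_closed[OF d x]] by blast
  then show "a x = a' x" using GH.Ops_diff_apply[OF \<alpha>_ops[OF a] \<alpha>_ops[OF a'] x] H.diff_zero_eq[OF \<alpha>_closed[OF a x] \<alpha>_closed[OF a' x]] by simp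
qed

text \<open>The element of \<open>\<alpha>\<close> that sends \<open>\<zeta>\<close> to \<open>h\<close>; this identifies \<open>H\<close> with \<open>\<alpha>\<close>.\<close>

definition elt :: "'h \<Rightarrow> 'g \<Rightarrow> 'h" where "elt h = (THE a. a \<in> \<alpha> \<and> a \<zeta> = h)"

lemma elt_eval: "a \<in> \<alpha> \<Longrightarrow> elt (a \<zeta>) = a"
  unfolding elt_def by (rule the_equality) (auto intro: elt_unique)

lemma elt: assumes "h \<in> carrier H" shows "elt h \<in> \<alpha>" "elt h \<zeta> = h"
  using ex_elt[OF assms] elt_eval by auto

lemma elt_add: "h \<in> carrier H \<Longrightarrow> h' \<in> carrier H \<Longrightarrow> elt (h \<oplus>\<^bsub>H\<^esub> h') = elt h \<oplus>\<^bsub>Ops G H\<^esub> elt h'"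
  using elt_eval[of "elt h \<oplus>\<^bsub>Ops G H\<^esub> elt h'"] GH.O.submoduleD(3)[OF \<alpha>_sub] elt \<zeta> by simp

lemma elt_smult: "h \<in> carrier H \<Longrightarrow> elt (k \<odot>\<^bsub>H\<^esub> h) = k \<odot>\<^bsub>Ops G H\<^esub> elt h"
  using elt_eval[of "k \<odot>\<^bsub>Ops G H\<^esub> elt h"] GH.O.submoduleD(4)[OF \<alpha>_sub] elt \<zeta> by simp

lemma elt_compose: assumes "a \<in> \<alpha>" "b \<in> B" shows "elt (a (b \<zeta>)) = compose (carrier G) a b"
  using elt_eval[OF \<alpha>B[OF assms]] \<zeta> by (simp add: compose_eq)

abbreviation "rep \<equiv> fact_rep H G \<alpha>"

lemma rep:
  assumes c: "c \<in> Bd"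
  shows rep_ops: "rep c \<in> carrier (Ops H H)"
    and rep_apply: "a \<in> \<alpha> \<Longrightarrow> \<omega> \<in> carrier G \<Longrightarrow> rep c (a \<omega>) = a (c \<omega>)"
proof -
  let ?T = "\<lambda>h\<in>carrier H. elt h (c \<zeta>)"
  have cz: "c \<zeta> \<in> carrier G" using OpsD(2)[OF Bd_ops[OF c] \<zeta>] .
  have T: "?T \<in> carrier (Ops H H)"
    by (rule HH.restrict_OpsI) (use cz \<alpha>_closed elt(1) in \<open>auto simp: elt_add elt_smult\<close>)
  have Ta: "?T (a \<omega>) = a (c \<omega>)" if a: "a \<in> \<alpha>" and w: "\<omega> \<in> carrier G" for a \<omega>
  proof -
    obtain b where b: "b \<in> B" "b \<zeta> = \<omega>" using cyc[OF w] by auto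
    have "?T (a \<omega>) = compose (carrier G) a b (c \<zeta>)" using elt_compose[OF a b(1)] b(2) \<alpha>_closed[OF a w] by simp
    also have "... = a (c \<omega>)" using cz BBd[OF b(1) c \<zeta>] b(2) by (simp add: compose_eq)
    finally show ?thesis .
  qed
  have sub: "{a \<omega> |a \<omega>. a \<in> \<alpha> \<and> \<omega> \<in> carrier G} \<subseteq> carrier H" using \<alpha>_closed by auto
  have e: "rep c = ?T"
    unfolding fact_rep_def
  proof (rule the_equality)
    show "?T \<in> carrier (Lalg H) \<and> (\<forall>\<xi>\<in>\<alpha>. \<forall>\<omega>\<in>carrier G. ?T (\<xi> \<omega>) = \<xi> (c \<omega>))" using T Ta by simp
    fix S assume "S \<in> carrier (Lalg H) \<and> (\<forall>\<xi>\<in>\<alpha>. \<forall>\<omega>\<in>carrier G. S (\<xi> \<omega>) = \<xi> (c \<omega>))"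
    then have S: "S \<in> carrier (Ops H H)" "\<And>a \<omega>. a \<in> \<alpha> \<Longrightarrow> \<omega> \<in> carrier G \<Longrightarrow> S (a \<omega>) = a (c \<omega>)" by auto
    show "S = ?T"
    proof (rule HH.Ops_eq_on_span[OF S(1) T sub \<alpha>G])
      fix y assume "y \<in> {a \<omega> |a \<omega>. a \<in> \<alpha> \<and> \<omega> \<in> carrier G}"
      then obtain a \<omega> where y: "y = a \<omega>" and a: "a \<in> \<alpha>" and w: "\<omega> \<in> carrier G" by auto
      show "S y = ?T y" unfolding y S(2)[OF a w] Ta[OF a w] ..
    qed
  qed
  show "rep c \<in> carrier (Ops H H)" unfolding e by (rule T)
  show "rep c (a \<omega>) = a (c \<omega>)" if "a \<in> \<alpha>" "\<omega> \<in> carrier G" unfolding e using Ta that by blast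
qed

lemma rep_elt: "c \<in> Bd \<Longrightarrow> h \<in> carrier H \<Longrightarrow> rep c h = elt h (c \<zeta>)"
  using rep_apply[of c "elt h" \<zeta>] elt \<zeta> by simp

lemma adj_rep:
  assumes a: "a \<in> \<alpha>" and c: "c \<in> Bd" and h: "h \<in> carrier H"
  shows "adj G H a (rep c h) = c (adj G H a h)"
  using rep_elt[OF c h] \<alpha>\<alpha>Bd[OF a elt(1)[OF h] c \<zeta>] elt(2)[OF h] by simp

text \<open>Operators that commute with the representation of \<open>Bd\<close> act on \<open>\<alpha>\<close> from the left.\<close>

lemma intertwiner:
  assumes s: "s \<in> carrier (Ops H H)" and i: "\<And>c h. c \<in> Bd \<Longrightarrow> h \<in> carrier H \<Longrightarrow> s (rep c h) = rep c (s h)" and a: "a \<in> \<alpha>"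
  shows "compose (carrier G) s a \<in> \<alpha>" "elt (s (a \<zeta>)) = compose (carrier G) s a"
proof -
  have sa: "s (a \<zeta>) \<in> carrier H" using OpsD(2)[OF s \<alpha>_closed[OF a \<zeta>]] .
  have cc: "compose (carrier G) s a \<in> carrier (Ops G H)"
    using compose_Ops[OF G.fd_space_axioms H.fd_space_axioms H.fd_space_axioms \<alpha>_ops[OF a] s] .
  show "elt (s (a \<zeta>)) = compose (carrier G) s a"
  proof (rule Ops_eqI[OF \<alpha>_ops[OF elt(1)[OF sa]] cc])
    fix x assume x: "x \<in> carrier G"
    obtain c where c: "c \<in> Bd" "c \<zeta> = x" using cycd[OF x] by auto
    have "elt (s (a \<zeta>)) x = rep c (s (a \<zeta>))" using rep_elt[OF c(1) sa] c(2) by simp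
    also have "... = s (a x)" using i[OF c(1) \<alpha>_closed[OF a \<zeta>]] rep_apply[OF c(1) a \<zeta>] c(2) by simp
    finally show "elt (s (a \<zeta>)) x = compose (carrier G) s a x" using x by (simp add: compose_eq)
  qed
  then show "compose (carrier G) s a \<in> \<alpha>" using elt(1)[OF sa] by simp
qed

text \<open>
  The frame operator \<open>\<Sum>\<^sub>f w\<^sub>f w\<^sub>f*\<close>, where \<open>w\<^sub>f = elt f\<close> for the basis vectors \<open>f\<close> of \<open>H\<close>. It is
  positive, injective and commutes with the representation of \<open>Bd\<close>.
\<close>

definition frame :: "'h \<Rightarrow> 'h" where
  "frame = (\<lambda>h\<in>carrier H. finsum H (\<lambda>f. elt f (adj G H (elt f) h)) H.basis)"

lemma frame_apply: "h \<in> carrier H \<Longrightarrow> frame h = finsum H (\<lambda>f. elt f (adj G H (elt f) h)) H.basis"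
  by (simp add: frame_def)

lemma bf: "f \<in> H.basis \<Longrightarrow> elt f \<in> \<alpha>" by (simp add: elt)

lemma frame_term: "h \<in> carrier H \<Longrightarrow> f \<in> H.basis \<Longrightarrow> elt f (adj G H (elt f) h) \<in> carrier H"
  using \<alpha>_closed[OF bf] \<alpha>adj_closed[OF bf] by blast

lemma frame_closed: "h \<in> carrier H \<Longrightarrow> frame h \<in> carrier H"
  unfolding frame_apply by (rule H.finsum_closed) (use frame_term in auto)

lemma ip_frame: "h \<in> carrier H \<Longrightarrow> x \<in> carrier H \<Longrightarrow> ip H x (frame h) = (\<Sum>f\<in>H.basis. ip G (adj G H (elt f) x) (adj G H (elt f) h))"
  unfolding frame_apply
  by (subst H.ip_finsum_right)
     (auto intro!: sum.cong simp: frame_term GH.adj_ip2[OF \<alpha>_ops[OF bf]] \<alpha>adj_closed[OF bf])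

lemma ip_frame_left: assumes "h \<in> carrier H" "x \<in> carrier H" shows "ip H (frame h) x = ip H h (frame x)"
proof -
  have "ip H (frame h) x = cnj (ip H x (frame h))" using H.ip_commute frame_closed assms by blast
  also have "... = ip H h (frame x)" using assms
    by (simp add: ip_frame G.ip_commute[of "adj G H _ x"] \<alpha>adj_closed[OF bf])
  finally show ?thesis .
qed

lemma frame_ops: "frame \<in> carrier (Ops H H)"
proof (rule HH.OpsI)
  show "frame \<in> carrier H \<rightarrow>\<^sub>E carrier H" using frame_closed by (auto simp: frame_def)
next
  fix x y assume xy: "x \<in> carrier H" "y \<in> carrier H"
  show "frame (x \<oplus>\<^bsub>H\<^esub> y) = frame x \<oplus>\<^bsub>H\<^esub> frame y"
    by (rule H.ip_eqI)
       (use xy in \<open>simp_all add: ip_frame H.ip_add_right frame_closed OpsD(3)[OF \<alpha>adj[OF bf]] \<alpha>adj_closed[OF bf] G.ip_add_right sum.distrib\<close>)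
next
  fix c x assume x: "x \<in> carrier H"
  show "frame (c \<odot>\<^bsub>H\<^esub> x) = c \<odot>\<^bsub>H\<^esub> frame x"
    by (rule H.ip_eqI)
       (use x in \<open>simp_all add: ip_frame H.ip_smult_right frame_closed OpsD(4)[OF \<alpha>adj[OF bf]] \<alpha>adj_closed[OF bf] G.ip_smult_right sum_distrib_left\<close>)
qed

lemma frame_pos: "h \<in> carrier H \<Longrightarrow> 0 \<le> Re (ip H h (frame h))"
  by (auto simp: ip_frame G.ip_self \<alpha>adj_closed[OF bf] simp flip: of_real_power intro!: sum_nonneg)

lemma frame_inj:
  assumes h: "h \<in> carrier H" and z: "frame h = \<zero>\<^bsub>H\<^esub>" shows "h = \<zero>\<^bsub>H\<^esub>"
proof -
  have "(\<Sum>f\<in>H.basis. (nrm G (adj G H (elt f) h))\<^sup>2) = Re (ip H h (frame h))"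
    using h by (simp add: ip_frame G.ip_self \<alpha>adj_closed[OF bf] flip: of_real_power)
  also have "... = 0" using z h by simp
  finally have "nrm G (adj G H (elt f) h) = 0" if "f \<in> H.basis" for f
    using that sum_nonneg_eq_0_iff[of H.basis "\<lambda>f. (nrm G (adj G H (elt f) h))\<^sup>2"] by simp
  then have a0: "adj G H (elt f) h = \<zero>\<^bsub>G\<^esub>" if "f \<in> H.basis" for f
    using that G.nrm_eq_0[OF \<alpha>adj_closed[OF bf[OF that] h]] by simp
  have f0: "ip H f h = 0" if f: "f \<in> H.basis" for f
    using GH.adj_ip[OF \<alpha>_ops[OF bf[OF f]] \<zeta> h] a0[OF f] elt(2)[of f] f \<zeta> by simp
  have "ip H h h = (\<Sum>e\<in>H.basis. ip H e h * ip H h e)" using H.parseval[OF h h] by simp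
  also have "... = 0" using f0 by simp
  finally show ?thesis using H.ip_self_zero[OF h] by blast
qed

lemma frame_rep:
  assumes c: "c \<in> Bd" and h: "h \<in> carrier H" shows "rep c (frame h) = frame (rep c h)"
proof -
  have rh: "rep c h \<in> carrier H" using OpsD(2)[OF rep_ops[OF c] h] .
  have "rep c (frame h) = finsum H (\<lambda>f. rep c (elt f (adj G H (elt f) h))) H.basis"
    unfolding frame_apply[OF h] by (rule HH.Ops_finsum[OF rep_ops[OF c]]) (use frame_term[OF h] in auto)
  also have "... = frame (rep c h)" unfolding frame_apply[OF rh]
    by (intro H.M.add.finprod_cong' refl)
       (use rh h frame_term c in \<open>auto simp: rep_apply[OF c bf] \<alpha>adj_closed[OF bf] adj_rep[OF bf c]\<close>)
  finally show ?thesis .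
qed

end

section \<open>The relative tensor product over a C*-base\<close>

text \<open>
  The two C*-factorizations; in the second one \<open>B\<close> and \<open>Bd\<close> change places. Everything about \<open>K\<close> is
  obtained from the locale \<open>factor\<close> with prefix \<open>E\<close>, everything about \<open>H\<close> with prefix \<open>A\<close>.
\<close>

locale two_factors = A: factor G B Bd \<zeta> H \<alpha> + E: factor G Bd B \<zeta> K \<beta>
  for G :: "('g, 'm) hilb_scheme" and B Bd \<zeta> and H :: "('h, 'n) hilb_scheme" and \<alpha>
  and K :: "('k, 'p) hilb_scheme" and \<beta>
begin

text \<open>The elements \<open>a*a'\<close> of \<open>B\<close> and \<open>e*e'\<close> of \<open>Bd\<close>.\<close>

abbreviation "bb a a' \<equiv> compose (carrier G) (adj G H a) a'"
abbreviation "cc e e' \<equiv> compose (carrier G) (adj G K e) e'"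

lemma aa_closed: "a \<in> \<alpha> \<Longrightarrow> a' \<in> \<alpha> \<Longrightarrow> x \<in> carrier G \<Longrightarrow> adj G H a (a' x) \<in> carrier G"
  using A.\<alpha>adj_closed A.\<alpha>_closed by blast
lemma ee_closed: "e \<in> \<beta> \<Longrightarrow> e' \<in> \<beta> \<Longrightarrow> x \<in> carrier G \<Longrightarrow> adj G K e (e' x) \<in> carrier G"
  using E.\<alpha>adj_closed E.\<alpha>_closed by blast

lemma commute4:
  assumes "a \<in> \<alpha>" "a' \<in> \<alpha>" "e \<in> \<beta>" "e' \<in> \<beta>" "x \<in> carrier G"
  shows "adj G H a (a' (adj G K e (e' x))) = adj G K e (e' (adj G H a (a' x)))"
  using A.\<alpha>\<alpha>Bd[OF assms(1,2) E.\<alpha>\<alpha>[OF assms(3,4)] assms(5)] assms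
  by (simp add: compose_eq aa_closed)

lemma form_herm:
  assumes a: "a \<in> \<alpha>" "a' \<in> \<alpha>" and e: "e \<in> \<beta>" "e' \<in> \<beta>" and x: "x \<in> carrier G" "x' \<in> carrier G"
  shows "ip G x' (adj G H a' (a (adj G K e' (e x)))) = cnj (ip G x (adj G H a (a' (adj G K e (e' x')))))"
proof -
  have c: "adj G K e' (e x) \<in> carrier G" "adj G H a (a' x') \<in> carrier G" using a e x aa_closed ee_closed by auto
  have "ip G x' (adj G H a' (a (adj G K e' (e x)))) = ip H (a' x') (a (adj G K e' (e x)))"
    using A.GH.adj_ip[OF A.\<alpha>_ops[OF a(2)] x(2) A.\<alpha>_closed[OF a(1) c(1)]] by simp
  also have "... = ip G (adj G H a (a' x')) (adj G K e' (e x))"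
    using A.GH.adj_ip2[OF A.\<alpha>_ops[OF a(1)] c(1) A.\<alpha>_closed[OF a(2) x(2)]] .
  also have "... = ip K (e' (adj G H a (a' x'))) (e x)"
    using E.GH.adj_ip[OF E.\<alpha>_ops[OF e(2)] c(2) E.\<alpha>_closed[OF e(1) x(1)]] by simp
  also have "... = ip G (adj G K e (e' (adj G H a (a' x')))) x"
    using E.GH.adj_ip2[OF E.\<alpha>_ops[OF e(1)] x(1) E.\<alpha>_closed[OF e(2) c(2)]] .
  also have "... = cnj (ip G x (adj G K e (e' (adj G H a (a' x')))))"
    using A.G.ip_commute[OF x(1) ee_closed[OF e c(2)]] .
  finally show ?thesis using commute4[OF a e x(2)] by simp
qed

lemma form_H:
  assumes a: "a \<in> \<alpha>" "a' \<in> \<alpha>" and e: "e \<in> \<beta>" "e' \<in> \<beta>" and x: "x \<in> carrier G" "x' \<in> carrier G"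
  shows "ip G x (adj G H a (a' (adj G K e (e' x')))) = ip H (a x) (A.rep (cc e e') (a' x'))"
  using A.rep_apply[OF E.\<alpha>\<alpha>[OF e] a(2) x(2)] A.GH.adj_ip[OF A.\<alpha>_ops[OF a(1)] x(1) A.\<alpha>_closed[OF a(2) ee_closed[OF e x(2)]]] x(2)
  by (simp add: compose_eq)

lemma form_K:
  assumes a: "a \<in> \<alpha>" "a' \<in> \<alpha>" and e: "e \<in> \<beta>" "e' \<in> \<beta>" and x: "x \<in> carrier G" "x' \<in> carrier G"
  shows "ip G x (adj G H a (a' (adj G K e (e' x')))) = ip K (e x) (E.rep (bb a a') (e' x'))"
  using E.rep_apply[OF A.\<alpha>\<alpha>[OF a] e(2) x(2)] E.GH.adj_ip[OF E.\<alpha>_ops[OF e(1)] x(1) E.\<alpha>_closed[OF e(2) aa_closed[OF a x(2)]]] x(2)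
  by (simp add: compose_eq commute4[OF a e x(2)])

abbreviation "X \<equiv> \<alpha> \<times> carrier G \<times> \<beta>"
abbreviation "\<phi> \<equiv> cst_form H G K"

lemma cst_form_apply: "\<phi> (a, x, e) (a', x', e') = ip G x (adj G H a (a' (adj G K e (e' x'))))"
  by (simp add: cst_form_def)

text \<open>
  Since \<open>w\<^sub>f*\<close> intertwines the representation of \<open>Bd\<close>, the sum is
  \<open>\<Sum>\<^sub>f \<Parallel>\<Sum>\<^sub>j e\<^sub>j w\<^sub>f* y\<^sub>j\<Parallel>\<^sup>2\<close>.
\<close>

lemma frame_kernel_psd:
  assumes J: "finite J" and e: "\<And>j. j \<in> J \<Longrightarrow> e j \<in> \<beta>" and y: "\<And>j. j \<in> J \<Longrightarrow> y j \<in> carrier H"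
  shows "0 \<le> Re (\<Sum>i\<in>J. \<Sum>j\<in>J. ip H (y i) (A.rep (cc (e i) (e j)) (A.frame (y j))))"
proof -
  let ?w = "\<lambda>f j. adj G H (A.elt f) (y j)"
  have wc: "?w f j \<in> carrier G" if "f \<in> A.H.basis" "j \<in> J" for f j using A.\<alpha>adj_closed[OF A.bf[OF that(1)] y[OF that(2)]] .
  have ec: "e j (?w f j) \<in> carrier K" if "f \<in> A.H.basis" "j \<in> J" for f j using E.\<alpha>_closed[OF e[OF that(2)] wc[OF that]] .
  have "(\<Sum>i\<in>J. \<Sum>j\<in>J. ip H (y i) (A.rep (cc (e i) (e j)) (A.frame (y j))))
    = (\<Sum>i\<in>J. \<Sum>j\<in>J. \<Sum>f\<in>A.H.basis. ip K (e i (?w f i)) (e j (?w f j)))"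
  proof (intro sum.cong refl)
    fix i j assume i: "i \<in> J" and j: "j \<in> J"
    note c = E.\<alpha>\<alpha>[OF e[OF i] e[OF j]]
    have rc: "A.rep (cc (e i) (e j)) (y j) \<in> carrier H" using OpsD(2)[OF A.rep_ops[OF c] y[OF j]] .
    have "ip H (y i) (A.rep (cc (e i) (e j)) (A.frame (y j))) = ip H (y i) (A.frame (A.rep (cc (e i) (e j)) (y j)))"
      using A.frame_rep[OF c y[OF j]] by simp
    also have "... = (\<Sum>f\<in>A.H.basis. ip G (?w f i) (adj G H (A.elt f) (A.rep (cc (e i) (e j)) (y j))))"
      using A.ip_frame[OF rc y[OF i]] .
    also have "... = (\<Sum>f\<in>A.H.basis. ip K (e i (?w f i)) (e j (?w f j)))"
    proof (intro sum.cong refl)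
      fix f assume f: "f \<in> A.H.basis"
      have "adj G H (A.elt f) (A.rep (cc (e i) (e j)) (y j)) = adj G K (e i) (e j (?w f j))"
        using A.adj_rep[OF A.bf[OF f] c y[OF j]] wc[OF f j] by (simp add: compose_eq)
      then show "ip G (?w f i) (adj G H (A.elt f) (A.rep (cc (e i) (e j)) (y j))) = ip K (e i (?w f i)) (e j (?w f j))"
        using E.GH.adj_ip[OF E.\<alpha>_ops[OF e[OF i]] wc[OF f i] ec[OF f j]] by simp
    qed
    finally show "ip H (y i) (A.rep (cc (e i) (e j)) (A.frame (y j))) = (\<Sum>f\<in>A.H.basis. ip K (e i (?w f i)) (e j (?w f j)))" .
  qed
  also have "... = (\<Sum>i\<in>J. \<Sum>f\<in>A.H.basis. \<Sum>j\<in>J. ip K (e i (?w f i)) (e j (?w f j)))"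
    by (intro sum.cong refl sum.swap)
  also have "... = (\<Sum>f\<in>A.H.basis. \<Sum>i\<in>J. \<Sum>j\<in>J. ip K (e i (?w f i)) (e j (?w f j)))" by (rule sum.swap)
  also have "... = (\<Sum>f\<in>A.H.basis. ip K (finsum K (\<lambda>j. e j (?w f j)) J) (finsum K (\<lambda>j. e j (?w f j)) J))"
  proof (intro sum.cong refl)
    fix f assume f: "f \<in> A.H.basis"
    have fc: "finsum K (\<lambda>j. e j (?w f j)) J \<in> carrier K" by (rule E.H.finsum_closed) (use ec[OF f] in auto)
    show "(\<Sum>i\<in>J. \<Sum>j\<in>J. ip K (e i (?w f i)) (e j (?w f j))) = ip K (finsum K (\<lambda>j. e j (?w f j)) J) (finsum K (\<lambda>j. e j (?w f j)) J)"
      using E.H.ip_finsum_left[OF J ec[OF f] fc] E.H.ip_finsum_right[OF J ec[OF f] ec[OF f]] by simp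
  qed
  finally have eq: "(\<Sum>i\<in>J. \<Sum>j\<in>J. ip H (y i) (A.rep (cc (e i) (e j)) (A.frame (y j)))) =
    (\<Sum>f\<in>A.H.basis. ip K (finsum K (\<lambda>j. e j (?w f j)) J) (finsum K (\<lambda>j. e j (?w f j)) J))" .
  have "0 \<le> Re (ip K (finsum K (\<lambda>j. e j (?w f j)) J) (finsum K (\<lambda>j. e j (?w f j)) J))" if f: "f \<in> A.H.basis" for f
  proof -
    have fc: "finsum K (\<lambda>j. e j (?w f j)) J \<in> carrier K" by (rule E.H.finsum_closed) (use ec[OF f] in auto)
    show ?thesis using E.H.ip_self[OF fc] by (simp flip: of_real_power)
  qed
  then show ?thesis unfolding eq Re_sum by (intro sum_nonneg)
qed

text \<open>
  The vectors \<open>a \<omega>\<close> are in the range of the frame operator, so positivity of the kernel with the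
  frame operator inserted gives positivity of the kernel itself.
\<close>

lemma pos_form_cst: "pos_form X \<phi>"
proof
  fix x y assume "x \<in> X" "y \<in> X"
  then obtain a \<omega> e a' \<omega>' e' where x: "x = (a, \<omega>, e)" "a \<in> \<alpha>" "\<omega> \<in> carrier G" "e \<in> \<beta>"
    and y: "y = (a', \<omega>', e')" "a' \<in> \<alpha>" "\<omega>' \<in> carrier G" "e' \<in> \<beta>" by auto
  show "\<phi> y x = cnj (\<phi> x y)"
    unfolding x(1) y(1) cst_form_apply using form_herm[OF x(2) y(2) x(4) y(4) x(3) y(3)] .
next
  fix u :: "('g \<Rightarrow> 'h) \<times> 'g \<times> ('g \<Rightarrow> 'k) \<Rightarrow>\<^sub>0 complex" assume u: "Poly_Mapping.keys u \<subseteq> X"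
  let ?J = "Poly_Mapping.keys u"
  let ?a = "\<lambda>j. fst j :: 'g \<Rightarrow> 'h" and ?x = "\<lambda>j. fst (snd j) :: 'g" and ?e = "\<lambda>j. snd (snd j) :: 'g \<Rightarrow> 'k"
  have a: "?a j \<in> \<alpha>" and x: "?x j \<in> carrier G" and e: "?e j \<in> \<beta>" if "j \<in> ?J" for j using u that by auto
  let ?C = "\<lambda>i j. A.rep (cc (?e i) (?e j))"
  have cB: "cc (?e i) (?e j) \<in> Bd" if "i \<in> ?J" "j \<in> ?J" for i j using E.\<alpha>\<alpha>[OF e[OF that(1)] e[OF that(2)]] .
  define z where "z j = Poly_Mapping.lookup u j \<odot>\<^bsub>H\<^esub> ?a j (?x j)" for j
  have zc: "z j \<in> carrier H" if "j \<in> ?J" for j unfolding z_def using A.\<alpha>_closed[OF a x] that by simp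
  have "\<exists>y\<in>carrier H. A.frame y = z j" if j: "j \<in> ?J" for j
    by (rule A.H.selfadj_surj[OF A.frame_ops A.ip_frame_left A.frame_inj zc[OF j]])
  then obtain y where y: "\<And>j. j \<in> ?J \<Longrightarrow> y j \<in> carrier H" "\<And>j. j \<in> ?J \<Longrightarrow> A.frame (y j) = z j" by metis
  have "sesq \<phi> u u = (\<Sum>i\<in>?J. \<Sum>j\<in>?J. ip H (z i) (?C i j (z j)))"
    unfolding sesq_def
  proof (intro sum.cong refl)
    fix i j assume i: "i \<in> ?J" and j: "j \<in> ?J"
    have "\<phi> i j = ip H (?a i (?x i)) (?C i j (?a j (?x j)))"
      using cst_form_apply[of "?a i" "?x i" "?e i" "?a j" "?x j" "?e j"] form_H[OF a[OF i] a[OF j] e[OF i] e[OF j] x[OF i] x[OF j]] by simp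
    then show "cnj (Poly_Mapping.lookup u i) * Poly_Mapping.lookup u j * \<phi> i j = ip H (z i) (?C i j (z j))"
      unfolding z_def using A.\<alpha>_closed[OF a x] i j OpsD(4)[OF A.rep_ops[OF cB[OF i j]]] OpsD(2)[OF A.rep_ops[OF cB[OF i j]]]
      by (simp add: A.H.ip_smult_left A.H.ip_smult_right del: in_keys_iff)
  qed
  also have "... = (\<Sum>i\<in>?J. \<Sum>j\<in>?J. ip H (A.frame (y i)) (?C i j (A.frame (y j))))"
    by (intro sum.cong refl) (simp add: y(2) del: in_keys_iff)
  finally have eq: "sesq \<phi> u u = (\<Sum>i\<in>?J. \<Sum>j\<in>?J. ip H (A.frame (y i)) (?C i j (A.frame (y j))))" .
  show "0 \<le> Re (sesq \<phi> u u)"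
    unfolding eq
  proof (rule A.H.positive_product[OF A.frame_ops A.ip_frame_left A.frame_pos])
    show "\<And>i j. i \<in> ?J \<Longrightarrow> j \<in> ?J \<Longrightarrow> ?C i j \<in> carrier (Ops H H)" using A.rep_ops cB by blast
    show "\<And>i j x. i \<in> ?J \<Longrightarrow> j \<in> ?J \<Longrightarrow> x \<in> carrier H \<Longrightarrow> ?C i j (A.frame x) = A.frame (?C i j x)"
      using A.frame_rep cB by blast
    show "\<And>y. (\<And>j. j \<in> ?J \<Longrightarrow> y j \<in> carrier H) \<Longrightarrow> 0 \<le> Re (\<Sum>i\<in>?J. \<Sum>j\<in>?J. ip H (y i) (?C i j (A.frame (y j))))"
      by (rule frame_kernel_psd) (use e in auto)
  qed (use y in auto)
qed

sublocale P: pos_form X \<phi> by (rule pos_form_cst)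

text \<open>\<open>W\<close> is the C*-relative tensor product and \<open>el a x e\<close> its elementary tensor \<open>a \<otimes> x \<otimes> e\<close>.\<close>

abbreviation "W \<equiv> cst_tensor H \<alpha> G K \<beta>"
abbreviation "el \<equiv> cst_elem H \<alpha> G K \<beta>"

lemma W_eq: "sep_space X \<phi> = W" by (simp add: cst_tensor_def)

lemma el_class: "sep_class X \<phi> (a, x, e) = el a x e" by (simp add: cst_elem_def)

sublocale W: ip_space W using P.ip_space_sep W_eq by simp

lemma el_closed: "a \<in> \<alpha> \<Longrightarrow> x \<in> carrier G \<Longrightarrow> e \<in> \<beta> \<Longrightarrow> el a x e \<in> carrier W"
  using P.class_closed[of "(a, x, e)"] by (simp add: W_eq el_class)

lemma ip_el:
  assumes "a \<in> \<alpha>" "a' \<in> \<alpha>" "e \<in> \<beta>" "e' \<in> \<beta>" "x \<in> carrier G" "x' \<in> carrier G"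
  shows "ip W (el a x e) (el a' x' e') = ip G x (adj G H a (a' (adj G K e (e' x'))))"
  using P.ip_class[of "(a, x, e)" "(a', x', e')"] assms by (simp add: W_eq el_class cst_form_apply)

lemma el_image: "(\<lambda>(a, x, e). el a x e) ` X = sep_class X \<phi> ` X"
  by (intro image_cong refl) (auto simp: el_class)

lemma el_span: "lspan W ((\<lambda>(a, x, e). el a x e) ` X) = carrier W"
  unfolding el_image using P.class_span by (simp add: W_eq)

lemma el_eqI:
  assumes "P \<in> carrier W" "Q \<in> carrier W"
    "\<And>a x e. a \<in> \<alpha> \<Longrightarrow> x \<in> carrier G \<Longrightarrow> e \<in> \<beta> \<Longrightarrow> ip W (el a x e) P = ip W (el a x e) Q"
  shows "P = Q"
  by (rule P.class_eqI) (use assms in \<open>auto simp: W_eq el_class\<close>)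

lemma el_move_left:
  assumes "a \<in> \<alpha>" "x \<in> carrier G" "e \<in> \<beta>" "b \<in> B"
  shows "el a (b x) e = el (compose (carrier G) a b) x e"
proof -
  have b: "b x \<in> carrier G" using OpsD(2)[OF A.B_ops] assms by blast
  have ab: "compose (carrier G) a b \<in> \<alpha>" using A.\<alpha>B assms by blast
  show ?thesis
  proof (rule el_eqI)
    fix a' x' e' assume h: "a' \<in> \<alpha>" "x' \<in> carrier G" "e' \<in> \<beta>"
    have "adj G K e' (e (b x)) = b (adj G K e' (e x))" using E.\<alpha>\<alpha>Bd[OF h(3) assms(3,4,2)] .
    then show "ip W (el a' x' e') (el a (b x) e) = ip W (el a' x' e') (el (compose (carrier G) a b) x e)"
      using assms b ab h ee_closed by (simp add: ip_el compose_eq)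
  qed (use assms b ab el_closed in auto)
qed

lemma el_move_right:
  assumes "a \<in> \<alpha>" "x \<in> carrier G" "e \<in> \<beta>" "c \<in> Bd"
  shows "el a (c x) e = el a x (compose (carrier G) e c)"
proof -
  have b: "c x \<in> carrier G" using OpsD(2)[OF A.Bd_ops] assms by blast
  have ab: "compose (carrier G) e c \<in> \<beta>" using E.\<alpha>B assms by blast
  show ?thesis
    by (rule el_eqI) (use assms b ab el_closed in \<open>auto simp: ip_el compose_eq\<close>)
qed

lemma el_add_left: "a \<in> \<alpha> \<Longrightarrow> a' \<in> \<alpha> \<Longrightarrow> x \<in> carrier G \<Longrightarrow> e \<in> \<beta> \<Longrightarrow> el (a \<oplus>\<^bsub>Ops G H\<^esub> a') x e = el a x e \<oplus>\<^bsub>W\<^esub> el a' x e"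
  by (rule el_eqI)
     (auto simp: ip_el W.ip_add_right el_closed A.GH.O.submoduleD(3)[OF A.\<alpha>_sub] ee_closed OpsD(3)[OF A.\<alpha>adj]
        A.\<alpha>_closed A.\<alpha>adj_closed A.G.ip_add_right)

lemma el_smult_left: "a \<in> \<alpha> \<Longrightarrow> x \<in> carrier G \<Longrightarrow> e \<in> \<beta> \<Longrightarrow> el (k \<odot>\<^bsub>Ops G H\<^esub> a) x e = k \<odot>\<^bsub>W\<^esub> el a x e"
  by (rule el_eqI)
     (auto simp: ip_el W.ip_smult_right el_closed A.GH.O.submoduleD(4)[OF A.\<alpha>_sub] ee_closed OpsD(4)[OF A.\<alpha>adj]
        A.\<alpha>_closed A.\<alpha>adj_closed A.G.ip_smult_right)

lemma el_add_right: "a \<in> \<alpha> \<Longrightarrow> x \<in> carrier G \<Longrightarrow> e \<in> \<beta> \<Longrightarrow> e' \<in> \<beta> \<Longrightarrow> el a x (e \<oplus>\<^bsub>Ops G K\<^esub> e') = el a x e \<oplus>\<^bsub>W\<^esub> el a x e'"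
  by (rule el_eqI)
     (auto simp: ip_el W.ip_add_right el_closed E.GH.O.submoduleD(3)[OF E.\<alpha>_sub] ee_closed OpsD(3)[OF E.\<alpha>adj] OpsD(3)[OF A.\<alpha>adj]
        OpsD(3)[OF A.\<alpha>_ops] E.\<alpha>_closed A.\<alpha>_closed A.\<alpha>adj_closed E.\<alpha>adj_closed A.G.ip_add_right)

lemma el_smult_right: "a \<in> \<alpha> \<Longrightarrow> x \<in> carrier G \<Longrightarrow> e \<in> \<beta> \<Longrightarrow> el a x (k \<odot>\<^bsub>Ops G K\<^esub> e) = k \<odot>\<^bsub>W\<^esub> el a x e"
  by (rule el_eqI)
     (auto simp: ip_el W.ip_smult_right el_closed E.GH.O.submoduleD(4)[OF E.\<alpha>_sub] ee_closed OpsD(4)[OF E.\<alpha>adj] OpsD(4)[OF A.\<alpha>adj]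
        OpsD(4)[OF A.\<alpha>_ops] E.\<alpha>_closed A.\<alpha>_closed A.\<alpha>adj_closed E.\<alpha>adj_closed A.G.ip_smult_right)

text \<open>The bilinear map \<open>(a \<zeta>, e \<zeta>) \<mapsto> a \<otimes> \<zeta> \<otimes> e\<close>. Its values are all the elementary tensors.\<close>

definition vec :: "'h \<Rightarrow> 'k \<Rightarrow> (('g \<Rightarrow> 'h) \<times> 'g \<times> ('g \<Rightarrow> 'k) \<Rightarrow>\<^sub>0 complex) set" where
  "vec h k = el (A.elt h) \<zeta> (E.elt k)"

lemma vec_closed: "h \<in> carrier H \<Longrightarrow> k \<in> carrier K \<Longrightarrow> vec h k \<in> carrier W"
  unfolding vec_def using el_closed A.elt(1) E.elt(1) A.\<zeta> by blast

lemma el_vec: assumes "a \<in> \<alpha>" "x \<in> carrier G" "e \<in> \<beta>" shows "el a x e = vec (a x) (e \<zeta>)"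
proof -
  obtain b where b: "b \<in> B" "b \<zeta> = x" using A.cyc[OF assms(2)] by auto
  have "el a x e = el (compose (carrier G) a b) \<zeta> e" using el_move_left[OF assms(1) A.\<zeta> assms(3) b(1)] b(2) by simp
  also have "... = vec (a x) (e \<zeta>)"
    unfolding vec_def using A.elt_compose[OF assms(1) b(1)] b(2) E.elt_eval[OF assms(3)] by simp
  finally show ?thesis .
qed

lemma vec_span: "lspan W {vec h k |h k. h \<in> carrier H \<and> k \<in> carrier K} = carrier W"
proof
  have c: "{vec h k |h k. h \<in> carrier H \<and> k \<in> carrier K} \<subseteq> carrier W" using vec_closed by auto
  then show "lspan W {vec h k |h k. h \<in> carrier H \<and> k \<in> carrier K} \<subseteq> carrier W" by (rule W.lspan_carrier)
  have "(\<lambda>(a, x, e). el a x e) ` X \<subseteq> {vec h k |h k. h \<in> carrier H \<and> k \<in> carrier K}"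
  proof clarify
    fix a x e assume "a \<in> \<alpha>" "x \<in> carrier G" "e \<in> \<beta>"
    then show "\<exists>h k. el a x e = vec h k \<and> h \<in> carrier H \<and> k \<in> carrier K"
      using el_vec A.\<alpha>_closed E.\<alpha>_closed A.\<zeta> by blast
  qed
  also have "... \<subseteq> lspan W {vec h k |h k. h \<in> carrier H \<and> k \<in> carrier K}" by (rule W.lspan_base)
  finally show "carrier W \<subseteq> lspan W {vec h k |h k. h \<in> carrier H \<and> k \<in> carrier K}"
    using W.lspan_least[OF W.lspan_submodule[OF c], of "(\<lambda>(a, x, e). el a x e) ` X"] el_span by simp
qed

lemma fd_space_W: "fd_space W"
  by (rule fin_dim_bilinear[OF A.H.fd_space_axioms E.H.fd_space_axioms W.ip_space_axioms, where w = vec])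
     (auto simp: vec_closed vec_span, auto simp: vec_def A.elt_add A.elt_smult E.elt_add E.elt_smult A.elt(1) E.elt(1) A.\<zeta>
        el_add_left el_add_right el_smult_left el_smult_right)

sublocale W: fd_space W by (rule fd_space_W)
sublocale WW: fd_pair W W ..
sublocale KW: fd_pair K W ..
sublocale HW: fd_pair H W ..

text \<open>The kets are given by \<open>|a\<rangle>\<^sub>[\<^sub>1\<^sub>] (e \<zeta>) = a \<otimes> \<zeta> \<otimes> e\<close> and \<open>|e\<rangle>\<^sub>[\<^sub>2\<^sub>] (a \<zeta>) = a \<otimes> \<zeta> \<otimes> e\<close>.\<close>

lemma ket1:
  assumes a: "a \<in> \<alpha>"
  shows ket1_ops: "ket1 H \<alpha> G K \<beta> a \<in> carrier (Ops K W)"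
    and ket1_el: "e \<in> \<beta> \<Longrightarrow> x \<in> carrier G \<Longrightarrow> ket1 H \<alpha> G K \<beta> a (e x) = el a x e"
proof -
  let ?T = "\<lambda>k\<in>carrier K. el a \<zeta> (E.elt k)"
  have T: "?T \<in> carrier (Ops K W)"
    by (rule KW.restrict_OpsI)
       (use a in \<open>simp_all add: el_closed A.\<zeta> E.elt(1) E.elt_add E.elt_smult el_add_right el_smult_right\<close>)
  have Te: "?T (e x) = el a x e" if e: "e \<in> \<beta>" and x: "x \<in> carrier G" for e x
  proof -
    obtain c where c: "c \<in> Bd" "c \<zeta> = x" using A.cycd[OF x] by auto
    have "?T (e x) = el a \<zeta> (compose (carrier G) e c)" using E.elt_compose[OF e c(1)] c(2) E.\<alpha>_closed[OF e x] by simp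
    also have "... = el a x e" using el_move_right[OF a A.\<zeta> e c(1)] c(2) by simp
    finally show ?thesis .
  qed
  have sub: "{e x |e x. e \<in> \<beta> \<and> x \<in> carrier G} \<subseteq> carrier K" using E.\<alpha>_closed by auto
  have eq: "ket1 H \<alpha> G K \<beta> a = ?T"
    unfolding ket1_def
  proof (rule the_equality)
    show "?T \<in> carrier (Ops K W) \<and> (\<forall>\<eta>\<in>\<beta>. \<forall>\<omega>\<in>carrier G. ?T (\<eta> \<omega>) = el a \<omega> \<eta>)" using T Te by blast
    fix S assume "S \<in> carrier (Ops K W) \<and> (\<forall>\<eta>\<in>\<beta>. \<forall>\<omega>\<in>carrier G. S (\<eta> \<omega>) = el a \<omega> \<eta>)"
    then have S: "S \<in> carrier (Ops K W)" "\<And>e x. e \<in> \<beta> \<Longrightarrow> x \<in> carrier G \<Longrightarrow> S (e x) = el a x e" by auto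
    show "S = ?T"
    proof (rule KW.Ops_eq_on_span[OF S(1) T sub E.\<alpha>G])
      fix y assume "y \<in> {e x |e x. e \<in> \<beta> \<and> x \<in> carrier G}"
      then obtain e x where y: "y = e x" and e: "e \<in> \<beta>" and x: "x \<in> carrier G" by auto
      show "S y = ?T y" unfolding y S(2)[OF e x] Te[OF e x] ..
    qed
  qed
  show "ket1 H \<alpha> G K \<beta> a \<in> carrier (Ops K W)" unfolding eq by (rule T)
  show "ket1 H \<alpha> G K \<beta> a (e x) = el a x e" if "e \<in> \<beta>" "x \<in> carrier G" unfolding eq by (rule Te[OF that])
qed

lemma ket2:
  assumes e: "e \<in> \<beta>"
  shows ket2_ops: "ket2 H \<alpha> G K \<beta> e \<in> carrier (Ops H W)"
    and ket2_el: "a \<in> \<alpha> \<Longrightarrow> x \<in> carrier G \<Longrightarrow> ket2 H \<alpha> G K \<beta> e (a x) = el a x e"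
proof -
  let ?T = "\<lambda>h\<in>carrier H. el (A.elt h) \<zeta> e"
  have T: "?T \<in> carrier (Ops H W)"
    by (rule HW.restrict_OpsI)
       (use e in \<open>simp_all add: el_closed A.\<zeta> A.elt(1) A.elt_add A.elt_smult el_add_left el_smult_left\<close>)
  have Te: "?T (a x) = el a x e" if a: "a \<in> \<alpha>" and x: "x \<in> carrier G" for a x
  proof -
    obtain b where b: "b \<in> B" "b \<zeta> = x" using A.cyc[OF x] by auto
    have "?T (a x) = el (compose (carrier G) a b) \<zeta> e" using A.elt_compose[OF a b(1)] b(2) A.\<alpha>_closed[OF a x] by simp
    also have "... = el a x e" using el_move_left[OF a A.\<zeta> e b(1)] b(2) by simp
    finally show ?thesis .
  qed
  have sub: "{a x |a x. a \<in> \<alpha> \<and> x \<in> carrier G} \<subseteq> carrier H" using A.\<alpha>_closed by auto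
  have eq: "ket2 H \<alpha> G K \<beta> e = ?T"
    unfolding ket2_def
  proof (rule the_equality)
    show "?T \<in> carrier (Ops H W) \<and> (\<forall>\<xi>\<in>\<alpha>. \<forall>\<omega>\<in>carrier G. ?T (\<xi> \<omega>) = el \<xi> \<omega> e)" using T Te by blast
    fix S assume "S \<in> carrier (Ops H W) \<and> (\<forall>\<xi>\<in>\<alpha>. \<forall>\<omega>\<in>carrier G. S (\<xi> \<omega>) = el \<xi> \<omega> e)"
    then have S: "S \<in> carrier (Ops H W)" "\<And>a x. a \<in> \<alpha> \<Longrightarrow> x \<in> carrier G \<Longrightarrow> S (a x) = el a x e" by auto
    show "S = ?T"
    proof (rule HW.Ops_eq_on_span[OF S(1) T sub A.\<alpha>G])
      fix y assume "y \<in> {a x |a x. a \<in> \<alpha> \<and> x \<in> carrier G}"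
      then obtain a x where y: "y = a x" and a: "a \<in> \<alpha>" and x: "x \<in> carrier G" by auto
      show "S y = ?T y" unfolding y S(2)[OF a x] Te[OF a x] ..
    qed
  qed
  show "ket2 H \<alpha> G K \<beta> e \<in> carrier (Ops H W)" unfolding eq by (rule T)
  show "ket2 H \<alpha> G K \<beta> e (a x) = el a x e" if "a \<in> \<alpha>" "x \<in> carrier G" unfolding eq by (rule Te[OF that])
qed

end

section \<open>The spatial fiber product as a commutant\<close>

text \<open>
  In addition: unital *-algebras \<open>AA\<close>, \<open>BB\<close> on \<open>H\<close>, \<open>K\<close> that contain the images of \<open>Bd\<close> and \<open>B\<close>
  under the representations given by \<open>\<alpha>\<close> and \<open>\<beta>\<close>.
\<close>

locale two_algebras = two_factors G B Bd \<zeta> H \<alpha> K \<beta> + SA: star_subalg H AA + SB: star_subalg K BB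
  for G :: "('g, 'm) hilb_scheme" and B Bd \<zeta> and H :: "('h, 'n) hilb_scheme" and \<alpha>
  and K :: "('k, 'p) hilb_scheme" and \<beta> and AA BB +
  assumes repA: "c \<in> Bd \<Longrightarrow> A.rep c \<in> AA" and repB: "b \<in> B \<Longrightarrow> E.rep b \<in> BB"
begin

abbreviation "A' \<equiv> commutant H AA"
abbreviation "B' \<equiv> commutant K BB"

lemma A'_intertwines: "s \<in> A' \<Longrightarrow> c \<in> Bd \<Longrightarrow> h \<in> carrier H \<Longrightarrow> s (A.rep c h) = A.rep c (s h)"
  using SA.commutantD(2) repA by blast
lemma B'_intertwines: "t \<in> B' \<Longrightarrow> b \<in> B \<Longrightarrow> k \<in> carrier K \<Longrightarrow> t (E.rep b k) = E.rep b (t k)"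
  using SB.commutantD(2) repB by blast

lemma s\<alpha>: assumes s: "s \<in> A'" and a: "a \<in> \<alpha>"
  shows "compose (carrier G) s a \<in> \<alpha>" "A.elt (s (a \<zeta>)) = compose (carrier G) s a"
  using A.intertwiner[OF SA.commutantD(1)[OF s] A'_intertwines[OF s] a] by auto
lemma t\<beta>: assumes t: "t \<in> B'" and e: "e \<in> \<beta>"
  shows "compose (carrier G) t e \<in> \<beta>" "E.elt (t (e \<zeta>)) = compose (carrier G) t e"
  using E.intertwiner[OF SB.commutantD(1)[OF t] B'_intertwines[OF t] e] by auto

lemma adj_s\<alpha>:
  assumes s: "s \<in> A'" and a: "a \<in> \<alpha>" and h: "h \<in> carrier H"
  shows "adj G H (compose (carrier G) (adj H H s) a) h = adj G H a (s h)"
proof -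
  note S = SA.commutantD(1)[OF s]
  have "adj G H (compose (carrier G) (adj H H s) a) = compose (carrier H) (adj G H a) (adj H H (adj H H s))"
    by (rule adj_compose[OF A.G.fd_space_axioms A.H.fd_space_axioms A.H.fd_space_axioms A.\<alpha>_ops[OF a] A.HH.adj_closed[OF S]])
  then show ?thesis using A.HH.adj_adj[OF S] h by (simp add: compose_eq)
qed

lemma adj_t\<beta>:
  assumes t: "t \<in> B'" and e: "e \<in> \<beta>" and k: "k \<in> carrier K"
  shows "adj G K (compose (carrier G) (adj K K t) e) k = adj G K e (t k)"
proof -
  note T = SB.commutantD(1)[OF t]
  have "adj G K (compose (carrier G) (adj K K t) e) = compose (carrier K) (adj G K e) (adj K K (adj K K t))"
    by (rule adj_compose[OF A.G.fd_space_axioms E.H.fd_space_axioms E.H.fd_space_axioms E.\<alpha>_ops[OF e] E.HH.adj_closed[OF T]])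
  then show ?thesis using E.HH.adj_adj[OF T] k by (simp add: compose_eq)
qed

text \<open>The operator \<open>s \<otimes> t\<close> on the C*-relative tensor product, for \<open>s \<in> AA'\<close> and \<open>t \<in> BB'\<close>; it is
  determined by its values on the elementary tensors.\<close>

definition amp :: "('h \<Rightarrow> 'h) \<Rightarrow> ('k \<Rightarrow> 'k) \<Rightarrow> (('g \<Rightarrow> 'h) \<times> 'g \<times> ('g \<Rightarrow> 'k) \<Rightarrow>\<^sub>0 complex) set \<Rightarrow> (('g \<Rightarrow> 'h) \<times> 'g \<times> ('g \<Rightarrow> 'k) \<Rightarrow>\<^sub>0 complex) set" where
  "amp s t = (SOME F. F \<in> carrier (Ops W W) \<and> (\<forall>a\<in>\<alpha>. \<forall>x\<in>carrier G. \<forall>e\<in>\<beta>.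
     F (el a x e) = el (compose (carrier G) s a) x (compose (carrier G) t e)))"

lemma amp:
  assumes s: "s \<in> A'" and t: "t \<in> B'"
  shows amp_ops: "amp s t \<in> carrier (Ops W W)"
    and amp_el: "a \<in> \<alpha> \<Longrightarrow> x \<in> carrier G \<Longrightarrow> e \<in> \<beta> \<Longrightarrow> amp s t (el a x e) = el (compose (carrier G) s a) x (compose (carrier G) t e)"
proof -
  let ?I = "\<alpha> \<times> carrier G \<times> \<beta>"
  let ?c = "\<lambda>(a, x, e). el a x e"
  let ?g = "\<lambda>(a, x, e). el (compose (carrier G) s a) x (compose (carrier G) t e)"
  let ?v = "\<lambda>(a, x, e). el (compose (carrier G) (adj H H s) a) x (compose (carrier G) (adj K K t) e)"
  note s' = SA.commutant_adj[OF s] and t' = SB.commutant_adj[OF t]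
  have F: "\<exists>F\<in>carrier (Ops W W). \<forall>i\<in>?I. F (?c i) = ?g i"
  proof (rule WW.Ops_extend[where d = ?c and J = ?I and v = ?v])
    show "?c \<in> ?I \<rightarrow> carrier W" by (auto intro: el_closed)
    show "lspan W (?c ` ?I) = carrier W" by (rule el_span)
    show "?g \<in> ?I \<rightarrow> carrier W" by (auto intro!: el_closed s\<alpha>[OF s] t\<beta>[OF t])
    show "?c \<in> ?I \<rightarrow> carrier W" by (auto intro: el_closed)
    show "lspan W (?c ` ?I) = carrier W" by (rule el_span)
    show "?v \<in> ?I \<rightarrow> carrier W" by (auto intro!: el_closed s\<alpha>[OF s'] t\<beta>[OF t'])
    fix i j assume i: "i \<in> ?I" and j: "j \<in> ?I"
    obtain a x e where ie: "i = (a, x, e)" by (cases i) auto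
    obtain a' x' e' where je: "j = (a', x', e')" by (cases j) auto
    have m: "a \<in> \<alpha>" "x \<in> carrier G" "e \<in> \<beta>" "a' \<in> \<alpha>" "x' \<in> carrier G" "e' \<in> \<beta>" using i j ie je by auto
    have tc: "t (e x) \<in> carrier K" using OpsD(2)[OF SB.commutantD(1)[OF t] E.\<alpha>_closed[OF m(3,2)]] .
    have c1: "adj G K e' (t (e x)) \<in> carrier G" using E.\<alpha>adj_closed[OF m(6) tc] .
    show "ip W (?c j) (?g i) = ip W (?v j) (?c i)"
      unfolding ie je prod.case
      using m s\<alpha>[OF s] t\<beta>[OF t] s\<alpha>[OF s'] t\<beta>[OF t'] c1
      by (simp add: ip_el compose_eq adj_s\<alpha>[OF s] adj_t\<beta>[OF t] A.\<alpha>_closed E.\<alpha>_closed)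
  qed
  obtain F where F: "F \<in> carrier (Ops W W)" "\<forall>i\<in>?I. F (?c i) = ?g i" using F by (rule bexE)
  then have "\<exists>F. F \<in> carrier (Ops W W) \<and> (\<forall>a\<in>\<alpha>. \<forall>x\<in>carrier G. \<forall>e\<in>\<beta>.
     F (el a x e) = el (compose (carrier G) s a) x (compose (carrier G) t e))"
    by (intro exI[of _ F]) auto
  from someI_ex[OF this] have *: "amp s t \<in> carrier (Ops W W) \<and> (\<forall>a\<in>\<alpha>. \<forall>x\<in>carrier G. \<forall>e\<in>\<beta>.
     amp s t (el a x e) = el (compose (carrier G) s a) x (compose (carrier G) t e))" unfolding amp_def .
  show "amp s t \<in> carrier (Ops W W)" using * by blast
  show "a \<in> \<alpha> \<Longrightarrow> x \<in> carrier G \<Longrightarrow> e \<in> \<beta> \<Longrightarrow> amp s t (el a x e) = el (compose (carrier G) s a) x (compose (carrier G) t e)"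
    using * by blast
qed

lemma amp_vec:
  assumes s: "s \<in> A'" and t: "t \<in> B'" and h: "h \<in> carrier H" and k: "k \<in> carrier K"
  shows "amp s t (vec h k) = vec (s h) (t k)"
  using amp_el[OF s t A.elt(1)[OF h] A.\<zeta> E.elt(1)[OF k]] s\<alpha>(2)[OF s A.elt(1)[OF h]] t\<beta>(2)[OF t E.elt(1)[OF k]]
    A.elt(2)[OF h] E.elt(2)[OF k]
  by (simp add: vec_def)

abbreviation "idH \<equiv> (\<lambda>x\<in>carrier H. x)"
abbreviation "idK \<equiv> (\<lambda>x\<in>carrier K. x)"

lemma idH: "idH \<in> A'" 
  by (rule SA.commutantI) (use SA.B_closed[OF SA.unit] in \<open>auto simp: OpsD(2)[OF SA.B_closed]\<close>)
lemma idK: "idK \<in> B'"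
  by (rule SB.commutantI) (use SB.B_closed[OF SB.unit] in \<open>auto simp: OpsD(2)[OF SB.B_closed]\<close>)

lemma id_\<alpha>: "a \<in> \<alpha> \<Longrightarrow> compose (carrier G) idH a = a"
  by (rule Ops_eqI[OF A.\<alpha>_ops[OF s\<alpha>(1)[OF idH]] A.\<alpha>_ops]) (auto simp: compose_eq A.\<alpha>_closed)
lemma id_\<beta>: "e \<in> \<beta> \<Longrightarrow> compose (carrier G) idK e = e"
  by (rule Ops_eqI[OF E.\<alpha>_ops[OF t\<beta>(1)[OF idK]] E.\<alpha>_ops]) (auto simp: compose_eq E.\<alpha>_closed)

lemma amp_split:
  assumes s: "s \<in> A'" and t: "t \<in> B'" and w: "w \<in> carrier W"
  shows "amp s t w = amp s idK (amp idH t w)"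
proof -
  have "amp s t = compose (carrier W) (amp s idK) (amp idH t)"
  proof (rule WW.Ops_eq_on_span[OF amp_ops[OF s t] _ _ el_span])
    show "compose (carrier W) (amp s idK) (amp idH t) \<in> carrier (Ops W W)"
      using compose_Ops[OF W.fd_space_axioms W.fd_space_axioms W.fd_space_axioms amp_ops[OF idH t] amp_ops[OF s idK]] .
    fix y assume "y \<in> (\<lambda>(a, x, e). el a x e) ` (\<alpha> \<times> carrier G \<times> \<beta>)"
    then obtain a x e where y: "y = el a x e" and m: "a \<in> \<alpha>" "x \<in> carrier G" "e \<in> \<beta>" by auto
    show "amp s t y = compose (carrier W) (amp s idK) (amp idH t) y"
      unfolding y using m el_closed[OF m]
      by (simp add: compose_eq amp_el[OF s t] amp_el[OF idH t] amp_el[OF s idK] id_\<alpha> id_\<beta> t\<beta>[OF t])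
  qed (auto intro: el_closed)
  then show ?thesis using w by (simp add: compose_eq)
qed

lemma el_total:
  assumes "w \<in> carrier W" "\<And>a x e. a \<in> \<alpha> \<Longrightarrow> x \<in> carrier G \<Longrightarrow> e \<in> \<beta> \<Longrightarrow> ip W (el a x e) w = 0"
  shows "w = \<zero>\<^bsub>W\<^esub>"
  by (rule el_eqI) (use assms el_closed in auto)

sublocale ket1: ket_system K BB W "ket1 H \<alpha> G K \<beta> ` \<alpha>" "\<lambda>t. amp idH t"
proof unfold_locales
  show "l \<in> carrier (Ops K W)" if "l \<in> ket1 H \<alpha> G K \<beta> ` \<alpha>" for l using that ket1_ops by auto
  show "w = \<zero>\<^bsub>W\<^esub>" if w: "w \<in> carrier W"
    and o: "\<And>l k. l \<in> ket1 H \<alpha> G K \<beta> ` \<alpha> \<Longrightarrow> k \<in> carrier K \<Longrightarrow> ip W (l k) w = 0" for w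
  proof (rule el_total[OF w])
    fix a x e assume a: "a \<in> \<alpha>" and x: "x \<in> carrier G" and e: "e \<in> \<beta>"
    show "ip W (el a x e) w = 0" using o[OF imageI[OF a] E.\<alpha>_closed[OF e x]] ket1_el[OF a e x] by simp
  qed
  fix t assume t: "t \<in> B'"
  show "amp idH t \<in> carrier (Ops W W)" using amp_ops[OF idH t] .
  fix l k assume l: "l \<in> ket1 H \<alpha> G K \<beta> ` \<alpha>" and k: "k \<in> carrier K"
  obtain a where a: "a \<in> \<alpha>" "l = ket1 H \<alpha> G K \<beta> a" using l by auto
  have tk: "t k \<in> carrier K" using OpsD(2)[OF SB.commutantD(1)[OF t] k] .
  have "l k = el a \<zeta> (E.elt k)" using ket1_el[OF a(1) E.elt(1)[OF k] A.\<zeta>] E.elt(2)[OF k] a(2) by simp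
  moreover have "l (t k) = el a \<zeta> (E.elt (t k))" using ket1_el[OF a(1) E.elt(1)[OF tk] A.\<zeta>] E.elt(2)[OF tk] a(2) by simp
  ultimately show "amp idH t (l k) = l (t k)"
    using amp_el[OF idH t a(1) A.\<zeta> E.elt(1)[OF k]] id_\<alpha>[OF a(1)] t\<beta>(2)[OF t E.elt(1)[OF k]] E.elt(2)[OF k] by simp
next
  fix l l' assume "l \<in> ket1 H \<alpha> G K \<beta> ` \<alpha>" "l' \<in> ket1 H \<alpha> G K \<beta> ` \<alpha>"
  then obtain a a' where a: "a \<in> \<alpha>" "l = ket1 H \<alpha> G K \<beta> a" "a' \<in> \<alpha>" "l' = ket1 H \<alpha> G K \<beta> a'" by auto
  have l: "l \<in> carrier (Ops K W)" "l' \<in> carrier (Ops K W)" using ket1_ops a by auto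
  have "compose (carrier K) (adj K W l) l' = E.rep (bb a a')"
  proof (rule Ops_eqI)
    show "compose (carrier K) (adj K W l) l' \<in> carrier (Ops K K)"
      using compose_Ops[OF E.H.fd_space_axioms W.fd_space_axioms E.H.fd_space_axioms l(2) KW.adj_closed[OF l(1)]] .
    show r: "E.rep (bb a a') \<in> carrier (Ops K K)" using E.rep_ops A.\<alpha>\<alpha> a by blast
    fix k assume k: "k \<in> carrier K"
    have lk: "l' k \<in> carrier W" using OpsD(2)[OF l(2) k] .
    have "adj K W l (l' k) = E.rep (bb a a') k"
    proof (rule E.H.ip_eqI)
      show "adj K W l (l' k) \<in> carrier K" using OpsD(2)[OF KW.adj_closed[OF l(1)] lk] .
      show "E.rep (bb a a') k \<in> carrier K" using OpsD(2)[OF r k] .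
      fix z assume z: "z \<in> carrier K"
      have "ip K z (adj K W l (l' k)) = ip W (l z) (l' k)" using KW.adj_ip[OF l(1) z lk] by simp
      also have "... = ip W (el a \<zeta> (E.elt z)) (el a' \<zeta> (E.elt k))"
        using ket1_el[OF a(1) E.elt(1)[OF z] A.\<zeta>] ket1_el[OF a(3) E.elt(1)[OF k] A.\<zeta>] E.elt(2)[OF z] E.elt(2)[OF k] a by simp
      also have "... = ip K z (E.rep (bb a a') k)"
        using form_K[OF a(1,3) E.elt(1)[OF z] E.elt(1)[OF k] A.\<zeta> A.\<zeta>] E.elt(2)[OF z] E.elt(2)[OF k]
        by (simp add: ip_el a E.elt(1) z k A.\<zeta>)
      finally show "ip K z (adj K W l (l' k)) = ip K z (E.rep (bb a a') k)" .
    qed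
    then show "compose (carrier K) (adj K W l) l' k = E.rep (bb a a') k" using k by (simp add: compose_eq)
  qed
  then show "compose (carrier K) (adj K W l) l' \<in> BB" using repB A.\<alpha>\<alpha> a by simp
qed

sublocale ket2: ket_system H AA W "ket2 H \<alpha> G K \<beta> ` \<beta>" "\<lambda>s. amp s idK"
proof unfold_locales
  show "l \<in> carrier (Ops H W)" if "l \<in> ket2 H \<alpha> G K \<beta> ` \<beta>" for l using that ket2_ops by auto
  show "w = \<zero>\<^bsub>W\<^esub>" if w: "w \<in> carrier W"
    and o: "\<And>l k. l \<in> ket2 H \<alpha> G K \<beta> ` \<beta> \<Longrightarrow> k \<in> carrier H \<Longrightarrow> ip W (l k) w = 0" for w
  proof (rule el_total[OF w])
    fix a x e assume a: "a \<in> \<alpha>" and x: "x \<in> carrier G" and e: "e \<in> \<beta>"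
    show "ip W (el a x e) w = 0" using o[OF imageI[OF e] A.\<alpha>_closed[OF a x]] ket2_el[OF e a x] by simp
  qed
  fix s assume s: "s \<in> A'"
  show "amp s idK \<in> carrier (Ops W W)" using amp_ops[OF s idK] .
  fix l h assume l: "l \<in> ket2 H \<alpha> G K \<beta> ` \<beta>" and h: "h \<in> carrier H"
  obtain e where e: "e \<in> \<beta>" "l = ket2 H \<alpha> G K \<beta> e" using l by auto
  have sh: "s h \<in> carrier H" using OpsD(2)[OF SA.commutantD(1)[OF s] h] .
  have "l h = el (A.elt h) \<zeta> e" using ket2_el[OF e(1) A.elt(1)[OF h] A.\<zeta>] A.elt(2)[OF h] e(2) by simp
  moreover have "l (s h) = el (A.elt (s h)) \<zeta> e" using ket2_el[OF e(1) A.elt(1)[OF sh] A.\<zeta>] A.elt(2)[OF sh] e(2) by simp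
  ultimately show "amp s idK (l h) = l (s h)"
    using amp_el[OF s idK A.elt(1)[OF h] A.\<zeta> e(1)] id_\<beta>[OF e(1)] s\<alpha>(2)[OF s A.elt(1)[OF h]] A.elt(2)[OF h] by simp
next
  fix l l' assume "l \<in> ket2 H \<alpha> G K \<beta> ` \<beta>" "l' \<in> ket2 H \<alpha> G K \<beta> ` \<beta>"
  then obtain e e' where e: "e \<in> \<beta>" "l = ket2 H \<alpha> G K \<beta> e" "e' \<in> \<beta>" "l' = ket2 H \<alpha> G K \<beta> e'" by auto
  have l: "l \<in> carrier (Ops H W)" "l' \<in> carrier (Ops H W)" using ket2_ops e by auto
  have "compose (carrier H) (adj H W l) l' = A.rep (cc e e')"
  proof (rule Ops_eqI)
    show "compose (carrier H) (adj H W l) l' \<in> carrier (Ops H H)"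
      using compose_Ops[OF A.H.fd_space_axioms W.fd_space_axioms A.H.fd_space_axioms l(2) HW.adj_closed[OF l(1)]] .
    show r: "A.rep (cc e e') \<in> carrier (Ops H H)" using A.rep_ops E.\<alpha>\<alpha> e by blast
    fix h assume h: "h \<in> carrier H"
    have lh: "l' h \<in> carrier W" using OpsD(2)[OF l(2) h] .
    have "adj H W l (l' h) = A.rep (cc e e') h"
    proof (rule A.H.ip_eqI)
      show "adj H W l (l' h) \<in> carrier H" using OpsD(2)[OF HW.adj_closed[OF l(1)] lh] .
      show "A.rep (cc e e') h \<in> carrier H" using OpsD(2)[OF r h] .
      fix z assume z: "z \<in> carrier H"
      have "ip H z (adj H W l (l' h)) = ip W (l z) (l' h)" using HW.adj_ip[OF l(1) z lh] by simp
      also have "... = ip W (el (A.elt z) \<zeta> e) (el (A.elt h) \<zeta> e')"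
        using ket2_el[OF e(1) A.elt(1)[OF z] A.\<zeta>] ket2_el[OF e(3) A.elt(1)[OF h] A.\<zeta>] A.elt(2)[OF z] A.elt(2)[OF h] e by simp
      also have "... = ip H z (A.rep (cc e e') h)"
        using form_H[OF A.elt(1)[OF z] A.elt(1)[OF h] e(1,3) A.\<zeta> A.\<zeta>] A.elt(2)[OF z] A.elt(2)[OF h]
        by (simp add: ip_el e A.elt(1) z h A.\<zeta>)
      finally show "ip H z (adj H W l (l' h)) = ip H z (A.rep (cc e e') h)" .
    qed
    then show "compose (carrier H) (adj H W l) l' h = A.rep (cc e e') h" using h by (simp add: compose_eq)
  qed
  then show "compose (carrier H) (adj H W l) l' \<in> AA" using repA E.\<alpha>\<alpha> e by simp
qed

theorem spatial_fiber_eq: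
  "spatial_fiber H \<alpha> AA G K \<beta> BB =
     {T \<in> carrier (Ops W W). \<forall>s\<in>A'. \<forall>t\<in>B'. \<forall>w\<in>carrier W. T (amp s t w) = amp s t (T w)}"
proof -
  have g1: "{compose (carrier K) l b |l b. l \<in> ket1 H \<alpha> G K \<beta> ` \<alpha> \<and> b \<in> BB} = {compose (carrier K) (ket1 H \<alpha> G K \<beta> \<xi>) b |\<xi> b. \<xi> \<in> \<alpha> \<and> b \<in> BB}"
    by blast
  have g2: "{compose (carrier H) l b |l b. l \<in> ket2 H \<alpha> G K \<beta> ` \<beta> \<and> b \<in> AA} = {compose (carrier H) (ket2 H \<alpha> G K \<beta> \<xi>) b |\<xi> b. \<xi> \<in> \<beta> \<and> b \<in> AA}"
    by blast
  have X1: "cspan (Ops K W) {compose (carrier K) (ket1 H \<alpha> G K \<beta> \<xi>) b |\<xi> b. \<xi> \<in> \<alpha> \<and> b \<in> BB} = ket1.X1"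
    using KW.cspan_Ops[OF ket1.gens_closed] unfolding g1 .
  have X2: "cspan (Ops H W) {compose (carrier H) (ket2 H \<alpha> G K \<beta> \<eta>) a |\<eta> a. \<eta> \<in> \<beta> \<and> a \<in> AA} = ket2.X1"
    using HW.cspan_Ops[OF ket2.gens_closed] unfolding g2 .
  have "spatial_fiber H \<alpha> AA G K \<beta> BB = {T \<in> carrier (Ops W W).
      (\<forall>l\<in>ket1 H \<alpha> G K \<beta> ` \<alpha>. compose (carrier K) T l \<in> ket1.X1 \<and> compose (carrier K) (adj W W T) l \<in> ket1.X1) \<and>
      (\<forall>l\<in>ket2 H \<alpha> G K \<beta> ` \<beta>. compose (carrier H) T l \<in> ket2.X1 \<and> compose (carrier H) (adj W W T) l \<in> ket2.X1)}"
    unfolding spatial_fiber_def Let_def X1 X2 by simp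
  also have "... = {T \<in> carrier (Ops W W).
      (\<forall>t\<in>B'. \<forall>w\<in>carrier W. T (amp idH t w) = amp idH t (T w)) \<and> (\<forall>s\<in>A'. \<forall>w\<in>carrier W. T (amp s idK w) = amp s idK (T w))}"
    by (intro Collect_cong conj_cong refl) (simp_all only: ket1.commutes_iff_ket ket2.commutes_iff_ket)
  also have "... = {T \<in> carrier (Ops W W). \<forall>s\<in>A'. \<forall>t\<in>B'. \<forall>w\<in>carrier W. T (amp s t w) = amp s t (T w)}"
  proof (intro Collect_cong conj_cong refl iffI conjI ballI)
    fix T s t w assume T: "T \<in> carrier (Ops W W)"
      and c: "(\<forall>t\<in>B'. \<forall>w\<in>carrier W. T (amp idH t w) = amp idH t (T w)) \<and> (\<forall>s\<in>A'. \<forall>w\<in>carrier W. T (amp s idK w) = amp s idK (T w))"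
      and s: "s \<in> A'" and t: "t \<in> B'" and w: "w \<in> carrier W"
    show "T (amp s t w) = amp s t (T w)"
      using c s t w OpsD(2)[OF amp_ops[OF idH t] w] OpsD(2)[OF T w] by (simp add: amp_split[OF s t])
  qed (use idH idK in auto)
  finally show ?thesis .
qed

end

section \<open>Conjugation by a unitary\<close>

context fd_pair begin

lemma unitaryD:
  assumes U: "unitary V W U"
  shows unitary_ops: "U \<in> carrier (Ops V W)" 
    and unitary_ip: "x \<in> carrier V \<Longrightarrow> y \<in> carrier V \<Longrightarrow> ip W (U x) (U y) = ip V x y"
    and unitary_adj: "x \<in> carrier V \<Longrightarrow> adj V W U (U x) = x"
    and unitary_adj': "w \<in> carrier W \<Longrightarrow> U (adj V W U w) = w"
proof -
  show o: "U \<in> carrier (Ops V W)" and i: "\<And>x y. x \<in> carrier V \<Longrightarrow> y \<in> carrier V \<Longrightarrow> ip W (U x) (U y) = ip V x y"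
    using U unfolding unitary_def by auto
  show a: "adj V W U (U x) = x" if x: "x \<in> carrier V" for x
  proof (rule V.ip_eqI)
    show "adj V W U (U x) \<in> carrier V" using OpsD(2)[OF adj_closed[OF o] OpsD(2)[OF o x]] .
    fix z assume z: "z \<in> carrier V"
    show "ip V z (adj V W U (U x)) = ip V z x" using adj_ip[OF o z OpsD(2)[OF o x]] i[OF z x] by simp
  qed (rule x)
  have b: "bij_betw U (carrier V) (carrier W)" using U unfolding unitary_def by auto
  have s: "\<exists>x\<in>carrier V. U x = w" if "w \<in> carrier W" for w
  proof -
    have "w \<in> U ` carrier V" using bij_betw_imp_surj_on[OF b] that by simp
    then show ?thesis by auto
  qed
  show "U (adj V W U w) = w" if w: "w \<in> carrier W" for w
  proof -
    obtain x where "x \<in> carrier V" "U x = w" using s[OF w] by auto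
    then show ?thesis using a by auto
  qed
qed

lemma unitary_adj_unitary:
  assumes U: "unitary V W U" shows "unitary W V (adj V W U)"
proof -
  note o = unitary_ops[OF U] and c = OpsD(2)[OF adj_closed[OF unitary_ops[OF U]]]
  have "bij_betw (adj V W U) (carrier W) (carrier V)"
    by (rule bij_betw_byWitness[where f' = U])
       (use unitary_adj[OF U] unitary_adj'[OF U] c OpsD(2)[OF o] in auto)
  moreover have "ip V (adj V W U x) (adj V W U y) = ip W x y" if "x \<in> carrier W" "y \<in> carrier W" for x y
    using unitary_ip[OF U c[OF that(1)] c[OF that(2)]] unitary_adj'[OF U that(1)] unitary_adj'[OF U that(2)] by simp
  ultimately show ?thesis using adj_closed[OF o] unfolding unitary_def by auto
qed

lemma Ad_apply: "y \<in> carrier W \<Longrightarrow> Ad V W U T y = U (T (adj V W U y))"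
  by (simp add: Ad_def compose_eq)

lemma Ad_ops:
  assumes U: "unitary V W U" and T: "T \<in> carrier (Ops V V)"
  shows "Ad V W U T \<in> carrier (Ops W W)"
proof -
  note o = unitary_ops[OF U]
  have "compose (carrier W) T (adj V W U) \<in> carrier (Ops W V)"
    by (rule compose_Ops[OF W.fd_space_axioms V.fd_space_axioms V.fd_space_axioms adj_closed[OF o] T])
  then show ?thesis unfolding Ad_def
    by (rule compose_Ops[OF W.fd_space_axioms V.fd_space_axioms W.fd_space_axioms _ o])
qed

lemma Ad_star_iso:
  assumes U: "unitary V W U" and C: "C \<subseteq> carrier (Ops V V)" and D: "D = Ad V W U ` C"
  shows "Ad V W U \<in> star_iso ((Lalg V)\<lparr>carrier := C\<rparr>) ((Lalg W)\<lparr>carrier := D\<rparr>)"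
proof -
  interpret VV: fd_pair V V ..
  interpret WW: fd_pair W W ..
  note o = unitary_ops[OF U]
  note Uc = OpsD(2)[OF o] and Uac = OpsD(2)[OF adj_closed[OF o]]
  have inj: "inj_on (Ad V W U) C"
  proof (rule inj_onI)
    fix S T assume S: "S \<in> C" and T: "T \<in> C" and e: "Ad V W U S = Ad V W U T"
    have S': "S \<in> carrier (Ops V V)" and T': "T \<in> carrier (Ops V V)" using S T C by auto
    show "S = T"
    proof (rule Ops_eqI[OF S' T'])
      fix x assume x: "x \<in> carrier V"
      have "U (S x) = U (T x)" using fun_cong[OF e, of "U x"] Ad_apply[OF Uc[OF x]] unitary_adj[OF U x] by simp
      then have "adj V W U (U (S x)) = adj V W U (U (T x))" by simp
      then show "S x = T x" using unitary_adj[OF U OpsD(2)[OF S' x]] unitary_adj[OF U OpsD(2)[OF T' x]] by simp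
    qed
  qed
  have "Ad V W U \<in> star_hom ((Lalg V)\<lparr>carrier := C\<rparr>) ((Lalg W)\<lparr>carrier := D\<rparr>)"
    unfolding star_hom_def
  proof (intro CollectI conjI ballI allI)
    show "Ad V W U \<in> carrier ((Lalg V)\<lparr>carrier := C\<rparr>) \<rightarrow> carrier ((Lalg W)\<lparr>carrier := D\<rparr>)" using D by auto
  next
    fix S T assume "S \<in> carrier ((Lalg V)\<lparr>carrier := C\<rparr>)" "T \<in> carrier ((Lalg V)\<lparr>carrier := C\<rparr>)"
    then have S: "S \<in> carrier (Ops V V)" and T: "T \<in> carrier (Ops V V)" using C by auto
    have "Ad V W U (S \<oplus>\<^bsub>Ops V V\<^esub> T) = Ad V W U S \<oplus>\<^bsub>Ops W W\<^esub> Ad V W U T"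
      by (rule Ops_eqI[OF Ad_ops[OF U VV.Ops_add_closed[OF S T]] WW.Ops_add_closed[OF Ad_ops[OF U S] Ad_ops[OF U T]]])
         (simp add: Ad_apply Uac OpsD(2)[OF S] OpsD(2)[OF T] OpsD(3)[OF o])
    then show "Ad V W U (S \<oplus>\<^bsub>(Lalg V)\<lparr>carrier := C\<rparr>\<^esub> T) = Ad V W U S \<oplus>\<^bsub>(Lalg W)\<lparr>carrier := D\<rparr>\<^esub> Ad V W U T" by simp
    have ST: "compose (carrier V) S T \<in> carrier (Ops V V)" "compose (carrier W) (Ad V W U S) (Ad V W U T) \<in> carrier (Ops W W)"
      using compose_Ops[OF V.fd_space_axioms V.fd_space_axioms V.fd_space_axioms T S]
        compose_Ops[OF W.fd_space_axioms W.fd_space_axioms W.fd_space_axioms Ad_ops[OF U T] Ad_ops[OF U S]] by auto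
    have "Ad V W U (compose (carrier V) S T) = compose (carrier W) (Ad V W U S) (Ad V W U T)"
      by (rule Ops_eqI[OF Ad_ops[OF U ST(1)] ST(2)])
         (simp add: Ad_apply Uac OpsD(2)[OF T] compose_eq Uc unitary_adj[OF U])
    then show "Ad V W U (S \<otimes>\<^bsub>(Lalg V)\<lparr>carrier := C\<rparr>\<^esub> T) = Ad V W U S \<otimes>\<^bsub>(Lalg W)\<lparr>carrier := D\<rparr>\<^esub> Ad V W U T" by simp
  next
    fix c S assume "S \<in> carrier ((Lalg V)\<lparr>carrier := C\<rparr>)"
    then have S: "S \<in> carrier (Ops V V)" using C by auto
    have "Ad V W U (c \<odot>\<^bsub>Ops V V\<^esub> S) = c \<odot>\<^bsub>Ops W W\<^esub> Ad V W U S"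
      by (rule Ops_eqI[OF Ad_ops[OF U VV.Ops_smult_closed[OF S]] WW.Ops_smult_closed[OF Ad_ops[OF U S]]])
         (simp add: Ad_apply Uac OpsD(2)[OF S] OpsD(4)[OF o])
    then show "Ad V W U (c \<odot>\<^bsub>(Lalg V)\<lparr>carrier := C\<rparr>\<^esub> S) = c \<odot>\<^bsub>(Lalg W)\<lparr>carrier := D\<rparr>\<^esub> Ad V W U S" by simp
  next
    fix S assume "S \<in> carrier ((Lalg V)\<lparr>carrier := C\<rparr>)"
    then have S: "S \<in> carrier (Ops V V)" using C by auto
    note Sa = VV.adj_closed[OF S]
    have "adj W W (Ad V W U S) = Ad V W U (adj V V S)"
    proof (rule WW.adj_eqI[OF Ad_ops[OF U Sa]])
      fix x y assume x: "x \<in> carrier W" and y: "y \<in> carrier W"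
      have "ip W (Ad V W U S x) y = ip V (S (adj V W U x)) (adj V W U y)"
        using adj_ip[OF o OpsD(2)[OF S Uac[OF x]] y] x by (simp add: Ad_apply)
      also have "... = ip V (adj V W U x) (adj V V S (adj V W U y))" using VV.adj_ip[OF S Uac[OF x] Uac[OF y]] .
      also have "... = ip W x (Ad V W U (adj V V S) y)"
        using adj_ip2[OF o OpsD(2)[OF Sa Uac[OF y]] x] y by (simp add: Ad_apply)
      finally show "ip W (Ad V W U S x) y = ip W x (Ad V W U (adj V V S) y)" .
    qed
    then show "Ad V W U (star ((Lalg V)\<lparr>carrier := C\<rparr>) S) = star ((Lalg W)\<lparr>carrier := D\<rparr>) (Ad V W U S)" by simp
  qed
  moreover have "bij_betw (Ad V W U) C D" using inj D unfolding bij_betw_def by simp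
  ultimately show ?thesis unfolding star_iso_def by simp
qed

end

lemma fd_space_unitary_image:
  assumes G: "fd_space G" and V: "ip_space V" and U: "unitary G V U"
  shows "fd_space V"
proof -
  interpret G: fd_space G by fact
  interpret V: ip_space V by fact
  have o: "U \<in> carrier (Ops G V)" and b: "bij_betw U (carrier G) (carrier V)" using U by (auto simp: unitary_def)
  have c: "U ` G.basis \<subseteq> carrier V" using OpsD(2)[OF o] by auto
  let ?M = "lspan V (U ` G.basis)"
  note M = V.submoduleD[OF V.lspan_submodule[OF c]]
  have z: "U \<zero>\<^bsub>G\<^esub> = \<zero>\<^bsub>V\<^esub>" using OpsD(4)[OF o G.M.zero_closed, of 0] OpsD(2)[OF o G.M.zero_closed] by simp
  have "U x \<in> ?M" if x: "x \<in> carrier G" for x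
  proof -
    have "x \<in> {x \<in> carrier G. U x \<in> ?M}"
      by (rule G.basis_span[OF G.submoduleI'])
         (use x z M V.lspan_base[of "U ` G.basis"] in \<open>auto simp: OpsD(3,4)[OF o]\<close>)
    then show ?thesis by simp
  qed
  then have "U ` carrier G \<subseteq> ?M" by auto
  then have "carrier V \<subseteq> ?M" using bij_betw_imp_surj_on[OF b] by simp
  then have "fin_dim V" unfolding fin_dim_def using c M(1) by (intro exI[of _ "U ` G.basis"]) auto
  then show ?thesis by unfold_locales
qed

lemma Ad_inverse:
  assumes G: "fd_space G" and V: "fd_space V" and U: "unitary G V U" and c: "c \<in> carrier (Ops G G)"
  shows "Ad V G (adj G V U) (Ad G V U c) = c"
proof -
  interpret GV: fd_pair G V using G V by (rule fd_pair.intro)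
  interpret VG: fd_pair V G ..
  note o = GV.unitary_ops[OF U]
  show ?thesis
  proof (rule Ops_eqI)
    show "Ad V G (adj G V U) (Ad G V U c) \<in> carrier (Ops G G)"
      using VG.Ad_ops[OF GV.unitary_adj_unitary[OF U] GV.Ad_ops[OF U c]] .
    fix x assume x: "x \<in> carrier G"
    show "Ad V G (adj G V U) (Ad G V U c) x = c x"
      using x GV.adj_adj[OF o]
      by (simp add: VG.Ad_apply GV.Ad_apply OpsD(2)[OF o] GV.unitary_adj[OF U] OpsD(2)[OF c])
  qed (rule c)
qed

section \<open>The classical relative tensor product\<close>

text \<open>
  Let \<open>x\<^sub>b\<close> run through \<open>U Bd U*\<close> and let \<open>r\<^sub>b\<close> be the image of \<open>U* x\<^sub>b U\<close> under the representation
  of \<open>Bd\<close> on \<open>H\<close>. The operator \<open>x\<^sub>b U \<zeta> \<mapsto> r\<^sub>b h\<close> is then \<open>elt h U*\<close>. This covers \<open>R_muop\<close>, and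
  with \<open>B\<close> and \<open>Bd\<close> exchanged also \<open>R_mu\<close>.
\<close>

lemma (in factor) bounded_vector_operator:
  assumes V: "fd_space V" and U: "unitary G V U"
    and x: "Ad G V U ` Bd = x ` I"
    and r: "\<And>b. b \<in> I \<Longrightarrow> r b = rep (Ad V G (adj G V U) (x b))" and h: "h \<in> carrier H"
  shows "(THE T. T \<in> carrier (Ops V H) \<and> (\<forall>b\<in>I. T (x b (U \<zeta>)) = r b h)) = compose (carrier V) (elt h) (adj G V U)"
proof (rule the_equality)
  interpret V: fd_space V by fact
  interpret GV: fd_pair G V ..
  note Uo = GV.unitary_ops[OF U] and UsU = GV.unitary_adj[OF U] and UUs = GV.unitary_adj'[OF U]
  let ?Us = "adj G V U"
  let ?T = "compose (carrier V) (elt h) ?Us"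
  have T: "?T \<in> carrier (Ops V H)"
    using compose_Ops[OF V.fd_space_axioms G.fd_space_axioms H.fd_space_axioms GV.adj_closed[OF Uo] \<alpha>_ops[OF elt(1)[OF h]]] .
  have Adv: "Ad G V U c (U \<zeta>) = U (c \<zeta>)" for c
    using GV.Ad_apply[of "U \<zeta>" U c] OpsD(2)[OF Uo \<zeta>] UsU[OF \<zeta>] by simp
  have Tb: "?T (x b (U \<zeta>)) = r b h" if b: "b \<in> I" for b
  proof -
    obtain c where c: "c \<in> Bd" "x b = Ad G V U c" using x b by (metis imageE imageI)
    have cz: "c \<zeta> \<in> carrier G" using OpsD(2)[OF Bd_ops[OF c(1)] \<zeta>] .
    have "r b h = elt h (c \<zeta>)"
      using r[OF b] c rep_elt[OF c(1) h] Ad_inverse[OF G.fd_space_axioms V U Bd_ops[OF c(1)]] by simp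
    then show ?thesis using cz by (simp add: c(2) Adv compose_eq OpsD(2)[OF Uo] UsU)
  qed
  show "?T \<in> carrier (Ops V H) \<and> (\<forall>b\<in>I. ?T (x b (U \<zeta>)) = r b h)" using T Tb by blast
  fix S assume S: "S \<in> carrier (Ops V H) \<and> (\<forall>b\<in>I. S (x b (U \<zeta>)) = r b h)"
  show "S = ?T"
  proof (rule Ops_eqI[OF _ T])
    show "S \<in> carrier (Ops V H)" using S by blast
    fix v assume v: "v \<in> carrier V"
    have "?Us v \<in> carrier G" using OpsD(2)[OF GV.adj_closed[OF Uo] v] .
    then obtain c where c: "c \<in> Bd" "c \<zeta> = ?Us v" using cycd by auto
    obtain b where b: "b \<in> I" "x b = Ad G V U c" using x c(1) by (metis imageE imageI)
    have "v = x b (U \<zeta>)" using b(2) Adv c(2) UUs[OF v] by simp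
    then show "S v = ?T v" using S Tb[OF b(1)] b(1) by simp
  qed
qed

text \<open>
  The unitary \<open>U\<close> carries \<open>G\<close>, \<open>B\<close>, \<open>Bd\<close>, \<open>\<zeta>\<close> to the GNS data of \<open>N\<close>, and \<open>\<sigma>\<close>, \<open>\<rho>\<close> are the
  representations of \<open>B\<close>, \<open>Bd\<close> given by \<open>\<beta>\<close>, \<open>\<alpha>\<close>, transported along \<open>U\<close>.
\<close>

locale gns_setting = two_algebras G B Bd \<zeta> H \<alpha> K \<beta> AA BB + V: fd_space V
  for G :: "('g, 'm) hilb_scheme" and B Bd \<zeta> and H :: "('h, 'p) hilb_scheme" and \<alpha>
  and K :: "('k, 'q) hilb_scheme" and \<beta> and AA BB and V :: "('v, 'r) hilb_scheme" +
  fixes N :: "('n, 's) cstar_scheme" and \<pi> :: "'n \<Rightarrow> 'v \<Rightarrow> 'v" and \<zeta>\<mu> :: 'v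
    and \<rho> :: "'n \<Rightarrow> 'h \<Rightarrow> 'h" and \<sigma> :: "'n \<Rightarrow> 'k \<Rightarrow> 'k" and U :: "'g \<Rightarrow> 'v"
  assumes U: "unitary G V U" and U\<zeta>: "U \<zeta> = \<zeta>\<mu>"
    and AdB: "Ad G V U ` B = \<pi> ` carrier N"
    and AdBd: "Ad G V U ` Bd = GNS_op N V \<pi> \<zeta>\<mu> ` carrier N"
    and \<rho>: "b \<in> carrier N \<Longrightarrow> \<rho> b = fact_rep H G \<alpha> (Ad V G (adj G V U) (GNS_op N V \<pi> \<zeta>\<mu> b))"
    and \<sigma>: "b \<in> carrier N \<Longrightarrow> \<sigma> b = fact_rep K G \<beta> (Ad V G (adj G V U) (\<pi> b))"
begin

sublocale GV: fd_pair G V ..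

abbreviation "Us \<equiv> adj G V U"

lemma U_ops: "U \<in> carrier (Ops G V)" using GV.unitary_ops[OF U] .
lemma U_closed: "x \<in> carrier G \<Longrightarrow> U x \<in> carrier V" using OpsD(2)[OF U_ops] .
lemma Us_ops: "Us \<in> carrier (Ops V G)" using GV.adj_closed[OF U_ops] .
lemma UsU: "x \<in> carrier G \<Longrightarrow> Us (U x) = x" using GV.unitary_adj[OF U] .

lemma R_muop_eq: "h \<in> carrier H \<Longrightarrow> R_muop N V \<pi> \<zeta>\<mu> H \<rho> h = compose (carrier V) (A.elt h) Us"
  unfolding R_muop_def U\<zeta>[symmetric]
  by (rule A.bounded_vector_operator[OF V.fd_space_axioms U]) (use AdBd \<rho> U\<zeta> in simp_all)

lemma R_mu_eq: "k \<in> carrier K \<Longrightarrow> R_mu N V \<pi> \<zeta>\<mu> K \<sigma> k = compose (carrier V) (E.elt k) Us"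
  unfolding R_mu_def U\<zeta>[symmetric]
  by (rule E.bounded_vector_operator[OF V.fd_space_axioms U]) (use AdB \<sigma> U\<zeta> in simp_all)

lemma R_muop_U: assumes h: "h \<in> carrier H" shows "compose (carrier G) (R_muop N V \<pi> \<zeta>\<mu> H \<rho> h) U = A.elt h"
  unfolding R_muop_eq[OF h] using OpsD(5)[OF A.\<alpha>_ops[OF A.elt(1)[OF h]]]
  by (intro extensionalityI[of _ "carrier G"]) (auto simp: compose_def U_closed UsU)

lemma R_mu_U: assumes k: "k \<in> carrier K" shows "compose (carrier G) (R_mu N V \<pi> \<zeta>\<mu> K \<sigma> k) U = E.elt k"
  unfolding R_mu_eq[OF k] using OpsD(5)[OF E.\<alpha>_ops[OF E.elt(1)[OF k]]]
  by (intro extensionalityI[of _ "carrier G"]) (auto simp: compose_def U_closed UsU)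

abbreviation "\<psi> \<equiv> rel_form N V \<pi> \<zeta>\<mu> H \<rho> K \<sigma>"

lemma rel_form_eq:
  assumes h: "h \<in> carrier H" "h' \<in> carrier H" and k: "k \<in> carrier K" "k' \<in> carrier K"
  shows "\<psi> (h, k) (h', k') = \<phi> (A.elt h, \<zeta>, E.elt k) (A.elt h', \<zeta>, E.elt k')"
proof -
  note a = A.elt(1)[OF h(1)] and a' = A.elt(1)[OF h(2)] and e = E.elt(1)[OF k(1)] and e' = E.elt(1)[OF k(2)]
  have R: "compose (carrier V) (A.elt h) Us \<zeta>\<mu> = h" if "h \<in> carrier H" for h
    using U\<zeta> U_closed[OF A.\<zeta>] UsU[OF A.\<zeta>] A.elt(2)[OF that] by (auto simp: compose_eq)
  have R': "compose (carrier V) (E.elt k) Us \<zeta>\<mu> = k" if "k \<in> carrier K" for k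
    using U\<zeta> U_closed[OF A.\<zeta>] UsU[OF A.\<zeta>] E.elt(2)[OF that] by (auto simp: compose_eq)
  have adH: "adj V H (compose (carrier V) (A.elt h') Us) h = U (adj G H (A.elt h') h)"
    using adj_compose[OF V.fd_space_axioms A.G.fd_space_axioms A.H.fd_space_axioms Us_ops A.\<alpha>_ops[OF a']]
      GV.adj_adj[OF U_ops] h by (simp add: compose_eq)
  have adK: "adj V K (compose (carrier V) (E.elt k) Us) k' = U (adj G K (E.elt k) k')"
    using adj_compose[OF V.fd_space_axioms A.G.fd_space_axioms E.H.fd_space_axioms Us_ops E.\<alpha>_ops[OF e]]
      GV.adj_adj[OF U_ops] k by (simp add: compose_eq)
  have c: "adj G K (E.elt k) k' \<in> carrier G" using E.\<alpha>adj_closed[OF e k(2)] .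
  have "\<psi> (h, k) (h', k') = ip V (U (adj G H (A.elt h') h)) (U (adj G K (E.elt k) k'))"
    unfolding rel_form_def prod.case R_muop_eq[OF h(1)] R_muop_eq[OF h(2)] R_mu_eq[OF k(1)] R_mu_eq[OF k(2)]
      R[OF h(1)] R'[OF k(2)] adH adK ..
  also have "... = ip G (adj G H (A.elt h') h) (adj G K (E.elt k) k')"
    using GV.unitary_ip[OF U A.\<alpha>adj_closed[OF a' h(1)] c] .
  also have "... = ip H h (A.elt h' (adj G K (E.elt k) k'))"
    using A.GH.adj_ip2[OF A.\<alpha>_ops[OF a'] c h(1)] by simp
  also have "... = ip G \<zeta> (adj G H (A.elt h) (A.elt h' (adj G K (E.elt k) k')))"
    using A.GH.adj_ip[OF A.\<alpha>_ops[OF a] A.\<zeta> A.\<alpha>_closed[OF a' c]] A.elt(2)[OF h(1)] by simp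
  finally show ?thesis unfolding cst_form_apply using E.elt(2)[OF k(2)] by simp
qed

lemma pos_form_rel: "pos_form (carrier H \<times> carrier K) \<psi>"
proof (rule pos_form_pullback[OF pos_form_cst, where f = "\<lambda>(h, k). (A.elt h, \<zeta>, E.elt k)"])
  fix x assume "x \<in> carrier H \<times> carrier K"
  then show "(case x of (h, k) \<Rightarrow> (A.elt h, \<zeta>, E.elt k)) \<in> \<alpha> \<times> carrier G \<times> \<beta>" using A.elt(1) E.elt(1) A.\<zeta> by auto
next
  fix x y assume "x \<in> carrier H \<times> carrier K" "y \<in> carrier H \<times> carrier K"
  then show "\<psi> x y = \<phi> (case x of (h, k) \<Rightarrow> (A.elt h, \<zeta>, E.elt k)) (case y of (h, k) \<Rightarrow> (A.elt h, \<zeta>, E.elt k))"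
    using rel_form_eq by auto
qed

sublocale R: pos_form "carrier H \<times> carrier K" \<psi> by (rule pos_form_rel)

text \<open>\<open>W1\<close> is the classical relative tensor product and \<open>rel h k\<close> its elementary tensor \<open>h \<otimes> k\<close>.\<close>

abbreviation "W1 \<equiv> rel_tensor N V \<pi> \<zeta>\<mu> H \<rho> K \<sigma>"
abbreviation "rel \<equiv> rel_elem N V \<pi> \<zeta>\<mu> H \<rho> K \<sigma>"

lemma W1_eq: "sep_space (carrier H \<times> carrier K) \<psi> = W1" by (simp add: rel_tensor_def)
lemma rel_class: "sep_class (carrier H \<times> carrier K) \<psi> (h, k) = rel h k" by (simp add: rel_elem_def)

sublocale W1: ip_space W1 using R.ip_space_sep W1_eq by simp

lemma rel_closed: "h \<in> carrier H \<Longrightarrow> k \<in> carrier K \<Longrightarrow> rel h k \<in> carrier W1"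
  using R.class_closed[of "(h, k)"] by (simp add: W1_eq rel_class)

lemma ip_rel:
  assumes "h \<in> carrier H" "h' \<in> carrier H" "k \<in> carrier K" "k' \<in> carrier K"
  shows "ip W1 (rel h k) (rel h' k') = ip W (vec h k) (vec h' k')"
proof -
  have "ip W1 (rel h k) (rel h' k') = \<psi> (h, k) (h', k')"
    using R.ip_class[of "(h, k)" "(h', k')"] assms by (simp add: W1_eq rel_class)
  also have "... = ip W (vec h k) (vec h' k')"
    unfolding vec_def rel_form_eq[OF assms] cst_form_apply using assms by (simp add: ip_el A.elt(1) E.elt(1) A.\<zeta>)
  finally show ?thesis .
qed

lemma rel_span: "lspan W1 {rel h k |h k. h \<in> carrier H \<and> k \<in> carrier K} = carrier W1"
proof -
  have "sep_class (carrier H \<times> carrier K) \<psi> ` (carrier H \<times> carrier K) = {rel h k |h k. h \<in> carrier H \<and> k \<in> carrier K}"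
  proof -
    have "sep_class (carrier H \<times> carrier K) \<psi> ` (carrier H \<times> carrier K) = (\<lambda>(h, k). rel h k) ` (carrier H \<times> carrier K)"
      by (intro image_cong refl) (auto simp: rel_class)
    also have "... = {rel h k |h k. h \<in> carrier H \<and> k \<in> carrier K}" by auto
    finally show ?thesis .
  qed
  then show ?thesis using R.class_span by (simp add: W1_eq)
qed

lemma rel_eqI:
  assumes "P \<in> carrier W1" "Q \<in> carrier W1"
    "\<And>h k. h \<in> carrier H \<Longrightarrow> k \<in> carrier K \<Longrightarrow> ip W1 (rel h k) P = ip W1 (rel h k) Q"
  shows "P = Q"
  by (rule R.class_eqI) (use assms in \<open>auto simp: W1_eq rel_class\<close>)

lemma vec_linear:
  "h \<in> carrier H \<Longrightarrow> h' \<in> carrier H \<Longrightarrow> k \<in> carrier K \<Longrightarrow> vec (h \<oplus>\<^bsub>H\<^esub> h') k = vec h k \<oplus>\<^bsub>W\<^esub> vec h' k"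
  "h \<in> carrier H \<Longrightarrow> k \<in> carrier K \<Longrightarrow> vec (a \<odot>\<^bsub>H\<^esub> h) k = a \<odot>\<^bsub>W\<^esub> vec h k"
  "h \<in> carrier H \<Longrightarrow> k \<in> carrier K \<Longrightarrow> k' \<in> carrier K \<Longrightarrow> vec h (k \<oplus>\<^bsub>K\<^esub> k') = vec h k \<oplus>\<^bsub>W\<^esub> vec h k'"
  "h \<in> carrier H \<Longrightarrow> k \<in> carrier K \<Longrightarrow> vec h (a \<odot>\<^bsub>K\<^esub> k) = a \<odot>\<^bsub>W\<^esub> vec h k"
  by (auto simp: vec_def A.elt_add A.elt_smult E.elt_add E.elt_smult A.elt(1) E.elt(1) A.\<zeta>
        el_add_left el_add_right el_smult_left el_smult_right)

lemma fd_space_W1: "fd_space W1"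
proof (rule fin_dim_bilinear[OF A.H.fd_space_axioms E.H.fd_space_axioms W1.ip_space_axioms, where w = rel])
  show "rel h k \<in> carrier W1" if "h \<in> carrier H" "k \<in> carrier K" for h k using rel_closed that .
  show "lspan W1 {rel h k |h k. h \<in> carrier H \<and> k \<in> carrier K} = carrier W1" by (rule rel_span)
qed (rule rel_eqI; simp add: rel_closed ip_rel W1.ip_add_right W1.ip_smult_right vec_linear W.ip_add_right W.ip_smult_right vec_closed)+

sublocale W1: fd_space W1 by (rule fd_space_W1)
sublocale W1W: fd_pair W1 W ..
sublocale W1W1: fd_pair W1 W1 ..

abbreviation "\<Phi> \<equiv> Phi N V \<pi> \<zeta>\<mu> H \<rho> K \<sigma> G \<alpha> \<beta> U \<zeta>"

lemma Phi: "unitary W1 W \<Phi>" "h \<in> carrier H \<Longrightarrow> k \<in> carrier K \<Longrightarrow> \<Phi> (rel h k) = vec h k"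
proof -
  let ?I = "carrier H \<times> carrier K"
  have im: "(\<lambda>(h, k). rel h k) ` ?I = {rel h k |h k. h \<in> carrier H \<and> k \<in> carrier K}"
    "(\<lambda>(h, k). vec h k) ` ?I = {vec h k |h k. h \<in> carrier H \<and> k \<in> carrier K}" by auto
  have "\<exists>F. unitary W1 W F \<and> (\<forall>i\<in>?I. F ((\<lambda>(h, k). rel h k) i) = (\<lambda>(h, k). vec h k) i)"
  proof (rule W1W.unitary_extend)
    show "(\<lambda>(h, k). rel h k) \<in> ?I \<rightarrow> carrier W1" "(\<lambda>(h, k). vec h k) \<in> ?I \<rightarrow> carrier W" using rel_closed vec_closed by auto
    show "lspan W1 ((\<lambda>(h, k). rel h k) ` ?I) = carrier W1" "lspan W ((\<lambda>(h, k). vec h k) ` ?I) = carrier W"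
      unfolding im by (rule rel_span, rule vec_span)
    fix i j assume "i \<in> ?I" "j \<in> ?I"
    then show "ip W ((\<lambda>(h, k). vec h k) j) ((\<lambda>(h, k). vec h k) i) = ip W1 ((\<lambda>(h, k). rel h k) j) ((\<lambda>(h, k). rel h k) i)"
      using ip_rel by auto
  qed
  then obtain F where F: "unitary W1 W F" "\<forall>i\<in>?I. F ((\<lambda>(h, k). rel h k) i) = (\<lambda>(h, k). vec h k) i" by auto
  have Fr: "F (rel h k) = vec h k" if "h \<in> carrier H" "k \<in> carrier K" for h k using F(2) that by auto
  have tgt: "cst_elem H \<alpha> G K \<beta> (compose (carrier G) (R_muop N V \<pi> \<zeta>\<mu> H \<rho> h) U) \<zeta> (compose (carrier G) (R_mu N V \<pi> \<zeta>\<mu> K \<sigma> k) U) = vec h k"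
    if "h \<in> carrier H" "k \<in> carrier K" for h k
    using that by (simp add: R_muop_U R_mu_U vec_def)
  note Fo = W1W.unitary_ops[OF F(1)]
  have "\<Phi> = F"
    unfolding Phi_def
  proof (rule the_equality)
    show "F \<in> carrier (Ops W1 W) \<and> (\<forall>\<xi>\<in>carrier H. \<forall>\<eta>\<in>carrier K. F (rel \<xi> \<eta>) =
       cst_elem H \<alpha> G K \<beta> (compose (carrier G) (R_muop N V \<pi> \<zeta>\<mu> H \<rho> \<xi>) U) \<zeta> (compose (carrier G) (R_mu N V \<pi> \<zeta>\<mu> K \<sigma> \<eta>) U))"
      using Fo Fr tgt by simp
    fix F' assume F': "F' \<in> carrier (Ops W1 W) \<and> (\<forall>\<xi>\<in>carrier H. \<forall>\<eta>\<in>carrier K. F' (rel \<xi> \<eta>) =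
       cst_elem H \<alpha> G K \<beta> (compose (carrier G) (R_muop N V \<pi> \<zeta>\<mu> H \<rho> \<xi>) U) \<zeta> (compose (carrier G) (R_mu N V \<pi> \<zeta>\<mu> K \<sigma> \<eta>) U))"
    show "F' = F"
    proof (rule W1W.Ops_eq_on_span[OF _ Fo _ rel_span])
      show "F' \<in> carrier (Ops W1 W)" using F' by blast
      fix y assume "y \<in> {rel h k |h k. h \<in> carrier H \<and> k \<in> carrier K}"
      then obtain h k where y: "y = rel h k" and hk: "h \<in> carrier H" "k \<in> carrier K" by auto
      show "F' y = F y" unfolding y Fr[OF hk] using F' tgt[OF hk] hk by simp
    qed (auto intro: rel_closed)
  qed
  then show "unitary W1 W \<Phi>" "h \<in> carrier H \<Longrightarrow> k \<in> carrier K \<Longrightarrow> \<Phi> (rel h k) = vec h k" using F(1) Fr by auto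
qed

lemma Phi_elem:
  assumes "h \<in> carrier H" "k \<in> carrier K"
  shows "\<Phi> (rel h k) = cst_elem H \<alpha> G K \<beta> (compose (carrier G) (R_muop N V \<pi> \<zeta>\<mu> H \<rho> h) U) \<zeta>
      (compose (carrier G) (R_mu N V \<pi> \<zeta>\<mu> K \<sigma> k) U)"
  using Phi(2)[OF assms] assms by (simp add: R_muop_U R_mu_U vec_def)

abbreviation "\<Phi>s \<equiv> adj W1 W \<Phi>"

lemma \<Phi>_closed: "w \<in> carrier W1 \<Longrightarrow> \<Phi> w \<in> carrier W" using OpsD(2)[OF W1W.unitary_ops[OF Phi(1)]] .
lemma \<Phi>s_closed: "w \<in> carrier W \<Longrightarrow> \<Phi>s w \<in> carrier W1" using OpsD(2)[OF W1W.adj_closed[OF W1W.unitary_ops[OF Phi(1)]]] .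
lemma \<Phi>s\<Phi>: "w \<in> carrier W1 \<Longrightarrow> \<Phi>s (\<Phi> w) = w" using W1W.unitary_adj[OF Phi(1)] .
lemma \<Phi>\<Phi>s: "w \<in> carrier W \<Longrightarrow> \<Phi> (\<Phi>s w) = w" using W1W.unitary_adj'[OF Phi(1)] .

lemma tensor_op_eq:
  assumes s: "s \<in> A'" and t: "t \<in> B'"
  shows "tensor_op N V \<pi> \<zeta>\<mu> H \<rho> K \<sigma> s t \<in> carrier (Ops W1 W1)"
    and "w \<in> carrier W1 \<Longrightarrow> tensor_op N V \<pi> \<zeta>\<mu> H \<rho> K \<sigma> s t w = \<Phi>s (amp s t (\<Phi> w))"
proof -
  let ?Q = "compose (carrier W1) \<Phi>s (compose (carrier W1) (amp s t) \<Phi>)"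
  note \<Phi>o = W1W.unitary_ops[OF Phi(1)]
  have "compose (carrier W1) (amp s t) \<Phi> \<in> carrier (Ops W1 W)"
    by (rule compose_Ops[OF W1.fd_space_axioms W.fd_space_axioms W.fd_space_axioms \<Phi>o amp_ops[OF s t]])
  then have Q: "?Q \<in> carrier (Ops W1 W1)"
    by (rule compose_Ops[OF W1.fd_space_axioms W.fd_space_axioms W1.fd_space_axioms _ W1W.adj_closed[OF \<Phi>o]])
  have Qr: "?Q (rel h k) = rel (s h) (t k)" if hk: "h \<in> carrier H" "k \<in> carrier K" for h k
  proof -
    have c: "s h \<in> carrier H" "t k \<in> carrier K" using OpsD(2)[OF SA.commutantD(1)[OF s] hk(1)] OpsD(2)[OF SB.commutantD(1)[OF t] hk(2)] by auto
    have "?Q (rel h k) = \<Phi>s (vec (s h) (t k))" using rel_closed[OF hk] Phi(2)[OF hk] amp_vec[OF s t hk] by (simp add: compose_eq)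
    also have "... = \<Phi>s (\<Phi> (rel (s h) (t k)))" using Phi(2)[OF c] by simp
    finally show ?thesis using \<Phi>s\<Phi>[OF rel_closed[OF c]] by simp
  qed
  have e: "tensor_op N V \<pi> \<zeta>\<mu> H \<rho> K \<sigma> s t = ?Q"
    unfolding tensor_op_def
  proof (rule the_equality)
    show "?Q \<in> carrier (Lalg W1) \<and> (\<forall>\<xi>\<in>carrier H. \<forall>\<eta>\<in>carrier K. ?Q (rel \<xi> \<eta>) = rel (s \<xi>) (t \<eta>))" using Q Qr by simp
    fix Q' assume Q': "Q' \<in> carrier (Lalg W1) \<and> (\<forall>\<xi>\<in>carrier H. \<forall>\<eta>\<in>carrier K. Q' (rel \<xi> \<eta>) = rel (s \<xi>) (t \<eta>))"
    show "Q' = ?Q"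
    proof (rule W1W1.Ops_eq_on_span[OF _ Q _ rel_span])
      show "Q' \<in> carrier (Ops W1 W1)" using Q' by simp
      fix y assume "y \<in> {rel h k |h k. h \<in> carrier H \<and> k \<in> carrier K}"
      then obtain h k where y: "y = rel h k" and hk: "h \<in> carrier H" "k \<in> carrier K" by auto
      show "Q' y = ?Q y" unfolding y Qr[OF hk] using Q' hk by simp
    qed (auto intro: rel_closed)
  qed
  show "tensor_op N V \<pi> \<zeta>\<mu> H \<rho> K \<sigma> s t \<in> carrier (Ops W1 W1)" unfolding e by (rule Q)
  show "tensor_op N V \<pi> \<zeta>\<mu> H \<rho> K \<sigma> s t w = \<Phi>s (amp s t (\<Phi> w))" if "w \<in> carrier W1"
    unfolding e using that by (simp add: compose_eq)
qed

text \<open>The operators \<open>s \<otimes> t\<close> on the two relative tensor products correspond to each other under \<open>\<Phi>\<close>.\<close>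

lemma classical_fiber_iff:
  "T \<in> classical_fiber N V \<pi> \<zeta>\<mu> H \<rho> AA K \<sigma> BB \<longleftrightarrow> T \<in> carrier (Ops W1 W1) \<and>
    (\<forall>s\<in>A'. \<forall>t\<in>B'. \<forall>w\<in>carrier W1. T (\<Phi>s (amp s t (\<Phi> w))) = \<Phi>s (amp s t (\<Phi> (T w))))"
proof -
  have *: "compose (carrier W1) T (tensor_op N V \<pi> \<zeta>\<mu> H \<rho> K \<sigma> s t) = compose (carrier W1) (tensor_op N V \<pi> \<zeta>\<mu> H \<rho> K \<sigma> s t) T
     \<longleftrightarrow> (\<forall>w\<in>carrier W1. T (\<Phi>s (amp s t (\<Phi> w))) = \<Phi>s (amp s t (\<Phi> (T w))))"
    if T: "T \<in> carrier (Ops W1 W1)" and s: "s \<in> A'" and t: "t \<in> B'" for s t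
    using tensor_op_eq(2)[OF s t] OpsD(2)[OF T] by (auto simp: compose_def fun_eq_iff)
  have "T \<in> classical_fiber N V \<pi> \<zeta>\<mu> H \<rho> AA K \<sigma> BB \<longleftrightarrow> T \<in> carrier (Ops W1 W1) \<and>
     (\<forall>s\<in>A'. \<forall>t\<in>B'. compose (carrier W1) T (tensor_op N V \<pi> \<zeta>\<mu> H \<rho> K \<sigma> s t) = compose (carrier W1) (tensor_op N V \<pi> \<zeta>\<mu> H \<rho> K \<sigma> s t) T)"
    unfolding classical_fiber_def commutant_def[of W1] by auto
  also have "... \<longleftrightarrow> T \<in> carrier (Ops W1 W1) \<and>
    (\<forall>s\<in>A'. \<forall>t\<in>B'. \<forall>w\<in>carrier W1. T (\<Phi>s (amp s t (\<Phi> w))) = \<Phi>s (amp s t (\<Phi> (T w))))"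
    by (intro conj_cong ball_cong refl) (rule *)
  finally show ?thesis .
qed

lemma Ad_fiber: "spatial_fiber H \<alpha> AA G K \<beta> BB = Ad W1 W \<Phi> ` classical_fiber N V \<pi> \<zeta>\<mu> H \<rho> AA K \<sigma> BB"
proof
  show "Ad W1 W \<Phi> ` classical_fiber N V \<pi> \<zeta>\<mu> H \<rho> AA K \<sigma> BB \<subseteq> spatial_fiber H \<alpha> AA G K \<beta> BB"
  proof clarify
    fix T assume "T \<in> classical_fiber N V \<pi> \<zeta>\<mu> H \<rho> AA K \<sigma> BB"
    then have T: "T \<in> carrier (Ops W1 W1)"
      and c: "\<And>s t w. s \<in> A' \<Longrightarrow> t \<in> B' \<Longrightarrow> w \<in> carrier W1 \<Longrightarrow> T (\<Phi>s (amp s t (\<Phi> w))) = \<Phi>s (amp s t (\<Phi> (T w)))"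
      using classical_fiber_iff by auto
    show "Ad W1 W \<Phi> T \<in> spatial_fiber H \<alpha> AA G K \<beta> BB"
      unfolding spatial_fiber_eq
    proof (intro CollectI conjI ballI)
      show "Ad W1 W \<Phi> T \<in> carrier (Ops W W)" using W1W.Ad_ops[OF Phi(1) T] .
      fix s t w assume s: "s \<in> A'" and t: "t \<in> B'" and w: "w \<in> carrier W"
      note ac = OpsD(2)[OF amp_ops[OF s t]]
      show "Ad W1 W \<Phi> T (amp s t w) = amp s t (Ad W1 W \<Phi> T w)"
        using c[OF s t \<Phi>s_closed[OF w]] ac w
        by (simp add: W1W.Ad_apply \<Phi>\<Phi>s \<Phi>s_closed \<Phi>_closed OpsD(2)[OF T])
    qed
  qed
  show "spatial_fiber H \<alpha> AA G K \<beta> BB \<subseteq> Ad W1 W \<Phi> ` classical_fiber N V \<pi> \<zeta>\<mu> H \<rho> AA K \<sigma> BB"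
  proof
    fix T assume "T \<in> spatial_fiber H \<alpha> AA G K \<beta> BB"
    then have T: "T \<in> carrier (Ops W W)"
      and c: "\<And>s t w. s \<in> A' \<Longrightarrow> t \<in> B' \<Longrightarrow> w \<in> carrier W \<Longrightarrow> T (amp s t w) = amp s t (T w)"
      unfolding spatial_fiber_eq by auto
    interpret WW1: fd_pair W W1 ..
    let ?S = "Ad W W1 \<Phi>s T"
    have S: "?S \<in> carrier (Ops W1 W1)"
      using WW1.Ad_ops[OF W1W.unitary_adj_unitary[OF Phi(1)] T] .
    have Sx: "?S x = \<Phi>s (T (\<Phi> x))" if "x \<in> carrier W1" for x
      using WW1.Ad_apply[OF that, of \<Phi>s T] W1W.adj_adj[OF W1W.unitary_ops[OF Phi(1)]] by simp
    have "?S \<in> classical_fiber N V \<pi> \<zeta>\<mu> H \<rho> AA K \<sigma> BB"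
      unfolding classical_fiber_iff
    proof (intro conjI ballI)
      fix s t w assume s: "s \<in> A'" and t: "t \<in> B'" and w: "w \<in> carrier W1"
      note ac = OpsD(2)[OF amp_ops[OF s t]]
      show "?S (\<Phi>s (amp s t (\<Phi> w))) = \<Phi>s (amp s t (\<Phi> (?S w)))"
        using w ac c[OF s t \<Phi>_closed[OF w]] by (simp add: Sx \<Phi>_closed \<Phi>s_closed \<Phi>\<Phi>s OpsD(2)[OF T])
    qed (rule S)
    moreover have "T = Ad W1 W \<Phi> ?S"
    proof (rule Ops_eqI[OF T W1W.Ad_ops[OF Phi(1) S]])
      fix x assume x: "x \<in> carrier W"
      show "T x = Ad W1 W \<Phi> ?S x" using x by (simp add: W1W.Ad_apply Sx \<Phi>s_closed \<Phi>\<Phi>s OpsD(2)[OF T])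
    qed
    ultimately show "T \<in> Ad W1 W \<Phi> ` classical_fiber N V \<pi> \<zeta>\<mu> H \<rho> AA K \<sigma> BB" by blast
  qed
qed

theorem Ad_Phi_star_iso:
  "Ad W1 W \<Phi> \<in> star_iso ((Lalg W1)\<lparr>carrier := classical_fiber N V \<pi> \<zeta>\<mu> H \<rho> AA K \<sigma> BB\<rparr>)
     ((Lalg W)\<lparr>carrier := spatial_fiber H \<alpha> AA G K \<beta> BB\<rparr>)"
  by (rule W1W.Ad_star_iso[OF Phi(1) _ Ad_fiber]) (auto simp: classical_fiber_iff)

end

section \<open>The isomorphism of the fiber products\<close>

lemma ip_space_hilbert: "hilbert_space V \<Longrightarrow> ip_space V"
  unfolding hilbert_space_def hilbert_space_axioms_def ip_space_def ip_space_axioms_def cvec_def by blast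

lemma fd_space_hilbert: "hilbert_space V \<Longrightarrow> fin_dim V \<Longrightarrow> fd_space V"
  unfolding fd_space_def fd_space_axioms_def using ip_space_hilbert by blast

lemma cstar_subalgebraD:
  assumes "cstar_subalgebra A V"
  shows "submodule A CC (Ops V V)" "S \<in> A \<Longrightarrow> T \<in> A \<Longrightarrow> compose (carrier V) S T \<in> A" "T \<in> A \<Longrightarrow> adj V V T \<in> A"
  using assms unfolding cstar_subalgebra_def closed_subspace_def by (auto simp: submodule_Lalg)

lemma (in fd_space) cyclic_surj:
  assumes A: "submodule A CC (Ops V V)" and c: "cyclic A V z" and x: "x \<in> carrier V"
  shows "\<exists>T\<in>A. T z = x"
proof -
  interpret VV: fd_pair V V ..
  have z: "z \<in> carrier V" using c by (simp add: cyclic_def)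
  note Ac = VV.O.submoduleD(1)[OF A]
  let ?M = "{T z |T. T \<in> A}"
  have M: "?M \<subseteq> carrier V" using OpsD(2)[OF subsetD[OF Ac] z] by auto
  have "submodule ?M CC V"
  proof (rule submoduleI')
    show "\<zero>\<^bsub>V\<^esub> \<in> ?M" using VV.O.submoduleD(2)[OF A] z by (auto intro!: exI[of _ "zero (Ops V V)"])
  next
    fix x y assume "x \<in> ?M" "y \<in> ?M"
    then obtain S T where "S \<in> A" "T \<in> A" "x = S z" "y = T z" by auto
    then show "x \<oplus>\<^bsub>V\<^esub> y \<in> ?M" using VV.O.submoduleD(3)[OF A] z by (auto intro!: exI[of _ "S \<oplus>\<^bsub>Ops V V\<^esub> T"])
  next
    fix k x assume "x \<in> ?M"
    then obtain S where "S \<in> A" "x = S z" by auto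
    then show "k \<odot>\<^bsub>V\<^esub> x \<in> ?M" using VV.O.submoduleD(4)[OF A] z by (auto intro!: exI[of _ "k \<odot>\<^bsub>Ops V V\<^esub> S"])
  qed (use M in auto)
  then have "lspan V ?M \<subseteq> ?M" by (rule lspan_least) simp
  moreover have "lspan V ?M = carrier V" using c cspan_eq_lspan[OF M] by (simp add: cyclic_def)
  ultimately show ?thesis using x by auto
qed

lemma base_standard:
  assumes b: "cstar_base G B Bd" and f: "fin_dim G" and z: "bicyclic G B Bd \<zeta>"
  shows "base G B Bd \<zeta>"
proof -
  have h: "hilbert_space G" and B: "cstar_subalgebra B G" and Bd: "cstar_subalgebra Bd G"
    and c: "\<And>b c. b \<in> B \<Longrightarrow> c \<in> Bd \<Longrightarrow> compose (carrier G) b c = compose (carrier G) c b"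
    using b unfolding cstar_base_def by auto
  interpret fd_space G using fd_space_hilbert[OF h f] .
  interpret GG: fd_pair G G ..
  note B' = cstar_subalgebraD[OF B] and Bd' = cstar_subalgebraD[OF Bd]
  have zB: "cyclic B G \<zeta>" and zBd: "cyclic Bd G \<zeta>" using z by (auto simp: bicyclic_def)
  show ?thesis
  proof
    show "\<And>b. b \<in> B \<Longrightarrow> b \<in> carrier (Ops G G)" using GG.O.submoduleD(1)[OF B'(1)] by auto
    show "\<And>b. b \<in> Bd \<Longrightarrow> b \<in> carrier (Ops G G)" using GG.O.submoduleD(1)[OF Bd'(1)] by auto
    show "b (d x) = d (b x)" if "b \<in> B" "d \<in> Bd" "x \<in> carrier G" for b d x
      using fun_cong[OF c[OF that(1,2)], of x] that(3) by (simp add: compose_eq)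
    show "\<zeta> \<in> carrier G" using zB by (simp add: cyclic_def)
    show "\<And>x. x \<in> carrier G \<Longrightarrow> \<exists>b\<in>B. b \<zeta> = x" using cyclic_surj[OF B'(1) zB] .
    show "\<And>x. x \<in> carrier G \<Longrightarrow> \<exists>b\<in>Bd. b \<zeta> = x" using cyclic_surj[OF Bd'(1) zBd] .
  qed
qed

lemma base_swap: "base G B Bd \<zeta> \<Longrightarrow> base G Bd B \<zeta>"
  unfolding base_def base_axioms_def by simp

lemma factor_standard:
  assumes b: "base G B Bd \<zeta>" and H: "fd_space H" and a: "cstar_factorization H G B Bd \<alpha>"
  shows "factor G B Bd \<zeta> H \<alpha>"
proof -
  interpret base G B Bd \<zeta> by fact
  interpret H: fd_space H by fact
  interpret GH: fd_pair G H ..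
  have cs: "submodule \<alpha> CC (Ops G H)"
    and BB: "cspan (Lalg G) {compose (carrier G) (adj G H \<xi>) \<xi>' |\<xi> \<xi>'. \<xi> \<in> \<alpha> \<and> \<xi>' \<in> \<alpha>} = B"
    and aB: "cspan (Ops G H) {compose (carrier G) \<xi> b |\<xi> b. \<xi> \<in> \<alpha> \<and> b \<in> B} = \<alpha>"
    and aG: "cspan H {\<xi> \<omega> |\<xi> \<omega>. \<xi> \<in> \<alpha> \<and> \<omega> \<in> carrier G} = carrier H"
    using a unfolding cstar_factorization_def closed_subspace_def by auto
  have ao: "\<And>\<xi>. \<xi> \<in> \<alpha> \<Longrightarrow> \<xi> \<in> carrier (Ops G H)" using GH.O.submoduleD(1)[OF cs] by auto
  have 1: "{compose (carrier G) (adj G H \<xi>) \<xi>' |\<xi> \<xi>'. \<xi> \<in> \<alpha> \<and> \<xi>' \<in> \<alpha>} \<subseteq> carrier (Ops G G)"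
    using compose_Ops[OF G.fd_space_axioms H.fd_space_axioms G.fd_space_axioms ao GH.adj_closed[OF ao]] by auto
  have 2: "{compose (carrier G) \<xi> b |\<xi> b. \<xi> \<in> \<alpha> \<and> b \<in> B} \<subseteq> carrier (Ops G H)"
    using compose_Ops[OF G.fd_space_axioms G.fd_space_axioms H.fd_space_axioms B_ops ao] by auto
  have 3: "{\<xi> \<omega> |\<xi> \<omega>. \<xi> \<in> \<alpha> \<and> \<omega> \<in> carrier G} \<subseteq> carrier H" using OpsD(2)[OF ao] by auto
  have B1: "B = lspan (Ops G G) {compose (carrier G) (adj G H \<xi>) \<xi>' |\<xi> \<xi>'. \<xi> \<in> \<alpha> \<and> \<xi>' \<in> \<alpha>}"
    using BB G.cspan_Lalg_eq[OF 1] by simp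
  have a1: "\<alpha> = lspan (Ops G H) {compose (carrier G) \<xi> b |\<xi> b. \<xi> \<in> \<alpha> \<and> b \<in> B}"
    using aB GH.cspan_Ops[OF 2] by simp
  show ?thesis
  proof (intro factor.intro factor_axioms.intro b H)
    show "submodule \<alpha> CC (Ops G H)" by (rule cs)
    show "compose (carrier G) (adj G H a) a' \<in> B" if "a \<in> \<alpha>" "a' \<in> \<alpha>" for a a'
      by (subst B1, rule subsetD[OF GG.O.lspan_base]) (use that in auto)
    show "compose (carrier G) a b \<in> \<alpha>" if "a \<in> \<alpha>" "b \<in> B" for a b
      by (subst a1, rule subsetD[OF GH.O.lspan_base]) (use that in auto)
    show "lspan H {a \<omega> |a \<omega>. a \<in> \<alpha> \<and> \<omega> \<in> carrier G} = carrier H" using aG H.cspan_eq_lspan[OF 3] by simp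
  qed
qed

lemma star_subalg_standard:
  assumes H: "fd_space H" and A: "cstar_subalgebra A H" and 1: "one (Lalg H) \<in> A"
  shows "star_subalg H A"
  using H cstar_subalgebraD[OF A] 1 unfolding star_subalg_def star_subalg_axioms_def by simp

theorem proposition3p1:
  fixes H :: "'h hilb" and K :: "'k hilb" and G :: "'g hilb" and V :: "'v hilb"
    and N :: "'n cstar" and \<mu> :: "'n \<Rightarrow> complex"
    and A :: "('h \<Rightarrow> 'h) set" and B :: "('k \<Rightarrow> 'k) set"
    and \<rho> :: "'n \<Rightarrow> 'h \<Rightarrow> 'h" and \<sigma> :: "'n \<Rightarrow> 'k \<Rightarrow> 'k"
    and \<BB> \<BB>d :: "('g \<Rightarrow> 'g) set" and \<zeta> :: 'g
    and \<alpha> :: "('g \<Rightarrow> 'h) set" and \<beta> :: "('g \<Rightarrow> 'k) set"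
    and \<pi> :: "'n \<Rightarrow> 'v \<Rightarrow> 'v" and \<zeta>\<mu> :: 'v and U :: "'g \<Rightarrow> 'v"
  assumes "hilbert_space H" and "fin_dim H" and "hilbert_space K" and "fin_dim K"
    and "cstar_subalgebra A H" and "nondegenerate A H"
    and "cstar_subalgebra B K" and "nondegenerate B K"
    and "cstar_algebra N" and "fin_dim N" and "faithful_state N \<mu>"
    and "GNS N \<mu> V \<pi> \<zeta>\<mu>"
    and "\<rho> \<in> star_hom (opposite N) ((Lalg H)\<lparr>carrier := A\<rparr>)"
    and "inj_on \<rho> (carrier N)" and "\<rho> \<one>\<^bsub>N\<^esub> = \<one>\<^bsub>Lalg H\<^esub>"
    and "\<sigma> \<in> star_hom N ((Lalg K)\<lparr>carrier := B\<rparr>)"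
    and "inj_on \<sigma> (carrier N)" and "\<sigma> \<one>\<^bsub>N\<^esub> = \<one>\<^bsub>Lalg K\<^esub>"
    and "cstar_base G \<BB> \<BB>d" and "fin_dim G" and "bicyclic G \<BB> \<BB>d \<zeta>"
    and "cstar_factorization H G \<BB> \<BB>d \<alpha>" and "fact_rep H G \<alpha> ` \<BB>d \<subseteq> A"
    and "cstar_factorization K G \<BB>d \<BB> \<beta>" and "fact_rep K G \<beta> ` \<BB> \<subseteq> B"
    and "unitary G V U"
    and "Ad G V U ` \<BB> = \<pi> ` carrier N"
    and "Ad G V U ` \<BB>d = GNS_op N V \<pi> \<zeta>\<mu> ` carrier N"
    and "U \<zeta> = \<zeta>\<mu>"
    and "\<forall>b\<in>carrier N. \<rho> b = fact_rep H G \<alpha> (Ad V G (adj G V U) (GNS_op N V \<pi> \<zeta>\<mu> b))"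
    and "\<forall>b\<in>carrier N. \<sigma> b = fact_rep K G \<beta> (Ad V G (adj G V U) (\<pi> b))"
  shows "let W1 = rel_tensor N V \<pi> \<zeta>\<mu> H \<rho> K \<sigma>;
             W2 = cst_tensor H \<alpha> G K \<beta>;
             \<Phi> = Phi N V \<pi> \<zeta>\<mu> H \<rho> K \<sigma> G \<alpha> \<beta> U \<zeta>
         in unitary W1 W2 \<Phi> \<and>
            (\<forall>\<xi>\<in>carrier H. \<forall>\<eta>\<in>carrier K. \<Phi> (rel_elem N V \<pi> \<zeta>\<mu> H \<rho> K \<sigma> \<xi> \<eta>) =
               cst_elem H \<alpha> G K \<beta> (compose (carrier G) (R_muop N V \<pi> \<zeta>\<mu> H \<rho> \<xi>) U) \<zeta>
                 (compose (carrier G) (R_mu N V \<pi> \<zeta>\<mu> K \<sigma> \<eta>) U)) \<and>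
            Ad W1 W2 \<Phi> \<in> star_iso
               ((Lalg W1)\<lparr>carrier := classical_fiber N V \<pi> \<zeta>\<mu> H \<rho> A K \<sigma> B\<rparr>)
               ((Lalg W2)\<lparr>carrier := spatial_fiber H \<alpha> A G K \<beta> B\<rparr>)"
proof -
  note hyps = assms
  have H: "fd_space H" and K: "fd_space K" using fd_space_hilbert hyps(1-4) by auto
  have base: "base G \<BB> \<BB>d \<zeta>" using base_standard hyps(19-21) .
  have G: "fd_space G" using base by (simp add: base_def)
  have V: "fd_space V"
  proof (rule fd_space_unitary_image[OF G ip_space_hilbert hyps(26)])
    show "hilbert_space V" using hyps(12) by (simp add: GNS_def)
  qed
  have one: "\<one>\<^bsub>N\<^esub> \<in> carrier N"
    using hyps(9) by (simp add: cstar_algebra_def ring.ring_simprules)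
  \<comment> \<open>\<open>A\<close> and \<open>B\<close> contain the identity because \<open>\<rho>\<close> and \<open>\<sigma>\<close> are unital.\<close>
  have "\<one>\<^bsub>Lalg H\<^esub> \<in> A"
  proof -
    have "\<rho> \<in> carrier N \<rightarrow> A" using hyps(13) by (simp add: star_hom_def opposite_def)
    then show ?thesis using one hyps(15) by (metis funcset_mem)
  qed
  then have A: "star_subalg H A" using star_subalg_standard[OF H hyps(5)] by blast
  have "\<one>\<^bsub>Lalg K\<^esub> \<in> B"
  proof -
    have "\<sigma> \<in> carrier N \<rightarrow> B" using hyps(16) by (simp add: star_hom_def)
    then show ?thesis using one hyps(18) by (metis funcset_mem)
  qed
  then have B: "star_subalg K B" using star_subalg_standard[OF K hyps(7)] by blast
  interpret gns_setting G \<BB> \<BB>d \<zeta> H \<alpha> K \<beta> A B V N \<pi> \<zeta>\<mu> \<rho> \<sigma> U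
  proof (intro gns_setting.intro two_algebras.intro two_factors.intro two_algebras_axioms.intro gns_setting_axioms.intro)
    show "factor G \<BB> \<BB>d \<zeta> H \<alpha>" using factor_standard[OF base H hyps(22)] .
    show "factor G \<BB>d \<BB> \<zeta> K \<beta>" using factor_standard[OF base_swap[OF base] K hyps(24)] .
  qed (use A B V hyps in auto)
  show ?thesis
    unfolding Let_def using Phi(1) Phi_elem Ad_Phi_star_iso by blast
qed

end
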